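(* Let $0<\nu\le\tfrac12$, $\lambda>0$, $k\in\mathbb{N}$, $\lambda_1,\dots,\lambda_k>0$ and $\Lambda=\lambda_1+\dots+\lambda_k$. Let $M$ be the generalized counting process with parameters $\lambda_1,\dots,\lambda_k$, independent of the inverse process $\mathcal{L}^\nu$ of $H_1^{2\nu}(t)+(2\lambda)^{1/\nu}H_2^\nu(t)$. Then the probabilities $\tilde p_n^\nu(t)=\mathsf{P}\{M(\mathcal{L}^\nu(t))=n\}$ satisfy $$\frac{d^{2\nu}\tilde p_n^\nu(t)}{dt^{2\nu}}+2\lambda\frac{d^\nu\tilde p_n^\nu(t)}{dt^\nu}=-\Lambda\tilde p_n^\nu(t)+\sum_{j=1}^{\min\{n,k\}}\lambda_j\tilde p_{n-j}^\nu(t),\quad n\ge0,$$ with $\tilde p_0^\nu(0)=1$, $\tilde p_n^\nu(0)=0$ for $n\ge1$ (fractional derivatives in the Caputo–Djrbashian sense). The solution $\tilde p_n^\nu(t)$, for $n=0,1,\dots$ and $t\ge0$, is given as follows. If $\lambda=\Lambda^{1/2}$, $$\tilde p_n^\nu(t)=\sum_{r=0}^n\ \sum_{\substack{\alpha_1+\dots+\alpha_k=r\\ \alpha_1+2\alpha_2+\dots+k\alpha_k=n}}\binom{r}{\alpha_1,\dots,\alpha_k}\lambda_1^{\alpha_1}\cdots\lambda_k^{\alpha_k}\left(t^{2r\nu}E_{\nu,2r\nu+1}^{2r+1}(-\Lambda^{1/2}t^\nu)+\Lambda^{1/2}t^{(2r+1)\nu}E_{\nu,(2r+1)\nu+1}^{2r+2}(-\Lambda^{1/2}t^\nu)\right).$$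 If $\lambda>\Lambda^{1/2}$, $$\tilde p_n^\nu(t)=\sum_{r=0}^n\ \sum_{\substack{\alpha_1+\dots+\alpha_k=r\\ \alpha_1+2\alpha_2+\dots+k\alpha_k=n}}\binom{r}{\alpha_1,\dots,\alpha_k}\lambda_1^{\alpha_1}\cdots\lambda_k^{\alpha_k}\left(\lambda^{2r}t^{2r\nu}E_{\nu,2r\nu+1}^{r+1,r+1}(p_1t^\nu,p_2t^\nu)+\lambda^{2r+1}t^{(2r+1)\nu}E_{\nu,(2r+1)\nu+1}^{r+1,r+1}(p_1t^\nu,p_2t^\nu)\right),$$ where $p_1=-\lambda+\sqrt{\lambda^2-\Lambda}$, $p_2=-\lambda-\sqrt{\lambda^2-\Lambda}$. The inner sums run over nonnegative integers $\alpha_1,\dots,\alpha_k$.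
   Context: The generalized counting process $M(t)$, $t\ge0$, with parameters $\lambda_1,\dots,\lambda_k>0$ is the counting process ($\mathbb{N}_0$-valued) with $M(0)=0$ a.s., stationary and independent increments, $\mathsf{P}\{M(h)=j\}=\lambda_jh+o(h)$ for $j=1,\dots,k$, and $\mathsf{P}\{M(h)>k\}=o(h)$ as $h\downarrow 0$. For $\beta\in(0,1)$, a stable subordinator $H^{\beta}$ is a nondecreasing Lévy process with $\mathsf{E}e^{-sH^{\beta}(t)}=e^{-ts^{\beta}}$, $s>0$; for $\beta=1$ set $H^1(t)=t$. $H_1^{2\nu}$ and $H_2^\nu$ are independent stable subordinators of orders $2\nu$ and $\nu$. The inverse process is $\mathcal{L}^\nu(t)=\inf\{s>0: H_1^{2\nu}(s)+(2\lambda)^{1/\nu}H_2^\nu(s)\ge t\}$, $t>0$. The Caputo–Djrbashian derivative of order $\beta\in(0,1)$ is $\frac{d^{\beta}}{dt^{\beta}}u(t)=\frac{1}{\Gamma(1-\beta)}\int_0^t \frac{u'(s)}{(t-s)^{\beta}}\,ds$; for $\beta=1$ it is the ordinary derivative. Mittag-Leffler functions: $E_{\alpha,\beta}^{\gamma}(z)=\sum_{r=0}^\infty\frac{(\gamma)_rz^r}{r!\,\Gamma(\alpha r+\beta)}$ and $$E_{\alpha,\beta}^{\gamma_1,\gamma_2}(z_1,z_2)=\sum_{k_1=0}^\infty\sum_{k_2=0}^\infty\frac{(\gamma_1)_{k_1}(\gamma_2)_{k_2}}{\Gamma(\alpha(k_1+k_2)+\beta)}\frac{z_1^{k_1}}{k_1!}\frac{z_2^{k_2}}{k_2!},$$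 with $(\gamma)_0=1$, $(\gamma)_r=\gamma(\gamma+1)\cdots(\gamma+r-1)$ for $r\ge1$. $\binom{r}{\alpha_1,\dots,\alpha_k}=\frac{r!}{\alpha_1!\cdots\alpha_k!}$ is the multinomial coefficient.
   Formalization: In the case λ>Λ^{1/2}, the coefficients λ^{2r} and λ^{2r+1} of the two Mittag-Leffler terms are replaced by 1 and 2λ; as printed the formula is false (for n=0 it has a term -λt^ν/Γ(ν+1), which the probability lacks). *)

theory Defs
  imports "HOL-Probability.Probability" "HOL-Library.Landau_Symbols"
begin

section \<open>Processes indexed by the half-line\<close>

text \<open>
  A process is a function of time and of the sample point; only times \<open>t \<ge> 0\<close> matter.
  Path properties are required for every sample point.
\<close>

definition independent_increments ::
    "'a measure \<Rightarrow> (real \<Rightarrow> 'a \<Rightarrow> real) \<Rightarrow> bool" where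
  "independent_increments M X \<longleftrightarrow>
     (\<forall>(n::nat) \<tau>. 0 \<le> \<tau> 0 \<and> (\<forall>i<n. \<tau> i \<le> \<tau> (Suc i)) \<longrightarrow>
        prob_space.indep_vars M (\<lambda>_. borel)
          (\<lambda>i \<omega>. X (\<tau> (Suc i)) \<omega> - X (\<tau> i) \<omega>) {..<n})"

definition stationary_increments ::
    "'a measure \<Rightarrow> (real \<Rightarrow> 'a \<Rightarrow> real) \<Rightarrow> bool" where
  "stationary_increments M X \<longleftrightarrow>
     (\<forall>s\<ge>0. \<forall>h\<ge>0. distr M borel (\<lambda>\<omega>. X (s + h) \<omega> - X s \<omega>)
                  = distr M borel (\<lambda>\<omega>. X h \<omega> - X 0 \<omega>))"

definition cadlag_on_halfline :: "(real \<Rightarrow> real) \<Rightarrow> bool" where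
  "cadlag_on_halfline x \<longleftrightarrow>
     (\<forall>t\<ge>0. continuous (at_right t) x) \<and> (\<forall>t>0. \<exists>l. (x \<longlongrightarrow> l) (at_left t))"

definition levy_process :: "'a measure \<Rightarrow> (real \<Rightarrow> 'a \<Rightarrow> real) \<Rightarrow> bool" where
  "levy_process M X \<longleftrightarrow>
     (\<forall>t\<ge>0. X t \<in> borel_measurable M) \<and>
     (AE \<omega> in M. X 0 \<omega> = 0) \<and>
     independent_increments M X \<and>
     stationary_increments M X \<and>
     (\<forall>t\<ge>0. \<forall>\<epsilon>>0.
        ((\<lambda>s. measure M {\<omega> \<in> space M. \<bar>X s \<omega> - X t \<omega>\<bar> > \<epsilon>}) \<longlongrightarrow> 0) (at t within {0..})) \<and>
     (\<forall>\<omega>\<in>space M. cadlag_on_halfline (\<lambda>t. X t \<omega>))"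

text \<open>
  Independence of whole processes: the random functions on \<open>[0,\<infinity>)\<close> are independent with
  respect to the product \<open>\<sigma>\<close>-algebra.
\<close>

definition independent_processes ::
    "'a measure \<Rightarrow> (real \<Rightarrow> 'a \<Rightarrow> real) \<Rightarrow> (real \<Rightarrow> 'a \<Rightarrow> real) \<Rightarrow> bool" where
  "independent_processes M X Y \<longleftrightarrow>
     prob_space.indep_var M
       (\<Pi>\<^sub>M t\<in>{0..}. borel) (\<lambda>\<omega>. \<lambda>t\<in>{0..}. X t \<omega>)
       (\<Pi>\<^sub>M t\<in>{0..}. borel) (\<lambda>\<omega>. \<lambda>t\<in>{0..}. Y t \<omega>)"

section \<open>The generalized counting process and its random time\<close>

text \<open>The rates are \<open>lam 1, \<dots>, lam k\<close>; other values of \<open>lam\<close> are irrelevant.\<close>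

definition generalized_counting_process ::
    "'a measure \<Rightarrow> nat \<Rightarrow> (nat \<Rightarrow> real) \<Rightarrow> (real \<Rightarrow> 'a \<Rightarrow> nat) \<Rightarrow> bool" where
  "generalized_counting_process M k lam N \<longleftrightarrow>
     (\<forall>t\<ge>0. N t \<in> measurable M (count_space UNIV)) \<and>
     (\<forall>\<omega>\<in>space M. mono_on {0..} (\<lambda>t. N t \<omega>) \<and> (\<forall>t\<ge>0. continuous (at_right t) (\<lambda>t. N t \<omega>))) \<and>
     (AE \<omega> in M. N 0 \<omega> = 0) \<and>
     independent_increments M (\<lambda>t \<omega>. real (N t \<omega>)) \<and>
     stationary_increments M (\<lambda>t \<omega>. real (N t \<omega>)) \<and>
     (\<forall>j\<in>{1..k}.
        (\<lambda>h. measure M {\<omega> \<in> space M. N h \<omega> = j} - lam j * h) \<in> o[at_right 0](\<lambda>h. h)) \<and>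
     (\<lambda>h. measure M {\<omega> \<in> space M. N h \<omega> > k}) \<in> o[at_right 0](\<lambda>h. h)"

definition stable_subordinator ::
    "'a measure \<Rightarrow> real \<Rightarrow> (real \<Rightarrow> 'a \<Rightarrow> real) \<Rightarrow> bool" where
  "stable_subordinator M \<beta> H \<longleftrightarrow>
     (if \<beta> = 1 then \<forall>t\<ge>0. \<forall>\<omega>\<in>space M. H t \<omega> = t
      else 0 < \<beta> \<and> \<beta> < 1 \<and>
        levy_process M H \<and>
        (\<forall>\<omega>\<in>space M. mono_on {0..} (\<lambda>t. H t \<omega>)) \<and>
        (\<forall>t\<ge>0. \<forall>s>0. (\<integral>\<omega>. exp (- s * H t \<omega>) \<partial>M) = exp (- t * s powr \<beta>)))"

text \<open>
  The set below is empty only if the path stays below \<open>t\<close> forever, a null event on which the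
  infimum would be \<open>\<infinity>\<close>.  The value is set to \<open>0\<close> there, so that the inverse process is a
  genuine \<open>[0,\<infinity>)\<close>-valued random variable and can be used as a time.
\<close>

definition inverse_process ::
    "real \<Rightarrow> real \<Rightarrow> (real \<Rightarrow> 'a \<Rightarrow> real) \<Rightarrow> (real \<Rightarrow> 'a \<Rightarrow> real) \<Rightarrow> real \<Rightarrow> 'a \<Rightarrow> real" where
  "inverse_process \<nu> l H1 H2 t \<omega> =
     (let S = {s. s > 0 \<and> H1 s \<omega> + (2 * l) powr (1 / \<nu>) * H2 s \<omega> \<ge> t}
      in if S = {} then 0 else Inf S)"

section \<open>Caputo--Djrbashian derivative\<close>

text \<open>
  The first predicate says that the derivative of order \<open>\<beta> \<in> (0,1]\<close> at \<open>t > 0\<close> makes sense;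
  the second gives its value, which is meaningful only under the first.
\<close>

definition caputo_differentiable :: "real \<Rightarrow> (real \<Rightarrow> real) \<Rightarrow> real \<Rightarrow> bool" where
  "caputo_differentiable \<beta> u t \<longleftrightarrow>
     (if \<beta> = 1 then u differentiable (at t)
      else continuous_on {0..t} u \<and>
        (\<forall>s\<in>{0<..<t}. u differentiable (at s)) \<and>
        set_integrable lborel {0<..<t} (\<lambda>s. deriv u s / (t - s) powr \<beta>))"

definition caputo_deriv :: "real \<Rightarrow> (real \<Rightarrow> real) \<Rightarrow> real \<Rightarrow> real" where
  "caputo_deriv \<beta> u t =
     (if \<beta> = 1 then deriv u t
      else 1 / Gamma (1 - \<beta>) * (LINT s:{0<..<t}|lborel. deriv u s / (t - s) powr \<beta>))"

section \<open>Mittag-Leffler functions and the combinatorial sum\<close>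

definition mittag_leffler3 :: "real \<Rightarrow> real \<Rightarrow> real \<Rightarrow> real \<Rightarrow> real" where
  "mittag_leffler3 \<alpha> \<beta> \<gamma> z =
     (\<Sum>r. pochhammer \<gamma> r * z ^ r / (fact r * Gamma (\<alpha> * real r + \<beta>)))"

definition mittag_leffler_bivariate ::
    "real \<Rightarrow> real \<Rightarrow> real \<Rightarrow> real \<Rightarrow> real \<Rightarrow> real \<Rightarrow> real" where
  "mittag_leffler_bivariate \<alpha> \<beta> \<gamma>1 \<gamma>2 z1 z2 =
     (\<Sum>k1. \<Sum>k2. pochhammer \<gamma>1 k1 * pochhammer \<gamma>2 k2 / Gamma (\<alpha> * real (k1 + k2) + \<beta>)
                  * (z1 ^ k1 / fact k1) * (z2 ^ k2 / fact k2))"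

text \<open>
  Tuples of nonnegative integers indexed by \<open>1, \<dots>, k\<close>, as extensional functions.
\<close>

definition jump_counts :: "nat \<Rightarrow> nat \<Rightarrow> nat \<Rightarrow> (nat \<Rightarrow> nat) set" where
  "jump_counts k r n =
     {a \<in> {1..k} \<rightarrow>\<^sub>E UNIV. (\<Sum>i=1..k. a i) = r \<and> (\<Sum>i=1..k. i * a i) = n}"

definition multinomial :: "nat \<Rightarrow> nat \<Rightarrow> (nat \<Rightarrow> nat) \<Rightarrow> real" where
  "multinomial k r a = fact r / (\<Prod>i=1..k. fact (a i))"

text \<open>
  In both closed forms the power \<open>t\<^bsup>m\<nu>\<^esup>\<close> is written \<open>(t powr \<nu>) ^ m\<close>, because
  \<open>0 powr 0 = 0\<close> whereas the value at \<open>t = 0\<close>, \<open>m = 0\<close> has to be \<open>1\<close>.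
\<close>

definition closed_form_critical ::
    "real \<Rightarrow> nat \<Rightarrow> (nat \<Rightarrow> real) \<Rightarrow> nat \<Rightarrow> real \<Rightarrow> real" where
  "closed_form_critical \<nu> k lam n t =
     (let \<Lambda> = (\<Sum>i=1..k. lam i); z = - sqrt \<Lambda> * t powr \<nu> in
      \<Sum>r=0..n. \<Sum>a\<in>jump_counts k r n. multinomial k r a * (\<Prod>i=1..k. lam i ^ a i) *
        ((t powr \<nu>) ^ (2 * r)
            * mittag_leffler3 \<nu> (2 * real r * \<nu> + 1) (2 * real r + 1) z
         + sqrt \<Lambda> * (t powr \<nu>) ^ (2 * r + 1)
            * mittag_leffler3 \<nu> ((2 * real r + 1) * \<nu> + 1) (2 * real r + 2) z))"

text \<open>
  The coefficients of the two summands are \<open>1\<close> and \<open>2 * l\<close>.  The source prints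
  \<open>l ^ (2 * r)\<close> and \<open>l ^ (2 * r + 1)\<close>, which is incompatible with the governing equation:
  already for \<open>n = 0\<close> it gives \<open>1 - l * t powr \<nu> / Gamma (\<nu> + 1)\<close> to first order at \<open>t = 0\<close>,
  whereas the probability has no term of order \<open>t powr \<nu>\<close>.  With \<open>x = s powr \<nu>\<close>, the Laplace
  transform of the bracket must be \<open>(x\<^sup>2 + 2 * l * x) / (s * (x\<^sup>2 + 2 * l * x + \<Lambda>) ^ (r + 1))\<close>,
  with \<open>x\<^sup>2 + 2 * l * x + \<Lambda> = (x - p1) * (x - p2)\<close>; its two terms invert to the two summands.
\<close>

definition closed_form_supercritical ::
    "real \<Rightarrow> real \<Rightarrow> nat \<Rightarrow> (nat \<Rightarrow> real) \<Rightarrow> nat \<Rightarrow> real \<Rightarrow> real" where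
  "closed_form_supercritical \<nu> l k lam n t =
     (let \<Lambda> = (\<Sum>i=1..k. lam i);
          p1 = - l + sqrt (l\<^sup>2 - \<Lambda>);
          p2 = - l - sqrt (l\<^sup>2 - \<Lambda>);
          z1 = p1 * t powr \<nu>;
          z2 = p2 * t powr \<nu> in
      \<Sum>r=0..n. \<Sum>a\<in>jump_counts k r n. multinomial k r a * (\<Prod>i=1..k. lam i ^ a i) *
        ((t powr \<nu>) ^ (2 * r)
            * mittag_leffler_bivariate \<nu> (2 * real r * \<nu> + 1) (real r + 1) (real r + 1) z1 z2
         + 2 * l * (t powr \<nu>) ^ (2 * r + 1)
            * mittag_leffler_bivariate \<nu> ((2 * real r + 1) * \<nu> + 1) (real r + 1) (real r + 1) z1 z2))"

end

theory Submission
  imports Defs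
begin

text \<open>
  Write \<open>D = H1 + (2 l)\<^bsup>1/\<nu>\<^esup> H2\<close>, a nondecreasing process with
  \<open>E exp (- u D(x)) = exp (- x \<phi>(u))\<close>, \<open>\<phi>(u) = u\<^bsup>2\<nu>\<^esup> + 2 l u\<^bsup>\<nu>\<^esup>\<close>, whose first-passage time over
  the level \<open>t\<close> is \<open>L(t)\<close>.  The proof computes the Laplace transform in \<open>t\<close> of each state
  probability, reads off a power series in \<open>t\<^bsup>\<nu>\<^esup>\<close> and gets everything else from that series.

  The counting process. Stationary independent increments and the behaviour for small times give
  the forward equations for \<open>P(N(x) = n)\<close>, hence
  \<open>P(N(x) = n) = exp (- \<Lambda> x) (\<Sum>r\<le>n. c(r,n) x\<^bsup>r\<^esup> / r!)\<close>, where \<open>c(r,n)\<close> is the combinatorial sum over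
  the jump patterns with \<open>r\<close> jumps of total height \<open>n\<close>; this is \<open>q_eq_count_prob\<close>.  Since \<open>N\<close> and
  \<open>L\<close> are independent, \<open>P(N(L(t)) = n) = (\<Sum>r\<le>n. c(r,n) E [exp (- \<Lambda> L(t)) L(t)\<^bsup>r\<^esup> / r!])\<close>
  (\<open>prob_at_independent_time\<close>).

  The random time. At an independent exponential time \<open>T\<close> of rate \<open>u\<close>, the event \<open>L(T) > a\<close> is
  \<open>T > D(a)\<close> and has probability \<open>E exp (- u D(a)) = exp (- a \<phi>(u))\<close>: the variable \<open>L(T)\<close> is
  exponential of rate \<open>\<phi>(u)\<close> (\<open>distributed_passage_exponential_time\<close>).  Therefore
  the transform of the \<open>r\<close>-th expectation, taken against \<open>u exp (- u t)\<close>, is \<open>\<phi>(u) / (\<phi>(u) + \<Lambda>)\<^bsup>r+1\<^esup>\<close> at rate \<open>u\<close>.  In terms of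
  \<open>y = u\<^bsup>- \<nu>\<^esup>\<close> this is the rational function
  \<open>A(y) = y\<^bsup>2r\<^esup> (1 + 2 l y) / (1 + 2 l y + \<Lambda> y\<^sup>2)\<^bsup>r+1\<^esup>\<close>, analytic at \<open>0\<close>.

  The series. A power series \<open>A\<close> with positive radius of convergence defines the function
  \<open>(\<Sum>m. a\<^sub>m t\<^bsup>\<nu> m\<^esup> / \<Gamma>(\<nu> m + 1))\<close>, called \<open>frac_series\<close> below, which has transform
  \<open>A(u\<^bsup>- \<nu>\<^esup>)\<close> (\<open>frac_series_laplace\<close>); by uniqueness of the Laplace transform
  (\<open>laplace_unique_left_continuous\<close>) the expectations are such series (\<open>passage_moment\<close>).
  A Caputo derivative of order \<open>j \<nu>\<close> shifts the coefficients by \<open>j\<close> places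
  (\<open>caputo_deriv_frac_series\<close>), so the fractional equation becomes an identity between rational
  functions of \<open>y\<close> (\<open>state_fps_governing\<close>), and the two closed forms are the expansions of the same
  rational functions when the denominator is a square or has two distinct real roots.
\<close>

section \<open>Power series with Gamma-function weights\<close>

text \<open>
  The integral for \<open>\<Gamma>(b)\<close> over \<open>[K,\<infinity>)\<close> alone is at least \<open>K\<^bsup>b-1\<^esup> \<integral> exp (- t) dt\<close>.  As \<open>K\<close> is
  arbitrary, \<open>\<Gamma>(\<nu> m + 1)\<close> beats every geometric sequence in \<open>m\<close>.
\<close>
lemma Gamma_ge_powr_exp:
  fixes b K :: real
  assumes "b \<ge> 1" "K > 0"
  shows "K powr (b - 1) * exp (- K) \<le> Gamma b"
proof -
  have "((\<lambda>x. K powr (b - 1) * exp (- 1 * x)) has_integral K powr (b - 1) * (exp (- 1 * K) / 1)) {K..}"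
    by (intro has_integral_mult_right has_integral_exp_minus_to_infinity) simp
  then have lo: "((\<lambda>x. if x \<in> {K..} then K powr (b - 1) * exp (- x) else 0) has_integral
      K powr (b - 1) * exp (- K)) {0..}"
    using assms by (subst has_integral_restrict) auto
  have hi: "((\<lambda>t. t powr (b - 1) / exp t) has_integral Gamma b) {0..}"
    using Gamma_integral_real[of b] assms by simp
  show ?thesis
  proof (rule has_integral_le[OF lo hi])
    fix x :: real
    assume "x \<in> {0..}"
    then show "(if x \<in> {K..} then K powr (b - 1) * exp (- x) else 0) \<le> x powr (b - 1) / exp x"
      using assms by (auto simp: exp_minus divide_inverse intro!: mult_right_mono powr_mono2)
  qed
qed

definition gamma_weighted :: "real \<Rightarrow> real fps \<Rightarrow> real fps" where
  "gamma_weighted \<nu> A = Abs_fps (\<lambda>m. fps_nth A m / Gamma (\<nu> * real m + 1))"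

definition frac_series :: "real \<Rightarrow> real fps \<Rightarrow> real \<Rightarrow> real" where
  "frac_series \<nu> A t = eval_fps (gamma_weighted \<nu> A) (t powr \<nu>)"

text \<open>
  The coefficients of \<open>A\<close> grow at most geometrically, and \<open>1 / \<Gamma>(\<nu> m + 1) \<le> exp K (K\<^bsup>\<nu>\<^esup>)\<^bsup>- m\<^esup>\<close>; for
  a given argument \<open>T\<close> the number \<open>K\<close> is taken so large that \<open>K\<^bsup>\<nu>\<^esup>\<close> outweighs both.
\<close>
lemma fps_conv_radius_gamma_weighted:
  assumes \<nu>: "0 < \<nu>" and A: "fps_conv_radius A > 0"
  shows "fps_conv_radius (gamma_weighted \<nu> A) = \<infinity>"
proof -
  obtain \<rho> where \<rho>: "0 < \<rho>" "ereal \<rho> < fps_conv_radius A"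
    using ereal_dense2[OF A] by (auto simp: zero_ereal_def)
  have sA: "summable (\<lambda>m. norm (fps_nth A m * \<rho> ^ m))"
    using norm_summable_fps[of \<rho> A] \<rho> by simp
  have "summable (\<lambda>m. fps_nth (gamma_weighted \<nu> A) m * T ^ m)" for T
  proof -
    define K where "K = ((\<bar>T\<bar> + 1) / \<rho>) powr (1 / \<nu>)"
    have K0: "K > 0" using \<rho> by (auto simp: K_def intro!: divide_pos_pos)
    have KT: "K powr \<nu> = (\<bar>T\<bar> + 1) / \<rho>"
      using \<nu> \<rho> by (simp add: K_def powr_powr)
    show ?thesis
    proof (rule summable_comparison_test'[where g = "\<lambda>m. exp K * norm (fps_nth A m * \<rho> ^ m)"])
      show "summable (\<lambda>m. exp K * norm (fps_nth A m * \<rho> ^ m))"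
        using sA by (rule summable_mult)
    next
      fix m :: nat
      define b where "b = \<nu> * real m + 1"
      have b: "b \<ge> 1" using \<nu> by (simp add: b_def)
      have G: "K powr (b - 1) * exp (- K) \<le> Gamma b"
        by (rule Gamma_ge_powr_exp[OF b K0])
      have Gp: "Gamma b > 0" using b by (intro Gamma_real_pos) simp
      have Kb: "K powr (b - 1) = ((\<bar>T\<bar> + 1) / \<rho>) ^ m"
        using KT \<rho> by (simp add: b_def powr_powr[symmetric] powr_realpow add_nonneg_pos)
      have "\<bar>T\<bar> ^ m \<le> (\<bar>T\<bar> + 1) ^ m" by (intro power_mono) auto
      also have "\<dots> = K powr (b - 1) * \<rho> ^ m"
        using \<rho> Kb by (simp add: power_divide)
      also have "\<dots> = (K powr (b - 1) * exp (- K)) * (exp K * \<rho> ^ m)"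
        by (simp add: exp_minus field_simps)
      also have "\<dots> \<le> Gamma b * (exp K * \<rho> ^ m)"
        using G \<rho> by (intro mult_right_mono) auto
      finally have "\<bar>T\<bar> ^ m / Gamma b \<le> exp K * \<rho> ^ m"
        using Gp by (simp add: field_simps)
      then have "\<bar>fps_nth A m\<bar> * (\<bar>T\<bar> ^ m / Gamma b) \<le> \<bar>fps_nth A m\<bar> * (exp K * \<rho> ^ m)"
        by (intro mult_left_mono) auto
      then show "norm (fps_nth (gamma_weighted \<nu> A) m * T ^ m) \<le> exp K * norm (fps_nth A m * \<rho> ^ m)"
        using Gp \<rho> by (simp add: gamma_weighted_def b_def[symmetric] abs_mult power_abs mult_ac)
    qed
  qed
  then have "conv_radius (fps_nth (gamma_weighted \<nu> A)) = \<infinity>"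
    by (rule conv_radius_inftyI'')
  then show ?thesis by (simp add: fps_conv_radius_def)
qed

context
  fixes \<nu> :: real and A :: "real fps"
  assumes \<nu>: "0 < \<nu>" and A: "fps_conv_radius A > 0"
begin

lemma frac_series_sums:
  "(\<lambda>m. fps_nth A m / Gamma (\<nu> * real m + 1) * (t powr \<nu>) ^ m) sums frac_series \<nu> A t"
  using sums_eval_fps[of "t powr \<nu>" "gamma_weighted \<nu> A"] fps_conv_radius_gamma_weighted[OF \<nu> A]
  by (simp add: frac_series_def gamma_weighted_def)

lemma frac_series_abs_summable:
  "summable (\<lambda>m. \<bar>fps_nth A m\<bar> / Gamma (\<nu> * real m + 1) * (t powr \<nu>) ^ m)"
proof -
  have "Gamma (\<nu> * real m + 1) > 0" for m
    using \<nu> by (intro Gamma_real_pos) (simp add: add_nonneg_pos)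
  then have "\<bar>Gamma (\<nu> * real m + 1)\<bar> = Gamma (\<nu> * real m + 1)" for m
    by (simp add: less_imp_le)
  then show ?thesis
  using norm_summable_fps[of "t powr \<nu>" "gamma_weighted \<nu> A"] fps_conv_radius_gamma_weighted[OF \<nu> A]
  by (simp add: gamma_weighted_def abs_mult)
qed

lemma frac_series_0: "frac_series \<nu> A 0 = fps_nth A 0"
  using \<nu> by (simp add: frac_series_def eval_fps_at_0 gamma_weighted_def)

lemma continuous_on_frac_series: "continuous_on {0..} (frac_series \<nu> A)"
  unfolding frac_series_def
  using \<nu> by (intro continuous_on_eval_fps' continuous_on_powr')
    (auto simp: fps_conv_radius_gamma_weighted[OF \<nu> A] intro!: continuous_intros)

text \<open>
  The factor \<open>\<nu> m\<close> produced by the derivative turns \<open>\<Gamma>(\<nu> m + 1)\<close> into \<open>\<Gamma>(\<nu> m)\<close>.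
\<close>
lemma frac_series_has_derivative:
  assumes t: "t > 0"
  shows "(frac_series \<nu> A has_real_derivative
     (\<Sum>m. fps_nth A (Suc m) / Gamma (\<nu> * real (Suc m)) * t powr (\<nu> * real (Suc m) - 1))) (at t)"
    and "summable (\<lambda>m. \<bar>fps_nth A (Suc m)\<bar> / Gamma (\<nu> * real (Suc m)) * t powr (\<nu> * real (Suc m) - 1))"
proof -
  let ?G = "gamma_weighted \<nu> A"
  have R: "fps_conv_radius ?G = \<infinity>" by (rule fps_conv_radius_gamma_weighted[OF \<nu> A])
  have R': "fps_conv_radius (fps_deriv ?G) = \<infinity>"
    using fps_conv_radius_deriv[of ?G] R by simp
  have D: "(frac_series \<nu> A has_real_derivative
       eval_fps (fps_deriv ?G) (t powr \<nu>) * (\<nu> * t powr (\<nu> - 1))) (at t)"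
    unfolding frac_series_def
    using t by (intro DERIV_chain2[OF has_field_derivative_eval_fps] has_real_derivative_powr)
      (simp_all add: R)
  have coeff: "fps_nth (fps_deriv ?G) m * (t powr \<nu>) ^ m * (\<nu> * t powr (\<nu> - 1))
      = fps_nth A (Suc m) / Gamma (\<nu> * real (Suc m)) * t powr (\<nu> * real (Suc m) - 1)" for m
  proof -
    have p: "\<nu> * real (Suc m) > 0" using \<nu> by simp
    have "\<nu> * real (Suc m) \<notin> \<int>\<^sub>\<le>\<^sub>0" using p by (meson nonpos_Ints_nonpos not_le)
    then have G: "Gamma (\<nu> * real (Suc m) + 1) = \<nu> * real (Suc m) * Gamma (\<nu> * real (Suc m))"
      by (rule Gamma_plus1)
    have "(t powr \<nu>) ^ m * t powr (\<nu> - 1) = t powr (\<nu> * real (Suc m) - 1)"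
      using t by (simp add: powr_powr powr_add[symmetric] algebra_simps flip: powr_realpow)
    moreover have "Gamma (\<nu> * real (Suc m)) > 0" using p by (rule Gamma_real_pos)
    moreover have "fps_nth (fps_deriv ?G) m * \<nu> = fps_nth A (Suc m) / Gamma (\<nu> * real (Suc m))"
      unfolding gamma_weighted_def using p by (simp only: fps_deriv_nth fps_nth_Abs_fps Suc_eq_plus1[symmetric] G) simp
    ultimately show ?thesis
      by (metis (no_types, lifting) mult.assoc mult.left_commute)
  qed
  have "(\<lambda>m. fps_nth (fps_deriv ?G) m * (t powr \<nu>) ^ m * (\<nu> * t powr (\<nu> - 1))) sums
      (eval_fps (fps_deriv ?G) (t powr \<nu>) * (\<nu> * t powr (\<nu> - 1)))"
    by (intro sums_mult2 sums_eval_fps) (simp add: R')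
  from sums_unique[OF this] D
  show "(frac_series \<nu> A has_real_derivative
     (\<Sum>m. fps_nth A (Suc m) / Gamma (\<nu> * real (Suc m)) * t powr (\<nu> * real (Suc m) - 1))) (at t)"
    unfolding coeff by simp
  have "summable (\<lambda>m. norm (fps_nth (fps_deriv ?G) m * (t powr \<nu>) ^ m) * norm (\<nu> * t powr (\<nu> - 1)))"
    by (intro summable_mult2 norm_summable_fps) (simp add: R')
  then have "summable (\<lambda>m. norm (fps_nth (fps_deriv ?G) m * (t powr \<nu>) ^ m * (\<nu> * t powr (\<nu> - 1))))"
    by (simp only: norm_mult)
  moreover have "Gamma (\<nu> * real (Suc m)) > 0" for m
    using \<nu> by (intro Gamma_real_pos) simp
  then have "\<bar>Gamma (\<nu> * real (Suc m))\<bar> = Gamma (\<nu> * real (Suc m))" for m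
    by (metis abs_of_pos)
  ultimately show "summable (\<lambda>m. \<bar>fps_nth A (Suc m)\<bar> / Gamma (\<nu> * real (Suc m)) * t powr (\<nu> * real (Suc m) - 1))"
    unfolding coeff by (simp add: abs_mult del: of_nat_Suc)
qed

end

lemma frac_series_add:
  assumes \<nu>: "0 < \<nu>" and A: "fps_conv_radius A > 0" and B: "fps_conv_radius B > 0"
  shows "frac_series \<nu> (A + B) t = frac_series \<nu> A t + frac_series \<nu> B t"
proof -
  have "gamma_weighted \<nu> (A + B) = gamma_weighted \<nu> A + gamma_weighted \<nu> B"
    by (simp add: gamma_weighted_def fps_eq_iff add_divide_distrib)
  then show ?thesis
    by (simp add: frac_series_def eval_fps_add fps_conv_radius_gamma_weighted \<nu> A B)
qed

lemma frac_series_cmult: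
  assumes \<nu>: "0 < \<nu>" and A: "fps_conv_radius A > 0"
  shows "frac_series \<nu> (fps_const c * A) t = c * frac_series \<nu> A t"
proof -
  have "gamma_weighted \<nu> (fps_const c * A) = fps_const c * gamma_weighted \<nu> A"
    by (simp add: gamma_weighted_def fps_eq_iff)
  then show ?thesis
    by (simp add: frac_series_def eval_fps_mult fps_conv_radius_gamma_weighted \<nu> A)
qed

section \<open>Caputo derivatives and Laplace transforms of the series\<close>

text \<open>Euler's Beta integral after the substitution \<open>s = t x\<close>.\<close>
lemma beta_kernel_integral:
  fixes a \<beta> t :: real
  assumes a: "0 < a" and \<beta>: "\<beta> < 1" and t: "0 < t"
  shows "has_bochner_integral lborel
     (\<lambda>s. indicator {0<..<t} s * (s powr (a - 1) / (t - s) powr \<beta>)) (t powr (a - \<beta>) * Beta a (1 - \<beta>))"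
proof -
  let ?f = "\<lambda>x::real. indicator {0..1} x *\<^sub>R (x powr (a - 1) * (1 - x) powr (1 - \<beta> - 1))"
  have I: "set_integrable lborel {0..1} (\<lambda>x::real. x powr (a - 1) * (1 - x) powr (1 - \<beta> - 1))"
    using a \<beta> by (intro integrable_Beta) auto
  have "has_bochner_integral lborel ?f (Beta a (1 - \<beta>))"
    using I set_borel_integral_eq_integral(2)[OF I] has_integral_Beta_real[OF a, of "1 - \<beta>"] \<beta>
    by (simp add: has_bochner_integral_iff set_integrable_def set_lebesgue_integral_def integral_unique)
  then have "has_bochner_integral lborel (\<lambda>s. ?f (0 + 1 / t * s)) (Beta a (1 - \<beta>) /\<^sub>R \<bar>1 / t\<bar>)"
    using t by (subst (asm) lborel_has_bochner_integral_real_affine_iff[where c = "1 / t" and t = 0]) auto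
  then have "has_bochner_integral lborel (\<lambda>s. t powr (a - 1 - \<beta>) * ?f (0 + 1 / t * s))
      (t powr (a - 1 - \<beta>) * (Beta a (1 - \<beta>) /\<^sub>R \<bar>1 / t\<bar>))"
    by (intro has_bochner_integral_mult_right)
  moreover have "t powr (a - 1 - \<beta>) * ?f (0 + 1 / t * s)
      = indicator {0<..<t} s * (s powr (a - 1) / (t - s) powr \<beta>)" for s
  proof (cases "s \<in> {0<..<t}")
    case True
    then have "(s / t) powr (a - 1) = s powr (a - 1) / t powr (a - 1)"
      by (simp add: powr_divide)
    moreover have "(1 - s / t) powr (- \<beta>) = t powr \<beta> / (t - s) powr \<beta>"
    proof -
      have "1 - s / t = (t - s) / t" using t by (simp add: field_simps)
      then show ?thesis using True by (simp add: powr_divide powr_minus field_simps)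
    qed
    moreover have "t powr (a - 1 - \<beta>) = t powr (a - 1) / t powr \<beta>"
      by (rule powr_diff)
    ultimately have "t powr (a - 1 - \<beta>) * ?f (0 + 1 / t * s)
      = t powr (a - 1) / t powr \<beta> * (s powr (a - 1) / t powr (a - 1) * (t powr \<beta> / (t - s) powr \<beta>))"
      using True by simp
    also have "\<dots> = s powr (a - 1) / (t - s) powr \<beta>"
      using t by simp
    finally show ?thesis using True by simp
  next
    case False
    then have "s < 0 \<or> s = 0 \<or> s = t \<or> s > t" by auto
    then show ?thesis using False t by (auto simp: indicator_def divide_simps)
  qed
  moreover have "t powr (a - 1 - \<beta>) * (Beta a (1 - \<beta>) /\<^sub>R \<bar>1 / t\<bar>) = t powr (a - \<beta>) * Beta a (1 - \<beta>)"
  proof -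
    have "t powr (a - \<beta>) = t powr (a - 1 - \<beta> + 1)" by simp
    also have "\<dots> = t powr (a - 1 - \<beta>) * t" using t by (subst powr_add) simp
    finally show ?thesis using t by simp
  qed
  ultimately show ?thesis by (simp only:)
qed

lemma gamma_kernel_integral:
  fixes b u :: real
  assumes b: "b \<ge> 0" and u: "0 < u"
  shows "has_bochner_integral lborel (\<lambda>t. t powr b * exponential_density u t) (Gamma (b + 1) / u powr b)"
proof -
  let ?f = "\<lambda>t::real. indicator {0..} t * t powr b / exp t"
  have "(\<integral>\<^sup>+t. ennreal (?f t) \<partial>lborel) = ennreal (Gamma (b + 1))"
    using Gamma_conv_nn_integral_real[of "b + 1"] b by simp
  then have "has_bochner_integral lborel ?f (Gamma (b + 1))"
    using b by (subst (asm) nn_integral_eq_integrable)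
      (auto simp: has_bochner_integral_iff intro!: Gamma_real_nonneg)
  then have "has_bochner_integral lborel (\<lambda>t. ?f (0 + u * t)) (Gamma (b + 1) /\<^sub>R \<bar>u\<bar>)"
    using u by (subst (asm) lborel_has_bochner_integral_real_affine_iff[where c = u and t = 0]) auto
  then have "has_bochner_integral lborel (\<lambda>t. u / u powr b * ?f (0 + u * t))
      (u / u powr b * (Gamma (b + 1) /\<^sub>R \<bar>u\<bar>))"
    by (intro has_bochner_integral_mult_right)
  moreover have "u / u powr b * ?f (0 + u * t) = t powr b * exponential_density u t" for t
    using u by (cases "t < 0") (auto simp: exponential_density_def indicator_def powr_mult exp_minus
       field_simps zero_le_mult_iff)
  moreover have "u / u powr b * (Gamma (b + 1) /\<^sub>R \<bar>u\<bar>) = Gamma (b + 1) / u powr b"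
    using u by simp
  ultimately show ?thesis by (simp only:)
qed

text \<open>
  Termwise, the derivative of order \<open>\<beta> = j \<nu>\<close> sends \<open>t\<^bsup>\<nu> i\<^esup> / \<Gamma>(\<nu> i + 1)\<close> to
  \<open>t\<^bsup>\<nu> i - \<beta>\<^esup> / \<Gamma>(\<nu> i + 1 - \<beta>)\<close> for \<open>i > 0\<close>, by the Beta integral, and kills the constant term.  This is
  a term of the same kind with index \<open>i - j\<close> if \<open>i \<ge> j\<close>; the vanishing of the coefficients with
  \<open>0 < i < j\<close> excludes negative powers of \<open>t\<close>.  The function \<open>u\<close> is tied to the series only
  on \<open>[0,\<infinity>)\<close>, the times at which the series will represent the probabilities.
\<close>
lemma
  fixes u :: "real \<Rightarrow> real"
  assumes \<nu>: "0 < \<nu>" and A: "fps_conv_radius A > 0"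
    and u: "\<And>s. s \<ge> 0 \<Longrightarrow> u s = frac_series \<nu> A s"
    and j: "1 \<le> j" "real j * \<nu> \<le> 1"
    and gap: "\<And>i. 0 < i \<Longrightarrow> i < j \<Longrightarrow> fps_nth A i = 0"
    and t: "t > 0"
  shows caputo_differentiable_frac_series: "caputo_differentiable (real j * \<nu>) u t"
    and caputo_deriv_frac_series: "caputo_deriv (real j * \<nu>) u t = frac_series \<nu> (fps_shift j A) t"
proof -
  define \<beta> where "\<beta> = real j * \<nu>"
  define D where "D s = (\<Sum>m. fps_nth A (Suc m) / Gamma (\<nu> * real (Suc m)) * s powr (\<nu> * real (Suc m) - 1))" for s
  \<comment> \<open>The derivative of order \<open>\<beta>\<close> of the \<open>i\<close>-th term of the series, for \<open>i > 0\<close>.\<close>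
  define h where "h i = fps_nth A i / Gamma (\<nu> * real i + 1 - \<beta>) * t powr (\<nu> * real i - \<beta>)" for i
  have uD: "(u has_real_derivative D s) (at s)" if "s > 0" for s
  proof (rule has_field_derivative_transform_within_open[where S = "{0<..}"])
    show "(frac_series \<nu> A has_real_derivative D s) (at s)"
      unfolding D_def by (rule frac_series_has_derivative(1)[OF \<nu> A that])
  qed (use that u in auto)
  have deriv_u: "deriv u s = D s" if "s > 0" for s
    using uD[OF that] by (rule DERIV_imp_deriv)
  have A': "fps_conv_radius (fps_shift j A) > 0" using A by simp
  have hj: "h (m + j) = fps_nth (fps_shift j A) m / Gamma (\<nu> * real m + 1) * (t powr \<nu>) ^ m" for m
  proof -
    have "\<nu> * real (m + j) + 1 - \<beta> = \<nu> * real m + 1" "\<nu> * real (m + j) - \<beta> = \<nu> * real m"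
      by (simp_all add: \<beta>_def algebra_simps)
    then show ?thesis using t by (simp only: h_def fps_shift_nth) (simp add: powr_powr[symmetric] powr_realpow)
  qed
  have h0: "h (Suc i) = 0" if "i < j - 1" for i
    using gap[of "Suc i"] that by (simp add: h_def)
  have hs: "(\<lambda>m. h (Suc m)) sums frac_series \<nu> (fps_shift j A) t"
  proof -
    have "(\<lambda>m. h (m + j)) sums frac_series \<nu> (fps_shift j A) t"
      unfolding hj by (rule frac_series_sums[OF \<nu> A'])
    then have "(\<lambda>m. h (Suc (m + (j - 1)))) sums frac_series \<nu> (fps_shift j A) t"
      using j by simp
    then show ?thesis
      by (subst (asm) sums_iff_shift[where f = "\<lambda>m. h (Suc m)"]) (simp add: h0)
  qed
  have has: "summable (\<lambda>m. \<bar>h (Suc m)\<bar>)"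
  proof -
    have "Gamma (\<nu> * real m + 1) > 0" for m
      using \<nu> by (intro Gamma_real_pos) (simp add: add_nonneg_pos)
    then have "\<bar>Gamma (\<nu> * real m + 1)\<bar> = Gamma (\<nu> * real m + 1)" for m
      by (simp add: less_imp_le)
    then have "summable (\<lambda>m. \<bar>h (m + j)\<bar>)"
      using frac_series_abs_summable[OF \<nu> A', of t] unfolding hj by (simp add: abs_mult)
    then have "summable (\<lambda>m. \<bar>h (Suc (m + (j - 1)))\<bar>)" using j by simp
    then show ?thesis by (subst (asm) summable_iff_shift[where f = "\<lambda>m. \<bar>h (Suc m)\<bar>"])
  qed
  have "caputo_differentiable \<beta> u t \<and> caputo_deriv \<beta> u t = frac_series \<nu> (fps_shift j A) t"
  proof (cases "\<beta> = 1")
    case True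
    have "fps_nth A (Suc m) / Gamma (\<nu> * real (Suc m)) * t powr (\<nu> * real (Suc m) - 1) = h (Suc m)" for m
      unfolding h_def True by simp
    then have "D t = frac_series \<nu> (fps_shift j A) t"
      using sums_unique[OF hs] by (simp add: D_def del: of_nat_Suc)
    moreover have "u differentiable (at t)"
      using uD[OF t] real_differentiable_def by blast
    ultimately show ?thesis
      using True deriv_u[OF t] by (simp add: caputo_differentiable_def caputo_deriv_def)
  next
    case False
    then have \<beta>: "\<beta> < 1" "0 < \<beta>" using j \<nu> by (auto simp: \<beta>_def)
    define F where "F m s = fps_nth A (Suc m) / Gamma (\<nu> * real (Suc m)) *
        (indicator {0<..<t} s * (s powr (\<nu> * real (Suc m) - 1) / (t - s) powr \<beta>))" for m and s :: real
    have a: "\<nu> * real (Suc m) > 0" for m using \<nu> by simp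
    have Ga: "Gamma (\<nu> * real (Suc m)) > 0" for m using a by (rule Gamma_real_pos)
    have val: "c / Gamma (\<nu> * real (Suc m)) * (t powr (\<nu> * real (Suc m) - \<beta>) * Beta (\<nu> * real (Suc m)) (1 - \<beta>))
       = Gamma (1 - \<beta>) * (c / Gamma (\<nu> * real (Suc m) + 1 - \<beta>) * t powr (\<nu> * real (Suc m) - \<beta>))" for c m
      using Ga[of m] by (simp add: Beta_def add_diff_eq del: of_nat_Suc)
    have FI: "has_bochner_integral lborel (F m) (Gamma (1 - \<beta>) * h (Suc m))" for m
      unfolding F_def h_def val[symmetric]
      by (intro has_bochner_integral_mult_right beta_kernel_integral a \<beta> t)
    have normF: "norm (F m s) = \<bar>fps_nth A (Suc m)\<bar> / Gamma (\<nu> * real (Suc m)) *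
        (indicator {0<..<t} s * (s powr (\<nu> * real (Suc m) - 1) / (t - s) powr \<beta>))" for m s
      using Ga[of m] by (auto simp: F_def abs_mult indicator_def simp del: of_nat_Suc)
    have G1: "Gamma (1 - \<beta>) > 0" using \<beta> by (intro Gamma_real_pos) simp
    have FN: "(\<integral>s. norm (F m s) \<partial>lborel) = Gamma (1 - \<beta>) * \<bar>h (Suc m)\<bar>" for m
    proof -
      have "has_bochner_integral lborel (\<lambda>s. norm (F m s))
        (Gamma (1 - \<beta>) * (\<bar>fps_nth A (Suc m)\<bar> / Gamma (\<nu> * real (Suc m) + 1 - \<beta>) * t powr (\<nu> * real (Suc m) - \<beta>)))"
        unfolding normF val[symmetric]
        by (intro has_bochner_integral_mult_right beta_kernel_integral a \<beta> t)
      moreover have "Gamma (\<nu> * real (Suc m) + 1 - \<beta>) > 0"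
        using a[of m] \<beta> by (intro Gamma_real_pos) linarith
      ultimately show ?thesis
        by (simp add: has_bochner_integral_iff h_def abs_mult del: of_nat_Suc)
    qed
    have FS: "(\<lambda>m. F m s) sums (indicator {0<..<t} s * (deriv u s / (t - s) powr \<beta>))"
      and FSn: "summable (\<lambda>m. norm (F m s))" for s
    proof -
      show "(\<lambda>m. F m s) sums (indicator {0<..<t} s * (deriv u s / (t - s) powr \<beta>))"
      proof (cases "s \<in> {0<..<t}")
        case True
        have "summable (\<lambda>m. fps_nth A (Suc m) / Gamma (\<nu> * real (Suc m)) * s powr (\<nu> * real (Suc m) - 1))"
        proof (rule summable_norm_cancel)
          show "summable (\<lambda>m. norm (fps_nth A (Suc m) / Gamma (\<nu> * real (Suc m)) * s powr (\<nu> * real (Suc m) - 1)))"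
            using frac_series_has_derivative(2)[OF \<nu> A, of s] True Ga
            by (simp add: abs_mult less_imp_le del: of_nat_Suc)
        qed
        then have "(\<lambda>m. fps_nth A (Suc m) / Gamma (\<nu> * real (Suc m)) * s powr (\<nu> * real (Suc m) - 1)) sums D s"
          unfolding D_def by (rule summable_sums)
        from sums_divide[OF this, of "(t - s) powr \<beta>"] show ?thesis
          using True deriv_u[of s] by (simp add: F_def)
      qed (simp add: F_def)
      show "summable (\<lambda>m. norm (F m s))"
      proof (cases "s \<in> {0<..<t}")
        case True
        then show ?thesis
          using summable_divide[OF frac_series_has_derivative(2)[OF \<nu> A, of s], of "(t - s) powr \<beta>"]
          unfolding normF by (simp add: mult_ac)
      qed (simp add: F_def)
    qed
    have suminf_F: "(\<lambda>s. \<Sum>m. F m s) = (\<lambda>s. indicator {0<..<t} s * (deriv u s / (t - s) powr \<beta>))"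
      using sums_unique[OF FS] by auto
    have Fint: "integrable lborel (F m)" for m
      using FI by (simp add: has_bochner_integral_iff)
    have sumFN: "summable (\<lambda>m. \<integral>s. norm (F m s) \<partial>lborel)"
      unfolding FN using has by (rule summable_mult)
    have int: "integrable lborel (\<lambda>s. indicator {0<..<t} s * (deriv u s / (t - s) powr \<beta>))"
      unfolding suminf_F[symmetric] using Fint sumFN FSn by (intro integrable_suminf) auto
    have "(\<lambda>m. integral\<^sup>L lborel (F m)) sums (\<integral>s. (\<Sum>m. F m s) \<partial>lborel)"
      using Fint sumFN FSn by (intro sums_integral) auto
    then have "(\<lambda>m. Gamma (1 - \<beta>) * h (Suc m)) sums (\<integral>s. indicator {0<..<t} s * (deriv u s / (t - s) powr \<beta>) \<partial>lborel)"
      using FI unfolding suminf_F by (simp add: has_bochner_integral_iff)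
    from sums_unique2[OF this sums_mult[OF hs]]
    have "(LINT s:{0<..<t}|lborel. deriv u s / (t - s) powr \<beta>) = Gamma (1 - \<beta>) * frac_series \<nu> (fps_shift j A) t"
      by (simp add: set_lebesgue_integral_def)
    moreover have "continuous_on {0..t} u"
      using continuous_on_subset[OF continuous_on_frac_series[OF \<nu> A], of "{0..t}"] u
      by (subst continuous_on_cong[OF refl, of _ _ "frac_series \<nu> A"]) auto
    moreover have "\<forall>s\<in>{0<..<t}. u differentiable (at s)"
      using uD real_differentiable_def by (metis greaterThanLessThan_iff)
    ultimately show ?thesis
      using False int G1
      by (simp add: caputo_differentiable_def caputo_deriv_def set_integrable_def)
  qed
  then show "caputo_differentiable (real j * \<nu>) u t"
    "caputo_deriv (real j * \<nu>) u t = frac_series \<nu> (fps_shift j A) t"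
    by (simp_all add: \<beta>_def)
qed

text \<open>
  Term by term, \<open>\<integral> t\<^bsup>\<nu> m\<^esup> u exp (- u t) dt = \<Gamma>(\<nu> m + 1) u\<^bsup>- \<nu> m\<^esup>\<close>, so the transform removes exactly the
  weights.  Transforms are taken against the exponential probability density, that is with an extra
  factor \<open>u\<close>, because that is how they arise from exponential times below.
\<close>
lemma frac_series_laplace:
  assumes \<nu>: "0 < \<nu>" and A: "ereal (u powr (- \<nu>)) < fps_conv_radius A" and u: "u > 0"
  shows "has_bochner_integral lborel (\<lambda>t. frac_series \<nu> A t * exponential_density u t) (eval_fps A (u powr (- \<nu>)))"
proof -
  have A0: "fps_conv_radius A > 0"
    using A u by (metis ereal_less(2) less_trans powr_gt_zero less_irrefl)
  define F where "F m t = fps_nth A m / Gamma (\<nu> * real m + 1) * ((t powr \<nu>) ^ m * exponential_density u t)" for m t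
  have G: "Gamma (\<nu> * real m + 1) > 0" for m
    using \<nu> by (intro Gamma_real_pos) (simp add: add_nonneg_pos)
  have kernel: "has_bochner_integral lborel (\<lambda>t. (t powr \<nu>) ^ m * exponential_density u t)
      (Gamma (\<nu> * real m + 1) * (u powr (- \<nu>)) ^ m)" for m
  proof -
    have I: "has_bochner_integral lborel (\<lambda>t. t powr (\<nu> * real m) * exponential_density u t)
      (Gamma (\<nu> * real m + 1) / u powr (\<nu> * real m))"
      using \<nu> u by (intro gamma_kernel_integral) auto
    have ae: "AE t in lborel. t powr (\<nu> * real m) * exponential_density u t = (t powr \<nu>) ^ m * exponential_density u t"
      using AE_lborel_singleton[of 0]
    proof eventually_elim
      case (elim t)
      then show ?case
        by (cases "t > 0") (auto simp: powr_powr[symmetric] powr_realpow exponential_density_def)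
    qed
    have "Gamma (\<nu> * real m + 1) / u powr (\<nu> * real m) = Gamma (\<nu> * real m + 1) * (u powr (- \<nu>)) ^ m"
      using u by (simp add: powr_powr[symmetric] powr_realpow powr_minus field_simps)
    then show ?thesis
      using I ae by (subst has_bochner_integral_cong_AE[symmetric]) simp_all
  qed
  have FI: "has_bochner_integral lborel (F m) (fps_nth A m * (u powr (- \<nu>)) ^ m)" for m
    using has_bochner_integral_mult_right[OF kernel[of m], of "fps_nth A m / Gamma (\<nu> * real m + 1)"] G[of m]
    by (simp add: F_def[abs_def])
  have normF: "norm (F m t) = \<bar>fps_nth A m\<bar> / Gamma (\<nu> * real m + 1) * ((t powr \<nu>) ^ m * exponential_density u t)" for m t
    using G[of m] u by (simp add: F_def abs_mult)
  have FN: "(\<integral>t. norm (F m t) \<partial>lborel) = norm (fps_nth A m * (u powr (- \<nu>)) ^ m)" for m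
    using has_bochner_integral_mult_right[OF kernel[of m], of "\<bar>fps_nth A m\<bar> / Gamma (\<nu> * real m + 1)"] G[of m]
    unfolding normF by (simp add: has_bochner_integral_iff abs_mult)
  have Fint: "integrable lborel (F m)" for m
    using FI by (simp add: has_bochner_integral_iff)
  have FS: "(\<lambda>m. F m t) sums (frac_series \<nu> A t * exponential_density u t)" for t
    using sums_mult2[OF frac_series_sums[OF \<nu> A0, of t], of "exponential_density u t"]
    by (simp add: F_def mult_ac)
  have FSn: "summable (\<lambda>m. norm (F m t))" for t
    using summable_mult2[OF frac_series_abs_summable[OF \<nu> A0, of t], of "exponential_density u t"]
    unfolding normF by (simp add: mult_ac)
  have suminf_F: "(\<lambda>t. \<Sum>m. F m t) = (\<lambda>t. frac_series \<nu> A t * exponential_density u t)"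
    using sums_unique[OF FS] by auto
  have A': "norm (u powr (- \<nu>)) < fps_conv_radius A" using A by simp
  have sumFN: "summable (\<lambda>m. \<integral>t. norm (F m t) \<partial>lborel)"
    unfolding FN by (rule norm_summable_fps[OF A'])
  have "integrable lborel (\<lambda>t. frac_series \<nu> A t * exponential_density u t)"
    unfolding suminf_F[symmetric] using Fint sumFN FSn by (intro integrable_suminf) auto
  moreover have "(\<lambda>m. integral\<^sup>L lborel (F m)) sums (\<integral>t. (\<Sum>m. F m t) \<partial>lborel)"
    using Fint sumFN FSn by (intro sums_integral) auto
  then have "(\<lambda>m. fps_nth A m * (u powr (- \<nu>)) ^ m) sums (\<integral>t. frac_series \<nu> A t * exponential_density u t \<partial>lborel)"
    using FI unfolding suminf_F by (simp add: has_bochner_integral_iff)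
  ultimately show ?thesis
    using sums_unique2[OF _ sums_eval_fps[OF A']] by (simp add: has_bochner_integral_iff)
qed

section \<open>Uniqueness of the Laplace transform\<close>

text \<open>
  Lerch's argument: the rates \<open>u0 + n\<close> alone show that \<open>h(s) = g(s) u0 exp (- u0 s)\<close> is orthogonal to
  all powers of \<open>exp (- s)\<close>, hence by the Weierstrass theorem to every continuous function of
  \<open>exp (- s)\<close>, hence to the indicators of intervals.  Left-continuity would make \<open>h\<close> positive on an
  interval to the left of a point with \<open>g t > 0\<close>.  One-sided continuity is what first-passage times
  provide without further work.
\<close>
lemma laplace_zero_left_continuous_nonpos:
  fixes g :: "real \<Rightarrow> real"
  assumes u0: "u0 > 0"
    and L: "\<And>u. u \<ge> u0 \<Longrightarrow> has_bochner_integral lborel (\<lambda>t. g t * exponential_density u t) 0"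
    and t: "t > 0" and left: "continuous (at_left t) g"
  shows "g t \<le> 0"
proof (rule ccontr)
  assume "\<not> g t \<le> 0"
  then have gt: "g t > 0" by simp
  define h where "h s = g s * exponential_density u0 s" for s
  have h: "integrable lborel h"
    using L[of u0] by (simp add: h_def[abs_def] has_bochner_integral_iff)
  have h_neg: "h s = 0" if "s < 0" for s
    using that by (simp add: h_def exponential_density_def)
  have pow: "has_bochner_integral lborel (\<lambda>s. h s * exp (- s) ^ n) 0" for n
  proof -
    have "has_bochner_integral lborel (\<lambda>s. u0 / (u0 + real n) * (g s * exponential_density (u0 + real n) s)) (u0 / (u0 + real n) * 0)"
      by (intro has_bochner_integral_mult_right L) simp
    moreover have "u0 / (u0 + real n) * (g s * exponential_density (u0 + real n) s) = h s * exp (- s) ^ n" for s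
    proof -
      have "exp (- (s * (u0 + real n))) = exp (- (s * u0)) * exp (- s) ^ n"
        by (simp add: exp_of_nat_mult[symmetric] exp_add[symmetric] algebra_simps)
      then show ?thesis using u0 by (simp add: h_def exponential_density_def)
    qed
    ultimately show ?thesis by simp
  qed
  have cont: "(\<integral>s. h s * \<psi> (exp (- s)) \<partial>lborel) = 0"
    if c: "continuous_on UNIV \<psi>" for \<psi> :: "real \<Rightarrow> real"
  proof -
    have m: "\<psi> \<in> borel_measurable borel" using c by (rule borel_measurable_continuous_onI)
    have cc: "continuous_on {0..1} \<psi>" using c continuous_on_subset by blast
    have "\<bar>\<integral>s. h s * \<psi> (exp (- s)) \<partial>lborel\<bar> \<le> e * (\<integral>s. \<bar>h s\<bar> \<partial>lborel)" if e: "e > 0" for e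
    proof -
      obtain P where P: "real_polynomial_function P" "\<And>x. x \<in> {0..1} \<Longrightarrow> \<bar>\<psi> x - P x\<bar> < e"
        using Stone_Weierstrass_real_polynomial_function[OF compact_Icc cc e] by blast
      obtain a n where an: "P = (\<lambda>x. \<Sum>i\<le>n. a i * x ^ i)"
        using P(1) by (auto simp: real_polynomial_function_iff_sum)
      have Pint: "has_bochner_integral lborel (\<lambda>s. h s * P (exp (- s))) 0"
      proof -
        have "has_bochner_integral lborel (\<lambda>s. \<Sum>i\<le>n. a i * (h s * exp (- s) ^ i)) (\<Sum>i\<le>n. a i * 0)"
          by (intro has_bochner_integral_sum has_bochner_integral_mult_right pow)
        then show ?thesis by (simp add: an sum_distrib_left mult_ac)
      qed
      have bd: "\<bar>h s * (\<psi> (exp (- s)) - P (exp (- s)))\<bar> \<le> e * \<bar>h s\<bar>" for s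
      proof (cases "s < 0")
        case False
        then have "\<bar>\<psi> (exp (- s)) - P (exp (- s))\<bar> \<le> e"
          using P(2)[of "exp (- s)"] by simp
        then show ?thesis
          by (simp add: abs_mult) (metis abs_ge_zero mult.commute mult_right_mono)
      qed (simp add: h_neg)
      have [measurable]: "P \<in> borel_measurable borel" unfolding an by measurable
      have hm[measurable]: "h \<in> borel_measurable lborel" using h by (rule borel_measurable_integrable)
      have di: "integrable lborel (\<lambda>s. h s * (\<psi> (exp (- s)) - P (exp (- s))))"
      proof (rule Bochner_Integration.integrable_bound)
        show "integrable lborel (\<lambda>s. e * \<bar>h s\<bar>)" using h by simp
        show "AE s in lborel. norm (h s * (\<psi> (exp (- s)) - P (exp (- s)))) \<le> norm (e * \<bar>h s\<bar>)"
          using bd e by (auto simp: abs_mult)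
      qed (use m in measurable)
      have "(\<integral>s. h s * \<psi> (exp (- s)) \<partial>lborel)
          = (\<integral>s. h s * (\<psi> (exp (- s)) - P (exp (- s))) + h s * P (exp (- s)) \<partial>lborel)"
        by (simp add: algebra_simps)
      also have "\<dots> = (\<integral>s. h s * (\<psi> (exp (- s)) - P (exp (- s))) \<partial>lborel)"
        using di Pint by (subst Bochner_Integration.integral_add) (auto simp: has_bochner_integral_iff)
      also have "\<bar>\<dots>\<bar> \<le> (\<integral>s. e * \<bar>h s\<bar> \<partial>lborel)"
        using integral_abs_bound[of lborel "\<lambda>s. h s * (\<psi> (exp (- s)) - P (exp (- s)))"] di h bd
        by (intro order_trans[OF integral_abs_bound] integral_mono) auto
      finally show ?thesis by simp
    qed
    moreover have "((\<lambda>e. e * (\<integral>s. \<bar>h s\<bar> \<partial>lborel)) \<longlongrightarrow> 0 * (\<integral>s. \<bar>h s\<bar> \<partial>lborel)) (at_right 0)"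
      by (intro tendsto_intros)
    ultimately have "\<bar>\<integral>s. h s * \<psi> (exp (- s)) \<partial>lborel\<bar> \<le> 0 * (\<integral>s. \<bar>h s\<bar> \<partial>lborel)"
      by (intro tendsto_lowerbound) (auto simp: eventually_at_right_field intro!: exI[of _ 1])
    then show ?thesis by simp
  qed
  have interval: "(\<integral>s. h s * indicator {a<..<b} s \<partial>lborel) = 0" for a b :: real
  proof -
    \<comment> \<open>Trapezoids on the image \<open>(exp (- b), exp (- a))\<close> of the interval, increasing to its indicator.\<close>
    define \<psi> where "\<psi> k x = min 1 (real k * max 0 (min (x - exp (- b)) (exp (- a) - x)))" for k and x :: real
    have c: "continuous_on UNIV (\<psi> k)" for k
      unfolding \<psi>_def by (intro continuous_intros)
    then have m[measurable]: "\<psi> k \<in> borel_measurable borel" for k by (rule borel_measurable_continuous_onI)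
    have hm[measurable]: "h \<in> borel_measurable lborel" using h by (rule borel_measurable_integrable)
    have lim: "(\<lambda>k. \<psi> k (exp (- s))) \<longlonglongrightarrow> indicator {a<..<b} s" for s
    proof (cases "s \<in> {a<..<b}")
      case True
      define y where "y = min (exp (- s) - exp (- b)) (exp (- a) - exp (- s))"
      have y: "y > 0" using True by (simp add: y_def)
      obtain K where K: "real K > 1 / y" using reals_Archimedean2 by blast
      have "\<psi> k (exp (- s)) = 1" if "k \<ge> K" for k
      proof -
        have "real k > 1 / y" using K that by linarith
        then have "real k * y > 1" using y by (simp add: field_simps)
        then show ?thesis using y by (simp add: \<psi>_def y_def[symmetric])
      qed
      then have "\<forall>\<^sub>F k in sequentially. \<psi> k (exp (- s)) = 1"
        by (auto simp: eventually_sequentially)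
      then show ?thesis using True by (simp add: tendsto_eventually)
    next
      case False
      then have "min (exp (- s) - exp (- b)) (exp (- a) - exp (- s)) \<le> 0"
        by (auto simp: min_le_iff_disj)
      then have "max 0 (min (exp (- s) - exp (- b)) (exp (- a) - exp (- s))) = 0" by (rule max_absorb1)
      then show ?thesis using False by (simp add: \<psi>_def)
    qed
    have \<psi>_bd: "\<bar>\<psi> k x\<bar> \<le> 1" for k x by (simp add: \<psi>_def)
    have "(\<lambda>k. \<integral>s. h s * \<psi> k (exp (- s)) \<partial>lborel) \<longlonglongrightarrow> (\<integral>s. h s * indicator {a<..<b} s \<partial>lborel)"
    proof (rule integral_dominated_convergence[where w = "\<lambda>s. \<bar>h s\<bar>"])
      show "AE s in lborel. (\<lambda>k. h s * \<psi> k (exp (- s))) \<longlonglongrightarrow> h s * indicator {a<..<b} s"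
        using lim by (auto intro!: tendsto_intros)
      show "AE s in lborel. norm (h s * \<psi> k (exp (- s))) \<le> \<bar>h s\<bar>" for k
        using mult_left_mono[OF \<psi>_bd] by (fastforce simp: abs_mult)
    qed (use h in auto)
    then show ?thesis using cont[OF c] LIMSEQ_unique[of "\<lambda>_. 0"] by auto
  qed
  have "\<forall>\<^sub>F s in at_left t. g s > 0"
    using order_tendstoD(1)[OF left[unfolded continuous_within] gt] .
  then obtain b where b: "b < t" "\<And>s. b < s \<Longrightarrow> s < t \<Longrightarrow> g s > 0"
    unfolding eventually_at_left_field by blast
  define a where "a = max b 0"
  have a: "a < t" "0 \<le> a" using b t by (auto simp: a_def)
  have pos: "h s > 0" if "s \<in> {a<..<t}" for s
    using b(2)[of s] that u0 a by (auto simp: h_def a_def exponential_density_def)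
  have "AE s in lborel. h s * indicator {a<..<t} s = 0"
  proof (subst integral_nonneg_eq_0_iff_AE[symmetric])
    show "integrable lborel (\<lambda>s. h s * indicator {a<..<t} s)"
      using integrable_mult_indicator[OF _ h, of "{a<..<t}"] by (simp add: mult.commute)
    show "AE s in lborel. 0 \<le> h s * indicator {a<..<t} s"
      using pos by (auto simp: indicator_def less_imp_le)
  qed (rule interval)
  then have "AE s in lborel. s \<notin> {a<..<t}"
    by eventually_elim (use pos in \<open>fastforce simp: indicator_def split: if_splits\<close>)
  then have "emeasure lborel {a<..<t} = 0"
    by (subst (asm) AE_iff_measurable[of "{a<..<t}"]) auto
  then show False using a by simp
qed

lemma laplace_unique_left_continuous:
  fixes g :: "real \<Rightarrow> real"
  assumes "u0 > 0"
    and L: "\<And>u. u \<ge> u0 \<Longrightarrow> has_bochner_integral lborel (\<lambda>t. g t * exponential_density u t) 0"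
    and "t > 0" and left: "continuous (at_left t) g"
  shows "g t = 0"
proof (rule antisym)
  show "g t \<le> 0" by (rule laplace_zero_left_continuous_nonpos[OF assms])
  have "has_bochner_integral lborel (\<lambda>t. - g t * exponential_density u t) 0" if "u \<ge> u0" for u
    using has_bochner_integral_minus[OF L[OF that]] by simp
  then have "- g t \<le> 0"
    by (rule laplace_zero_left_continuous_nonpos[OF assms(1) _ assms(3)]) (use left in \<open>auto intro: continuous_intros\<close>)
  then show "0 \<le> g t" by simp
qed

section \<open>Counting jump patterns\<close>

definition jump_weight :: "nat \<Rightarrow> (nat \<Rightarrow> real) \<Rightarrow> nat \<Rightarrow> nat \<Rightarrow> real" where
  "jump_weight k lam r n = (\<Sum>a\<in>jump_counts k r n. multinomial k r a * (\<Prod>i=1..k. lam i ^ a i))"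

lemma finite_jump_counts: "finite (jump_counts k r n)"
proof (rule finite_subset)
  show "jump_counts k r n \<subseteq> {1..k} \<rightarrow>\<^sub>E {..r}"
  proof
    fix a assume a: "a \<in> jump_counts k r n"
    have "a i \<le> r" if "i \<in> {1..k}" for i
      using member_le_sum[of i "{1..k}" a] a that by (auto simp: jump_counts_def)
    then show "a \<in> {1..k} \<rightarrow>\<^sub>E {..r}"
      using a by (auto simp: jump_counts_def PiE_iff)
  qed
qed (auto intro: finite_PiE)

lemma jump_weight_eq:
  "jump_weight k lam r n = fact r * (\<Sum>a\<in>jump_counts k r n. \<Prod>i=1..k. lam i ^ a i / fact (a i))"
  by (simp add: jump_weight_def multinomial_def prod_dividef sum_distrib_left)

lemma jump_weight_0: "jump_weight k lam 0 n = (if n = 0 then 1 else 0)"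
proof -
  have 0: "jump_counts k 0 n = (if n = 0 then {\<lambda>i\<in>{1..k}. 0} else {})"
    by (auto simp: jump_counts_def PiE_iff extensional_def fun_eq_iff)
  show ?thesis by (simp add: jump_weight_eq 0)
qed

text \<open>
  Conditioning on the height \<open>j\<close> of one of the jumps.  For a pattern \<open>a\<close> with \<open>r + 1\<close> jumps,
  \<open>(r + 1)! / \<Prod> a\<^sub>i! = (\<Sum>j. a\<^sub>j r! / \<Prod> a\<^sub>i!)\<close>, and \<open>a\<^sub>j / \<Prod> a\<^sub>i!\<close> belongs to the pattern with one jump of
  height \<open>j\<close> removed.
\<close>
lemma jump_weight_Suc:
  "jump_weight k lam (Suc r) n = (\<Sum>j=1..min n k. lam j * jump_weight k lam r (n - j))"
proof -
  define G where "G a = (\<Prod>i=1..k. lam i ^ a i / fact (a i))" for a :: "nat \<Rightarrow> nat"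
  have step: "real (a j) * G a = lam j * G (a(j := a j - 1))" if j: "j \<in> {1..k}" and aj: "a j > 0" for a j
  proof -
    obtain m where m: "a j = Suc m" using aj gr0_implies_Suc by blast
    have G: "G b = lam j ^ b j / fact (b j) * (\<Prod>i\<in>{1..k} - {j}. lam i ^ b i / fact (b i))" for b
      unfolding G_def using j by (intro prod.remove) auto
    have R: "(\<Prod>i\<in>{1..k} - {j}. lam i ^ (a(j := m)) i / fact ((a(j := m)) i))
        = (\<Prod>i\<in>{1..k} - {j}. lam i ^ a i / fact (a i))"
      by (intro prod.cong) auto
    have "real (Suc m) * (lam j ^ Suc m / fact (Suc m)) = lam j * (lam j ^ m / fact m)"
      by (simp add: divide_simps del: of_nat_Suc)
    then show ?thesis
      unfolding m diff_Suc_1 G[of "a(j := m)"] G[of a] R by (simp only: m fun_upd_same mult.assoc[symmetric])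
  qed
  \<comment> \<open>Removing one jump of height \<open>j\<close> is a bijection onto the patterns with \<open>r\<close> jumps and total \<open>n - j\<close>.\<close>
  have bij: "(\<Sum>a\<in>{a \<in> jump_counts k (Suc r) n. a j > 0}. G (a(j := a j - 1)))
      = (if j \<le> n then \<Sum>a\<in>jump_counts k r (n - j). G a else 0)" if j: "j \<in> {1..k}" for j
  proof -
    have sums: "(\<Sum>i=1..k. c i * a i) = c j * a j + (\<Sum>i\<in>{1..k} - {j}. c i * a i)" for a c :: "nat \<Rightarrow> nat"
      using j by (intro sum.remove) auto
    have upd: "(\<Sum>i\<in>{1..k} - {j}. c i * (a(j := x)) i) = (\<Sum>i\<in>{1..k} - {j}. c i * a i)"
      for a c :: "nat \<Rightarrow> nat" and x
      by (intro sum.cong) auto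
    have sum1: "(\<Sum>i=1..k. (a(j := x)) i) + a j = (\<Sum>i=1..k. a i) + x"
      and sum2: "(\<Sum>i=1..k. i * (a(j := x)) i) + j * a j = (\<Sum>i=1..k. i * a i) + j * x"
      for a :: "nat \<Rightarrow> nat" and x
      using sums[of "\<lambda>_. 1" a] sums[of "\<lambda>_. 1" "a(j := x)"] upd[of "\<lambda>_. 1" a x]
        sums[of "\<lambda>i. i" a] sums[of "\<lambda>i. i" "a(j := x)"] upd[of "\<lambda>i. i" a x] by simp_all
    show ?thesis
    proof (cases "j \<le> n")
      case True
      have "(\<Sum>a\<in>{a \<in> jump_counts k (Suc r) n. a j > 0}. G (a(j := a j - 1))) = (\<Sum>a\<in>jump_counts k r (n - j). G a)"
      proof (rule sum.reindex_bij_witness[where j = "\<lambda>a. a(j := a j - 1)" and i = "\<lambda>a. a(j := Suc (a j))"])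
        fix a assume a: "a \<in> {a \<in> jump_counts k (Suc r) n. a j > 0}"
        then show "(a(j := a j - 1))(j := Suc ((a(j := a j - 1)) j)) = a" by auto
        have "j * a j = j * (a j - 1) + j"
          using a by (cases "a j") auto
        then show "a(j := a j - 1) \<in> jump_counts k r (n - j)"
          using a j sum1[of a "a j - 1"] sum2[of a "a j - 1"]
          by (auto simp: jump_counts_def PiE_iff extensional_def)
      next
        fix b assume b: "b \<in> jump_counts k r (n - j)"
        show "(b(j := Suc (b j)))(j := (b(j := Suc (b j))) j - 1) = b" by auto
        show "b(j := Suc (b j)) \<in> {a \<in> jump_counts k (Suc r) n. a j > 0}"
          using b j True sum1[of b "Suc (b j)"] sum2[of b "Suc (b j)"]
          by (auto simp: jump_counts_def PiE_iff extensional_def)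
      qed auto
      then show ?thesis using True by simp
    next
      case False
      have "a j = 0" if "a \<in> jump_counts k (Suc r) n" for a
      proof -
        have "j * a j \<le> n"
          using sums[of "\<lambda>i. i" a] that by (auto simp: jump_counts_def)
        then show ?thesis using False by (cases "a j") auto
      qed
      then have empty: "{a \<in> jump_counts k (Suc r) n. a j > 0} = {}" by auto
      show ?thesis unfolding empty using False by simp
    qed
  qed
  have "jump_weight k lam (Suc r) n = fact r * (\<Sum>a\<in>jump_counts k (Suc r) n. real (Suc r) * G a)"
    by (simp add: jump_weight_eq G_def sum_distrib_left mult_ac)
  also have "\<dots> = fact r * (\<Sum>a\<in>jump_counts k (Suc r) n. \<Sum>j=1..k. real (a j) * G a)"
  proof -
    have "real (Suc r) = (\<Sum>j=1..k. real (a j))" if "a \<in> jump_counts k (Suc r) n" for a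
      using that unfolding jump_counts_def by (metis (mono_tags, lifting) mem_Collect_eq of_nat_sum)
    then show ?thesis
      by (intro arg_cong[where f = "\<lambda>x. fact r * x"] sum.cong refl) (metis sum_distrib_right)
  qed
  also have "\<dots> = fact r * (\<Sum>j=1..k. \<Sum>a\<in>jump_counts k (Suc r) n. real (a j) * G a)"
    by (subst sum.swap) simp
  also have "\<dots> = fact r * (\<Sum>j=1..k. \<Sum>a\<in>{a \<in> jump_counts k (Suc r) n. a j > 0}. real (a j) * G a)"
    by (intro arg_cong[where f = "\<lambda>x. fact r * x"] sum.cong refl sum.mono_neutral_right)
      (auto simp: finite_jump_counts)
  also have "\<dots> = fact r * (\<Sum>j=1..k. lam j * (\<Sum>a\<in>{a \<in> jump_counts k (Suc r) n. a j > 0}. G (a(j := a j - 1))))"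
    by (intro arg_cong[where f = "\<lambda>x. fact r * x"] sum.cong refl)
      (auto simp: step sum_distrib_left)
  also have "\<dots> = (\<Sum>j=1..k. if j \<le> n then lam j * jump_weight k lam r (n - j) else 0)"
  proof -
    have jw: "fact r * (\<Sum>a\<in>jump_counts k r m. G a) = jump_weight k lam r m" for m
      by (simp add: jump_weight_eq G_def)
    have "fact r * (lam j * (\<Sum>a\<in>{a \<in> jump_counts k (Suc r) n. a j > 0}. G (a(j := a j - 1))))
        = (if j \<le> n then lam j * jump_weight k lam r (n - j) else 0)" if j: "j \<in> {1..k}" for j
      unfolding bij[OF j] jw[symmetric] by simp
    then show ?thesis
      by (subst sum_distrib_left) (rule sum.cong[OF refl])
  qed
  also have "\<dots> = (\<Sum>j=1..min n k. lam j * jump_weight k lam r (n - j))"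
    by (intro sum.mono_neutral_cong_right) auto
  finally show ?thesis .
qed

lemma jump_weight_eq_0: "n < r \<Longrightarrow> jump_weight k lam r n = 0"
proof (induction r arbitrary: n)
  case (Suc r)
  then have "lam j * jump_weight k lam r (n - j) = 0" if "j \<in> {1..min n k}" for j
  proof -
    have "n - j < r" using that Suc.prems by auto
    then show ?thesis by (simp add: Suc.IH)
  qed
  then show ?case unfolding jump_weight_Suc by (intro sum.neutral ballI)
qed simp

section \<open>The rational functions behind the state probabilities\<close>

text \<open>
  The variable of the three power series is \<open>y = u\<^bsup>- \<nu>\<^esup>\<close>, where \<open>u\<close> is the Laplace variable.  With
  \<open>\<phi> = u\<^bsup>2\<nu>\<^esup> + 2 l u\<^bsup>\<nu>\<^esup>\<close> one has \<open>\<phi> + \<Lambda> = char_fps / y\<^sup>2\<close>, the series \<open>moment_fps\<close> is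
  \<open>\<phi> / (\<phi> + \<Lambda>)\<^bsup>r+1\<^esup>\<close>, and \<open>state_fps\<close> is the transform of the probability of state \<open>n\<close>.
\<close>
definition char_fps :: "real \<Rightarrow> real \<Rightarrow> real fps" where
  "char_fps l \<Lambda> = 1 + fps_const (2 * l) * fps_X + fps_const \<Lambda> * fps_X ^ 2"

definition moment_fps :: "real \<Rightarrow> real \<Rightarrow> nat \<Rightarrow> real fps" where
  "moment_fps l \<Lambda> r = fps_X ^ (2 * r) * (1 + fps_const (2 * l) * fps_X) * inverse (char_fps l \<Lambda>) ^ Suc r"

definition state_fps :: "real \<Rightarrow> real \<Rightarrow> nat \<Rightarrow> (nat \<Rightarrow> real) \<Rightarrow> nat \<Rightarrow> real fps" where
  "state_fps l \<Lambda> k lam n = (\<Sum>r=0..n. fps_const (jump_weight k lam r n) * moment_fps l \<Lambda> r)"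

lemma fps_conv_radius_mult_pos:
  fixes A B :: "real fps"
  assumes "fps_conv_radius A > 0" "fps_conv_radius B > 0"
  shows "fps_conv_radius (A * B) > 0"
  using assms by (intro less_le_trans[OF _ fps_conv_radius_mult]) simp

lemma fps_conv_radius_add_pos:
  fixes A B :: "real fps"
  assumes "fps_conv_radius A > 0" "fps_conv_radius B > 0"
  shows "fps_conv_radius (A + B) > 0"
  using assms by (intro less_le_trans[OF _ fps_conv_radius_add]) simp

lemma fps_conv_radius_power_pos:
  fixes A :: "real fps"
  assumes "fps_conv_radius A > 0"
  shows "fps_conv_radius (A ^ n) > 0"
  using assms by (intro less_le_trans[OF _ fps_conv_radius_power])

lemma fps_conv_radius_sum_pos:
  fixes A :: "'i \<Rightarrow> real fps"
  assumes "\<And>i. i \<in> I \<Longrightarrow> fps_conv_radius (A i) > 0"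
  shows "fps_conv_radius (\<Sum>i\<in>I. A i) > 0"
  using assms by (induction I rule: infinite_finite_induct) (auto intro!: fps_conv_radius_add_pos)

lemmas fps_conv_radius_pos_intros =
  fps_conv_radius_mult_pos fps_conv_radius_add_pos fps_conv_radius_power_pos fps_conv_radius_inverse_pos

lemma fps_conv_radius_char_fps: "fps_conv_radius (char_fps l \<Lambda>) = \<infinity>"
proof -
  have "fps_conv_radius (fps_const c * fps_X ^ m :: real fps) \<ge> \<infinity>" for c m
    by (rule order_trans[OF _ fps_conv_radius_mult]) simp
  then have i: "fps_conv_radius (fps_const c * fps_X ^ m :: real fps) = \<infinity>" for c m by simp
  have j: "fps_conv_radius (A + B) = \<infinity>" if "fps_conv_radius A = \<infinity>" "fps_conv_radius B = \<infinity>" for A B :: "real fps"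
    using fps_conv_radius_add[of A B] that by simp
  show ?thesis unfolding char_fps_def using i[of _ 1] i by (intro j) auto
qed

lemma char_fps_nth_0 [simp]: "fps_nth (char_fps l \<Lambda>) 0 = 1"
  by (simp add: char_fps_def)

lemma fps_conv_radius_moment_fps: "fps_conv_radius (moment_fps l \<Lambda> r) > 0"
  unfolding moment_fps_def
  by (intro fps_conv_radius_pos_intros) (auto simp: fps_conv_radius_char_fps)

lemma fps_conv_radius_state_fps: "fps_conv_radius (state_fps l \<Lambda> k lam n) > 0"
  unfolding state_fps_def
  by (intro fps_conv_radius_sum_pos fps_conv_radius_mult_pos fps_conv_radius_moment_fps) auto

lemma frac_series_sum_cmult:
  assumes \<nu>: "0 < \<nu>" and A: "\<And>j. j \<in> I \<Longrightarrow> fps_conv_radius (A j) > 0"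
  shows "frac_series \<nu> (\<Sum>j\<in>I. fps_const (c j) * A j) t = (\<Sum>j\<in>I. c j * frac_series \<nu> (A j) t)"
proof (cases "finite I")
  case True
  then show ?thesis using A
  proof (induction I)
    case empty
    then show ?case using frac_series_cmult[OF \<nu>, of 1 0 t] by simp
  next
    case (insert j I)
    then show ?case
      by (simp add: frac_series_add frac_series_cmult \<nu> fps_conv_radius_sum_pos fps_conv_radius_mult_pos)
  qed
next
  case False
  then show ?thesis using frac_series_cmult[OF \<nu>, of 1 0 t] by simp
qed

lemma frac_series_state_fps:
  assumes "0 < \<nu>"
  shows "frac_series \<nu> (state_fps l \<Lambda> k lam n) t
    = (\<Sum>r=0..n. jump_weight k lam r n * frac_series \<nu> (moment_fps l \<Lambda> r) t)"
  unfolding state_fps_def by (rule frac_series_sum_cmult[OF assms fps_conv_radius_moment_fps])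
lemma inverse_char_fps: "char_fps l \<Lambda> * inverse (char_fps l \<Lambda>) = 1"
  by (simp add: inverse_mult_eq_1')

lemma char_fps_moment_fps_0: "char_fps l \<Lambda> * moment_fps l \<Lambda> 0 = 1 + fps_const (2 * l) * fps_X"
  using inverse_char_fps[of l \<Lambda>] by (simp add: moment_fps_def mult_ac)

lemma char_fps_moment_fps_Suc: "char_fps l \<Lambda> * moment_fps l \<Lambda> (Suc r) = fps_X ^ 2 * moment_fps l \<Lambda> r"
proof -
  have "char_fps l \<Lambda> * moment_fps l \<Lambda> (Suc r)
    = (char_fps l \<Lambda> * inverse (char_fps l \<Lambda>)) * (fps_X ^ 2 * moment_fps l \<Lambda> r)"
    by (simp add: moment_fps_def power2_eq_square mult_ac)
  then show ?thesis by (simp add: inverse_char_fps)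
qed

text \<open>
  The recursion for \<open>jump_weight\<close> meets \<open>char_fps * moment_fps (r + 1) = y\<^sup>2 * moment_fps r\<close>: this is
  the governing equation on the level of transforms, including the initial condition.
\<close>
lemma char_fps_state_fps:
  "char_fps l \<Lambda> * state_fps l \<Lambda> k lam n = (if n = 0 then 1 + fps_const (2 * l) * fps_X else 0)
     + fps_X ^ 2 * (\<Sum>j=1..min n k. fps_const (lam j) * state_fps l \<Lambda> k lam (n - j))"
proof (cases n)
  case 0
  then show ?thesis by (simp add: state_fps_def jump_weight_0 char_fps_moment_fps_0)
next
  case (Suc n')
  have ext: "state_fps l \<Lambda> k lam (n - j) = (\<Sum>r=0..n'. fps_const (jump_weight k lam r (n - j)) * moment_fps l \<Lambda> r)"
    if "j \<ge> 1" for j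
    unfolding state_fps_def using that Suc
    by (intro sum.mono_neutral_left) (auto simp: jump_weight_eq_0)
  have "state_fps l \<Lambda> k lam n = (\<Sum>r=0..n'. fps_const (jump_weight k lam (Suc r) n) * moment_fps l \<Lambda> (Suc r))"
    unfolding state_fps_def Suc
    by (subst sum.atLeast0_atMost_Suc_shift) (simp add: jump_weight_0)
  then have "char_fps l \<Lambda> * state_fps l \<Lambda> k lam n
     = (\<Sum>r=0..n'. fps_const (jump_weight k lam (Suc r) n) * (char_fps l \<Lambda> * moment_fps l \<Lambda> (Suc r)))"
    by (simp add: sum_distrib_left mult_ac)
  also have "\<dots> = fps_X ^ 2 * (\<Sum>r=0..n'. fps_const (jump_weight k lam (Suc r) n) * moment_fps l \<Lambda> r)"
    by (simp add: char_fps_moment_fps_Suc sum_distrib_left mult_ac)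
  also have "(\<Sum>r=0..n'. fps_const (jump_weight k lam (Suc r) n) * moment_fps l \<Lambda> r)
     = (\<Sum>r=0..n'. \<Sum>j=1..min n k. fps_const (lam j) * (fps_const (jump_weight k lam r (n - j)) * moment_fps l \<Lambda> r))"
  proof (intro sum.cong refl)
    fix r
    have "fps_const (jump_weight k lam (Suc r) n)
        = (\<Sum>j=1..min n k. fps_const (lam j) * fps_const (jump_weight k lam r (n - j)))"
      by (simp add: jump_weight_Suc fps_eq_iff fps_sum_nth)
    then show "fps_const (jump_weight k lam (Suc r) n) * moment_fps l \<Lambda> r
        = (\<Sum>j=1..min n k. fps_const (lam j) * (fps_const (jump_weight k lam r (n - j)) * moment_fps l \<Lambda> r))"
      by (simp add: sum_distrib_right mult.assoc del: fps_const_mult)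
  qed
  also have "\<dots> = (\<Sum>j=1..min n k. fps_const (lam j) * state_fps l \<Lambda> k lam (n - j))"
    by (subst sum.swap) (auto simp: ext sum_distrib_left intro!: sum.cong)
  finally show ?thesis using Suc by simp
qed

text \<open>
  The constant coefficient is the initial value.  The vanishing of the next one is what makes the
  derivative of order \<open>2 \<nu>\<close> of the probabilities free of a term \<open>t\<^bsup>- \<nu>\<^esup>\<close>.
\<close>
lemma state_fps_low_coeffs:
  "fps_nth (state_fps l \<Lambda> k lam n) 0 = (if n = 0 then 1 else 0)"
  "fps_nth (state_fps l \<Lambda> k lam n) 1 = 0"
proof -
  let ?P = "state_fps l \<Lambda> k lam n"
  have c: "fps_nth (char_fps l \<Lambda> * ?P) 0 = fps_nth ?P 0"
    "fps_nth (char_fps l \<Lambda> * ?P) 1 = fps_nth ?P 1 + 2 * l * fps_nth ?P 0"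
    by (simp_all add: fps_mult_nth char_fps_def)
  show z: "fps_nth ?P 0 = (if n = 0 then 1 else 0)"
    using c(1) unfolding char_fps_state_fps by (simp split: if_splits)
  show "fps_nth ?P 1 = 0"
    using c(2) z unfolding char_fps_state_fps by (simp split: if_splits)
qed

text \<open>
  The fractional equation in terms of coefficients, where shifts by two and by one place stand for
  the derivatives of orders \<open>2 \<nu>\<close> and \<open>\<nu>\<close>: compare the coefficients of index \<open>m + 2\<close> in
  \<open>char_fps_state_fps\<close>.
\<close>
lemma state_fps_governing:
  "fps_shift 2 (state_fps l \<Lambda> k lam n) + fps_const (2 * l) * fps_shift 1 (state_fps l \<Lambda> k lam n)
   = - (fps_const \<Lambda> * state_fps l \<Lambda> k lam n) + (\<Sum>j=1..min n k. fps_const (lam j) * state_fps l \<Lambda> k lam (n - j))"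
    (is "?L = - (_ * ?P) + ?S")
proof (rule fps_ext)
  fix m
  have "fps_nth (char_fps l \<Lambda> * ?P) (m + 2)
      = fps_nth (?P + fps_X * (fps_const (2 * l) * ?P) + fps_X ^ 2 * (fps_const \<Lambda> * ?P)) (m + 2)"
    by (simp add: char_fps_def algebra_simps)
  also have "\<dots> = fps_nth ?P (m + 2) + 2 * l * fps_nth ?P (m + 1) + \<Lambda> * fps_nth ?P m"
    by (simp add: fps_X_power_mult_nth)
  finally have "fps_nth ?P (m + 2) + 2 * l * fps_nth ?P (m + 1) + \<Lambda> * fps_nth ?P m = fps_nth ?S m"
    unfolding char_fps_state_fps by (simp add: fps_X_power_mult_nth split: if_splits)
  then show "fps_nth ?L m = fps_nth (- (fps_const \<Lambda> * ?P) + ?S) m"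
    by (simp add: algebra_simps)
qed

text \<open>
  Multiplying by the power of \<open>char_fps\<close> avoids evaluating an inverse series.
\<close>
lemma eval_moment_fps:
  assumes "u > 0" "l > 0" "\<Lambda> \<ge> 0" "ereal (u powr (- \<nu>)) < fps_conv_radius (moment_fps l \<Lambda> r)"
  shows "eval_fps (moment_fps l \<Lambda> r) (u powr (- \<nu>))
    = (u powr (2 * \<nu>) + 2 * l * u powr \<nu>) / (u powr (2 * \<nu>) + 2 * l * u powr \<nu> + \<Lambda>) ^ Suc r"
proof -
  define y where "y = u powr (- \<nu>)"
  have y: "y > 0" using assms by (simp add: y_def)
  have Q: "eval_fps (char_fps l \<Lambda>) y = 1 + 2 * l * y + \<Lambda> * y\<^sup>2"
  proof -
    have c: "eval_fps (fps_const a * B) y = a * eval_fps B y" "fps_conv_radius (fps_const a * B) = \<infinity>"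
      if "fps_conv_radius B = \<infinity>" for a and B :: "real fps"
      using that fps_conv_radius_mult[of "fps_const a" B] by (auto simp: eval_fps_mult)
    have d: "fps_conv_radius (1 + fps_const (2 * l) * fps_X) = \<infinity>"
      using fps_conv_radius_add[of 1 "fps_const (2 * l) * fps_X"] c(2)[of fps_X "2 * l"] by simp
    show ?thesis unfolding char_fps_def
      by (simp add: eval_fps_add c d)
  qed
  have "char_fps l \<Lambda> ^ Suc r * moment_fps l \<Lambda> r = fps_X ^ (2 * r) * (1 + fps_const (2 * l) * fps_X)
      * (char_fps l \<Lambda> * inverse (char_fps l \<Lambda>)) ^ Suc r"
    by (simp add: moment_fps_def power_mult_distrib mult_ac)
  then have e: "char_fps l \<Lambda> ^ Suc r * moment_fps l \<Lambda> r = fps_X ^ (2 * r) + fps_const (2 * l) * fps_X ^ Suc (2 * r)"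
    by (simp add: inverse_char_fps algebra_simps)
  have R: "fps_conv_radius (char_fps l \<Lambda> ^ Suc r) = \<infinity>"
    using fps_conv_radius_power[of "char_fps l \<Lambda>" "Suc r"] by (simp add: fps_conv_radius_char_fps)
  have "eval_fps (char_fps l \<Lambda> ^ Suc r * moment_fps l \<Lambda> r) y
     = (1 + 2 * l * y + \<Lambda> * y\<^sup>2) ^ Suc r * eval_fps (moment_fps l \<Lambda> r) y"
    using assms y R by (simp add: eval_fps_mult eval_fps_power fps_conv_radius_char_fps Q y_def[symmetric] del: power_Suc)
  moreover have "eval_fps (char_fps l \<Lambda> ^ Suc r * moment_fps l \<Lambda> r) y = y ^ (2 * r) * (1 + 2 * l * y)"
  proof -
    have "fps_conv_radius (fps_const (2 * l) * fps_X ^ Suc (2 * r)) = \<infinity>"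
      using fps_conv_radius_mult[of "fps_const (2 * l)" "fps_X ^ Suc (2 * r)"] by (simp del: power_Suc)
    then show ?thesis unfolding e by (simp add: eval_fps_add eval_fps_mult algebra_simps del: power_Suc) simp
  qed
  moreover have p: "1 + 2 * l * y + \<Lambda> * y\<^sup>2 > 0"
    using assms y by (intro add_pos_nonneg) auto
  ultimately have ev: "eval_fps (moment_fps l \<Lambda> r) y = y ^ (2 * r) * (1 + 2 * l * y) / (1 + 2 * l * y + \<Lambda> * y\<^sup>2) ^ Suc r"
    by (metis eq_divide_imp less_irrefl mult.commute power_not_zero)
  have u1: "u powr \<nu> = 1 / y" by (simp add: y_def powr_minus field_simps)
  have u2: "u powr (2 * \<nu>) = 1 / y\<^sup>2"
  proof -
    have "u powr (2 * \<nu>) = u powr \<nu> * u powr \<nu>" by (simp only: mult_2 powr_add)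
    then show ?thesis by (simp add: u1 power2_eq_square)
  qed
  have "u powr (2 * \<nu>) + 2 * l * u powr \<nu> + \<Lambda> = (1 + 2 * l * y + \<Lambda> * y\<^sup>2) / y\<^sup>2"
    using y unfolding u1 u2 by (simp add: field_simps power2_eq_square)
  moreover have "u powr (2 * \<nu>) + 2 * l * u powr \<nu> = (1 + 2 * l * y) / y\<^sup>2"
    using y unfolding u1 u2 by (simp add: field_simps power2_eq_square)
  moreover have "(c / y\<^sup>2) / (d / y\<^sup>2) ^ Suc r = y ^ (2 * r) * c / d ^ Suc r" for c d
  proof -
    have "(y\<^sup>2) ^ Suc r = y\<^sup>2 * y ^ (2 * r)"
      by (simp add: power_mult)
    then have "(d / y\<^sup>2) ^ Suc r = d ^ Suc r / (y\<^sup>2 * y ^ (2 * r))"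
      by (simp only: power_divide)
    then show ?thesis using y by (simp del: power_Suc)
  qed
  ultimately show ?thesis
    unfolding ev y_def[symmetric] by (simp only:)
qed

section \<open>Mittag-Leffler functions as fractional series\<close>

lemma frac_series_add_cmult:
  assumes "0 < \<nu>" "fps_conv_radius A > 0" "fps_conv_radius B > 0"
  shows "frac_series \<nu> (A + fps_const c * B) t = frac_series \<nu> A t + c * frac_series \<nu> B t"
  using assms by (simp add: frac_series_add frac_series_cmult fps_conv_radius_mult_pos)

lemma fps_nth_inverse_linear_power:
  fixes c :: real
  shows "fps_nth (inverse (1 - fps_const c * fps_X) ^ s) m = pochhammer (real s) m * c ^ m / fact m"
proof -
  have "inverse (1 - fps_const c * fps_X) ^ s = fps_compose (fps_binomial (- real s)) (fps_const (- c) * fps_X)"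
    using one_minus_fps_X_const_neg_power[of c s] by (simp add: fps_inverse_power)
  then have "fps_nth (inverse (1 - fps_const c * fps_X) ^ s) m = (- c) ^ m * ((- real s) gchoose m)"
    by (simp add: fps_compose_linear)
  moreover have "(- c) ^ m = (- 1) ^ m * c ^ m" "(- 1) ^ m * (- 1 :: real) ^ m = 1"
    by (rule power_minus, metis mult_minus1 power_mult_distrib power_one minus_minus)
  ultimately show ?thesis
    by (simp add: gbinomial_pochhammer)
qed

lemma fps_conv_radius_inverse_linear_power:
  fixes c :: real
  shows "fps_conv_radius (inverse (1 - fps_const c * fps_X) ^ s) > 0"
proof -
  have "fps_conv_radius (1 - fps_const c * fps_X) = \<infinity>"
    using fps_conv_radius_diff[of 1 "fps_const c * fps_X"] fps_conv_radius_mult[of "fps_const c" fps_X] by simp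
  then show ?thesis by (intro fps_conv_radius_pos_intros) auto
qed

lemma frac_series_X_power_mult:
  assumes \<nu>: "0 < \<nu>" and B: "fps_conv_radius B > 0"
  shows "frac_series \<nu> (fps_X ^ s * B) t
    = (t powr \<nu>) ^ s * (\<Sum>m. fps_nth B m / Gamma (\<nu> * real m + (real s * \<nu> + 1)) * (t powr \<nu>) ^ m)"
    and "summable (\<lambda>m. \<bar>fps_nth B m\<bar> / Gamma (\<nu> * real m + (real s * \<nu> + 1)) * (t powr \<nu>) ^ m)"
proof -
  let ?T = "t powr \<nu>"
  let ?h = "\<lambda>m. fps_nth B m / Gamma (\<nu> * real m + (real s * \<nu> + 1)) * ?T ^ m"
  let ?A = "fps_X ^ s * B"
  have A: "fps_conv_radius ?A > 0" using B by (intro fps_conv_radius_mult_pos) auto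
  have idx: "fps_nth ?A (m + s) = fps_nth B m" "\<nu> * real (m + s) + 1 = \<nu> * real m + (real s * \<nu> + 1)" for m
    by (simp add: fps_X_power_mult_nth, simp add: algebra_simps)
  have sh: "fps_nth ?A (m + s) / Gamma (\<nu> * real (m + s) + 1) * ?T ^ (m + s) = ?T ^ s * ?h m" for m
    by (simp only: idx) (simp add: power_add)
  have "(\<lambda>m. ?T ^ s * ?h m) sums frac_series \<nu> ?A t"
    using frac_series_sums[OF \<nu> A, of t] unfolding sh[symmetric]
    by (subst sums_iff_shift) (simp add: fps_X_power_mult_nth)
  moreover have "summable (\<lambda>m. \<bar>fps_nth B m\<bar> / Gamma (\<nu> * real m + (real s * \<nu> + 1)) * ?T ^ m)"
  proof (cases "t = 0")
    case True
    then show ?thesis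
      using summable_finite[of "{0}" "\<lambda>m. \<bar>fps_nth B m\<bar> / Gamma (\<nu> * real m + (real s * \<nu> + 1)) * ?T ^ m"] by simp
  next
    case False
    have sh': "\<bar>fps_nth ?A (m + s)\<bar> / Gamma (\<nu> * real (m + s) + 1) * ?T ^ (m + s)
        = ?T ^ s * (\<bar>fps_nth B m\<bar> / Gamma (\<nu> * real m + (real s * \<nu> + 1)) * ?T ^ m)" for m
      by (simp only: idx) (simp add: power_add)
    have "summable (\<lambda>m. ?T ^ s * (\<bar>fps_nth B m\<bar> / Gamma (\<nu> * real m + (real s * \<nu> + 1)) * ?T ^ m))"
      using frac_series_abs_summable[OF \<nu> A, of t] unfolding sh'[symmetric] by (subst summable_iff_shift)
    then show ?thesis using False by (subst (asm) summable_cmult_iff) auto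
  qed
  then show s: "summable (\<lambda>m. \<bar>fps_nth B m\<bar> / Gamma (\<nu> * real m + (real s * \<nu> + 1)) * ?T ^ m)" .
  have "Gamma (\<nu> * real m + (real s * \<nu> + 1)) > 0" for m
    using \<nu> by (intro Gamma_real_pos) (simp add: add_nonneg_pos)
  then have "norm (?h m) = \<bar>fps_nth B m\<bar> / Gamma (\<nu> * real m + (real s * \<nu> + 1)) * ?T ^ m" for m
    by (simp add: abs_mult less_imp_le)
  then have "summable ?h" using s by (intro summable_norm_cancel[of ?h]) simp
  then have "(\<lambda>m. ?T ^ s * ?h m) sums (?T ^ s * (\<Sum>m. ?h m))"
    by (intro sums_mult summable_sums)
  ultimately show "frac_series \<nu> ?A t = ?T ^ s * (\<Sum>m. ?h m)"
    using sums_unique2 by blast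
qed

lemma frac_series_inverse_linear_power:
  assumes \<nu>: "0 < \<nu>"
  shows "frac_series \<nu> (fps_X ^ s * inverse (1 - fps_const c * fps_X) ^ q) t
    = (t powr \<nu>) ^ s * mittag_leffler3 \<nu> (real s * \<nu> + 1) (real q) (c * t powr \<nu>)"
  unfolding mittag_leffler3_def
  by (subst frac_series_X_power_mult(1)[OF \<nu> fps_conv_radius_inverse_linear_power])
    (simp add: fps_nth_inverse_linear_power power_mult_distrib mult.assoc)

text \<open>
  The bivariate function is an iterated sum, whereas a product of power series is summed along
  diagonals; absolute convergence along the diagonals makes the two agree.
\<close>
lemma iterated_suminf_eq_diagonal:
  fixes f :: "nat \<Rightarrow> nat \<Rightarrow> real"
  assumes "summable (\<lambda>m. \<Sum>i\<le>m. \<bar>f i (m - i)\<bar>)"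
  shows "(\<Sum>i. \<Sum>j. f i j) = (\<Sum>m. \<Sum>i\<le>m. f i (m - i))"
proof -
  let ?S = "SIGMA m:UNIV. {..m::nat}"
  let ?g = "\<lambda>(m, i). f i (m - i)"
  have "(\<lambda>x. norm (?g x)) summable_on ?S"
    unfolding Infinite_Sum.abs_summable_on_Sigma_iff using assms
    by (simp add: summable_on_UNIV_nonneg_real_iff sum_nonneg)
  then have sg: "?g summable_on ?S" by (rule abs_summable_summable)
  have "(\<lambda>(i, j). f i j) summable_on (UNIV \<times> UNIV) \<longleftrightarrow> ?g summable_on ?S"
    by (rule summable_on_reindex_bij_witness[where j = "\<lambda>(i, j). (i + j, i)" and i = "\<lambda>(m, i). (i, m - i)"]) auto
  with sg have sf: "(\<lambda>(i, j). f i j) summable_on (UNIV \<times> UNIV)" by simp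
  have eq: "infsum (\<lambda>(i, j). f i j) (UNIV \<times> UNIV) = infsum ?g ?S"
    by (rule infsum_reindex_bij_witness[where j = "\<lambda>(i, j). (i + j, i)" and i = "\<lambda>(m, i). (i, m - i)"]) auto
  have inner: "f i summable_on UNIV" for i
  proof -
    have "(\<lambda>(i, j). f i j) summable_on ({i} \<times> UNIV)"
      using sf by (rule summable_on_subset_banach) auto
    moreover have "(\<lambda>(i, j). f i j) summable_on ({i} \<times> UNIV) \<longleftrightarrow> f i summable_on UNIV"
      by (rule summable_on_reindex_bij_witness[where j = snd and i = "Pair i"]) auto
    ultimately show ?thesis by simp
  qed
  have inf_eq: "infsum h UNIV = suminf h" if "h summable_on UNIV" for h :: "nat \<Rightarrow> real"
    using has_sum_imp_sums[OF has_sum_infsum[OF that]] by (simp add: sums_iff)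
  have "(\<Sum>i. \<Sum>j. f i j) = (\<Sum>i. infsum (f i) UNIV)"
    using inf_eq[OF inner] by simp
  also have "\<dots> = infsum (\<lambda>i. infsum (f i) UNIV) UNIV"
    using inf_eq[OF summable_on_Sigma_banach[OF sf]] by simp
  also have "\<dots> = infsum ?g ?S"
    using infsum_Sigma'_banach[OF sf] eq by simp
  also have "\<dots> = infsum (\<lambda>m. infsum (\<lambda>i. f i (m - i)) {..m}) UNIV"
    using infsum_Sigma'_banach[OF sg] by simp
  also have "\<dots> = (\<Sum>m. \<Sum>i\<le>m. f i (m - i))"
    using inf_eq[OF summable_on_Sigma_banach[OF sg]] by simp
  finally show ?thesis .
qed

lemma frac_series_inverse_two_linear_powers:
  assumes \<nu>: "0 < \<nu>"
  shows "frac_series \<nu> (fps_X ^ s * (inverse (1 - fps_const c * fps_X) ^ q * inverse (1 - fps_const d * fps_X) ^ q')) t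
    = (t powr \<nu>) ^ s * mittag_leffler_bivariate \<nu> (real s * \<nu> + 1) (real q) (real q') (c * t powr \<nu>) (d * t powr \<nu>)"
proof -
  let ?T = "t powr \<nu>"
  let ?B = "inverse (1 - fps_const c * fps_X) ^ q" and ?C = "inverse (1 - fps_const d * fps_X) ^ q'"
  let ?\<Gamma> = "\<lambda>m. Gamma (\<nu> * real m + (real s * \<nu> + 1))"
  define f where "f i j = fps_nth ?B i * fps_nth ?C j / ?\<Gamma> (i + j) * ?T ^ (i + j)" for i j
  have G: "?\<Gamma> m > 0" for m
    using \<nu> by (intro Gamma_real_pos) (simp add: add_nonneg_pos)
  have BC: "fps_conv_radius (?B * ?C) > 0"
    by (intro fps_conv_radius_mult_pos fps_conv_radius_inverse_linear_power)
  \<comment> \<open>Absolute convergence: replace both factors by the series of absolute values.\<close>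
  define B' C' where "B' = Abs_fps (\<lambda>m. \<bar>fps_nth ?B m\<bar>)" and "C' = Abs_fps (\<lambda>m. \<bar>fps_nth ?C m\<bar>)"
  have BC': "fps_conv_radius (B' * C') > 0"
    using fps_conv_radius_norm[of ?B] fps_conv_radius_norm[of ?C]
    by (intro fps_conv_radius_mult_pos) (simp_all add: B'_def C'_def fps_conv_radius_inverse_linear_power)
  have nonneg: "fps_nth (B' * C') m \<ge> 0" for m
    by (simp add: fps_mult_nth B'_def C'_def sum_nonneg)
  have absf: "\<bar>f i j\<bar> = \<bar>fps_nth ?B i\<bar> * \<bar>fps_nth ?C j\<bar> / ?\<Gamma> (i + j) * ?T ^ (i + j)" for i j
    unfolding f_def using G[of "i + j"] by (simp add: abs_mult del: of_nat_add)
  have "(\<Sum>i\<le>m. \<bar>f i (m - i)\<bar>) = fps_nth (B' * C') m / ?\<Gamma> m * ?T ^ m" for m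
    unfolding absf fps_mult_nth atLeast0AtMost sum_divide_distrib sum_distrib_right
    by (intro sum.cong refl) (simp add: B'_def C'_def)
  then have "summable (\<lambda>m. \<Sum>i\<le>m. \<bar>f i (m - i)\<bar>)"
    using frac_series_X_power_mult(2)[OF \<nu> BC', of s t] nonneg by simp
  note diag = iterated_suminf_eq_diagonal[OF this]
  have f_diag: "(\<Sum>i\<le>m. f i (m - i)) = fps_nth (?B * ?C) m / ?\<Gamma> m * ?T ^ m" for m
    unfolding f_def fps_mult_nth atLeast0AtMost sum_divide_distrib sum_distrib_right
    by (intro sum.cong refl) simp
  have "frac_series \<nu> (fps_X ^ s * (?B * ?C)) t = ?T ^ s * (\<Sum>i. \<Sum>j. f i j)"
    unfolding frac_series_X_power_mult(1)[OF \<nu> BC] diag f_diag ..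
  also have "(\<Sum>i. \<Sum>j. f i j) = mittag_leffler_bivariate \<nu> (real s * \<nu> + 1) (real q) (real q') (c * ?T) (d * ?T)"
    unfolding mittag_leffler_bivariate_def f_def fps_nth_inverse_linear_power
    by (intro suminf_cong) (simp add: power_mult_distrib power_add mult_ac)
  finally show ?thesis .
qed

text \<open>
  For \<open>\<Lambda> = l\<^sup>2\<close> the denominator is \<open>(1 + l y)\<^bsup>2r+2\<^esup>\<close>.  Splitting the numerator as
  \<open>1 + 2 l y = (1 + l y) + l y\<close> cancels one factor in the first part, whence the different
  third parameters \<open>2 r + 1\<close> and \<open>2 r + 2\<close> of the two Mittag-Leffler functions.
\<close>
lemma frac_series_moment_fps_critical:
  assumes \<nu>: "0 < \<nu>"
  shows "frac_series \<nu> (moment_fps l (l\<^sup>2) r) t =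
     (t powr \<nu>) ^ (2 * r) * mittag_leffler3 \<nu> (2 * real r * \<nu> + 1) (2 * real r + 1) (- l * t powr \<nu>)
   + l * (t powr \<nu>) ^ (2 * r + 1) * mittag_leffler3 \<nu> ((2 * real r + 1) * \<nu> + 1) (2 * real r + 2) (- l * t powr \<nu>)"
proof -
  let ?D = "1 - fps_const (- l) * fps_X :: real fps"
  have D: "?D * inverse ?D = 1" by (rule inverse_mult_eq_1') simp
  have E: "fps_conv_radius (fps_X ^ s * inverse ?D ^ q) > 0" for s q
    by (intro fps_conv_radius_mult_pos fps_conv_radius_inverse_linear_power) auto
  have c2: "fps_const (2 * l) = fps_const l + fps_const l" "fps_const (l\<^sup>2) = fps_const l * fps_const l"
    by (simp_all add: power2_eq_square)
  have Q: "char_fps l (l\<^sup>2) = ?D ^ 2"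
    by (simp add: char_fps_def c2 power2_eq_square algebra_simps del: fps_const_mult fps_const_add flip: fps_const_neg)
  have N: "1 + fps_const (2 * l) * fps_X = ?D + fps_const l * fps_X"
    by (simp add: c2 algebra_simps del: fps_const_add flip: fps_const_neg)
  have P: "inverse (?D ^ 2) ^ Suc r = inverse ?D ^ (2 * r + 2)"
    by (simp only: fps_inverse_power power_mult[symmetric]) simp
  have "moment_fps l (l\<^sup>2) r = fps_X ^ (2 * r) * (?D + fps_const l * fps_X) * inverse ?D ^ (2 * r + 2)"
    unfolding moment_fps_def Q N P ..
  also have "\<dots> = fps_X ^ (2 * r) * inverse ?D ^ (2 * r + 1) * (?D * inverse ?D)
      + fps_const l * (fps_X ^ (2 * r + 1) * inverse ?D ^ (2 * r + 2))"
    by (simp add: algebra_simps)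
  finally have "moment_fps l (l\<^sup>2) r = fps_X ^ (2 * r) * inverse ?D ^ (2 * r + 1)
      + fps_const l * (fps_X ^ (2 * r + 1) * inverse ?D ^ (2 * r + 2))"
    by (simp only: D mult_1_right)
  then have "frac_series \<nu> (moment_fps l (l\<^sup>2) r) t
      = frac_series \<nu> (fps_X ^ (2 * r) * inverse ?D ^ (2 * r + 1)) t
      + l * frac_series \<nu> (fps_X ^ (2 * r + 1) * inverse ?D ^ (2 * r + 2)) t"
    by (simp only: frac_series_add_cmult[OF \<nu> E E])
  also have "\<dots> = (t powr \<nu>) ^ (2 * r) * mittag_leffler3 \<nu> (real (2 * r) * \<nu> + 1) (real (2 * r + 1)) (- l * t powr \<nu>)
   + l * ((t powr \<nu>) ^ (2 * r + 1) * mittag_leffler3 \<nu> (real (2 * r + 1) * \<nu> + 1) (real (2 * r + 2)) (- l * t powr \<nu>))"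
    by (simp only: frac_series_inverse_linear_power[OF \<nu>])
  finally show ?thesis by (simp add: mult.assoc add.commute)
qed

text \<open>
  Here \<open>p1\<close> and \<open>p2\<close> are the roots of \<open>x\<^sup>2 + 2 l x + \<Lambda>\<close>, that is \<open>1 + 2 l y + \<Lambda> y\<^sup>2 = (1 - p1 y) (1 - p2 y)\<close>.
\<close>
lemma frac_series_moment_fps_two_roots:
  assumes \<nu>: "0 < \<nu>" and p: "p1 + p2 = - (2 * l)" "p1 * p2 = \<Lambda>"
  shows "frac_series \<nu> (moment_fps l \<Lambda> r) t =
     (t powr \<nu>) ^ (2 * r) * mittag_leffler_bivariate \<nu> (2 * real r * \<nu> + 1) (real r + 1) (real r + 1) (p1 * t powr \<nu>) (p2 * t powr \<nu>)
   + 2 * l * (t powr \<nu>) ^ (2 * r + 1) * mittag_leffler_bivariate \<nu> ((2 * real r + 1) * \<nu> + 1) (real r + 1) (real r + 1) (p1 * t powr \<nu>) (p2 * t powr \<nu>)"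
proof -
  let ?D = "\<lambda>c. 1 - fps_const c * fps_X :: real fps"
  have "fps_const (2 * l) = - (fps_const p1 + fps_const p2)" "fps_const \<Lambda> = fps_const p1 * fps_const p2"
    using p by (simp_all add: fps_const_neg flip: fps_const_neg fps_const_add)
  then have Q: "char_fps l \<Lambda> = ?D p1 * ?D p2"
    by (simp add: char_fps_def power2_eq_square algebra_simps del: fps_const_mult fps_const_add)
  let ?E = "inverse (?D p1) ^ Suc r * inverse (?D p2) ^ Suc r"
  have E: "fps_conv_radius (fps_X ^ s * ?E) > 0" for s
    by (intro fps_conv_radius_mult_pos fps_conv_radius_inverse_linear_power) auto
  have "moment_fps l \<Lambda> r = fps_X ^ (2 * r) * ?E + fps_const (2 * l) * (fps_X ^ (2 * r + 1) * ?E)"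
    unfolding moment_fps_def Q by (simp only: fps_inverse_mult power_mult_distrib) (simp add: algebra_simps)
  then have "frac_series \<nu> (moment_fps l \<Lambda> r) t
      = frac_series \<nu> (fps_X ^ (2 * r) * ?E) t + 2 * l * frac_series \<nu> (fps_X ^ (2 * r + 1) * ?E) t"
    by (simp only: frac_series_add_cmult[OF \<nu> E E])
  also have "\<dots> = (t powr \<nu>) ^ (2 * r) * mittag_leffler_bivariate \<nu> (real (2 * r) * \<nu> + 1) (real (Suc r)) (real (Suc r)) (p1 * t powr \<nu>) (p2 * t powr \<nu>)
   + 2 * l * ((t powr \<nu>) ^ (2 * r + 1) * mittag_leffler_bivariate \<nu> (real (2 * r + 1) * \<nu> + 1) (real (Suc r)) (real (Suc r)) (p1 * t powr \<nu>) (p2 * t powr \<nu>))"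
    by (simp only: frac_series_inverse_two_linear_powers[OF \<nu>])
  finally show ?thesis by (simp add: mult.assoc add.commute)
qed

lemma closed_form_critical_eq:
  assumes "0 < \<nu>" "\<Lambda> = (\<Sum>i=1..k. lam i)" "l = sqrt \<Lambda>" "\<Lambda> \<ge> 0"
  shows "closed_form_critical \<nu> k lam n t = frac_series \<nu> (state_fps l \<Lambda> k lam n) t"
proof -
  have "\<Lambda> = l\<^sup>2" using assms by simp
  then show ?thesis
    unfolding closed_form_critical_def Let_def assms(2)[symmetric] assms(3)[symmetric]
      frac_series_state_fps[OF assms(1)] jump_weight_def sum_distrib_right
    by (simp only: frac_series_moment_fps_critical[OF assms(1)])
qed

lemma closed_form_supercritical_eq:
  assumes "0 < \<nu>" "\<Lambda> = (\<Sum>i=1..k. lam i)" "l > sqrt \<Lambda>" "\<Lambda> \<ge> 0"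
  shows "closed_form_supercritical \<nu> l k lam n t = frac_series \<nu> (state_fps l \<Lambda> k lam n) t"
proof -
  have "\<Lambda> \<le> l\<^sup>2" using assms by (meson less_imp_le real_sqrt_le_iff sqrt_le_D)
  then have "(- l + sqrt (l\<^sup>2 - \<Lambda>)) * (- l - sqrt (l\<^sup>2 - \<Lambda>)) = \<Lambda>"
    by (simp add: algebra_simps flip: power2_eq_square)
  then show ?thesis
    unfolding closed_form_supercritical_def Let_def assms(2)[symmetric]
      frac_series_state_fps[OF assms(1)] jump_weight_def sum_distrib_right
    by (subst frac_series_moment_fps_two_roots[OF assms(1), of "- l + sqrt (l\<^sup>2 - \<Lambda>)" "- l - sqrt (l\<^sup>2 - \<Lambda>)"])
      (auto simp: mult.assoc)
qed

section \<open>The law of the generalized counting process\<close>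

text \<open>
  The compound Poisson probability of the total \<open>n\<close>: a Poisson number of jumps with mean \<open>\<Lambda> x\<close>, of
  height \<open>j\<close> with probability \<open>lam j / \<Lambda>\<close> each, where \<open>\<Lambda>\<close> is the sum of the \<open>lam j\<close>.
\<close>
definition count_prob :: "real \<Rightarrow> nat \<Rightarrow> (nat \<Rightarrow> real) \<Rightarrow> nat \<Rightarrow> real \<Rightarrow> real" where
  "count_prob \<Lambda> k lam n x = exp (- \<Lambda> * x) * (\<Sum>r=0..n. jump_weight k lam r n * x ^ r / fact r)"

lemma count_prob_0: "count_prob \<Lambda> k lam n 0 = (if n = 0 then 1 else 0)"
proof -
  have "(\<Sum>r=0..n. jump_weight k lam r n * 0 ^ r / fact r) = (\<Sum>r\<in>{0}. jump_weight k lam r n * 0 ^ r / fact r)"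
    by (intro sum.mono_neutral_right) auto
  then show ?thesis by (simp add: count_prob_def jump_weight_0)
qed

lemma count_prob_has_derivative:
  "(count_prob \<Lambda> k lam n has_real_derivative
     - \<Lambda> * count_prob \<Lambda> k lam n x + (\<Sum>j=1..min n k. lam j * count_prob \<Lambda> k lam (n - j) x)) (at x within S)"
proof -
  define p where "p n x = (\<Sum>r=0..n. jump_weight k lam r n * x ^ r / fact r)" for n x
  have ext: "p m x = (\<Sum>r=0..n. jump_weight k lam r m * x ^ r / fact r)" if "m \<le> n" for m n x
    unfolding p_def using that by (intro sum.mono_neutral_left) (auto simp: jump_weight_eq_0)
  have dp: "(p n has_real_derivative (\<Sum>j=1..min n k. lam j * p (n - j) x)) (at x within S)"
  proof (cases n)
    case 0
    then show ?thesis by (simp add: p_def[abs_def] jump_weight_0)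
  next
    case (Suc n')
    have "(p n has_real_derivative (\<Sum>r=0..n. jump_weight k lam r n * (real r * x ^ (r - 1)) / fact r)) (at x within S)"
      unfolding p_def by (auto intro!: derivative_eq_intros simp: mult_ac)
    also have "(\<Sum>r=0..n. jump_weight k lam r n * (real r * x ^ (r - 1)) / fact r)
        = (\<Sum>r=0..n'. jump_weight k lam (Suc r) n * x ^ r / fact r)"
      unfolding Suc by (subst sum.atLeast0_atMost_Suc_shift) (simp add: divide_simps del: of_nat_Suc)
    also have "\<dots> = (\<Sum>r=0..n'. \<Sum>j=1..min n k. lam j * (jump_weight k lam r (n - j) * x ^ r / fact r))"
      by (simp add: jump_weight_Suc sum_distrib_right sum_divide_distrib mult.assoc)
    also have "\<dots> = (\<Sum>j=1..min n k. lam j * p (n - j) x)"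
    proof (subst sum.swap, intro sum.cong refl)
      fix j assume "j \<in> {1..min n k}"
      then have "n - j \<le> n'" using Suc by auto
      then show "(\<Sum>r=0..n'. lam j * (jump_weight k lam r (n - j) * x ^ r / fact r)) = lam j * p (n - j) x"
        by (simp add: ext[of "n - j" n'] sum_distrib_left)
    qed
    finally show ?thesis .
  qed
  have e: "((\<lambda>x. exp (- \<Lambda> * x)) has_real_derivative - \<Lambda> * exp (- \<Lambda> * x)) (at x within S)"
    by (auto intro!: derivative_eq_intros)
  have "((\<lambda>x. exp (- \<Lambda> * x) * p n x) has_real_derivative
      - \<Lambda> * (exp (- \<Lambda> * x) * p n x) + (\<Sum>j=1..min n k. lam j * (exp (- \<Lambda> * x) * p (n - j) x))) (at x within S)"
    by (rule DERIV_cong[OF DERIV_mult[OF e dp]]) (simp add: sum_distrib_right sum_distrib_left mult_ac)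
  then show ?thesis by (simp add: count_prob_def[abs_def] p_def)
qed

locale counting_process = prob_space M for M :: "'a measure" +
  fixes k :: nat and lam :: "nat \<Rightarrow> real" and N :: "real \<Rightarrow> 'a \<Rightarrow> nat"
  assumes gcp: "generalized_counting_process M k lam N"
begin

definition q :: "nat \<Rightarrow> real \<Rightarrow> real" where
  "q n x = prob {\<omega> \<in> space M. N x \<omega> = n}"

lemma N_measurable [measurable]: "t \<ge> 0 \<Longrightarrow> N t \<in> measurable M (count_space UNIV)"
  using gcp by (simp add: generalized_counting_process_def)

lemma N_mono: "\<omega> \<in> space M \<Longrightarrow> 0 \<le> s \<Longrightarrow> s \<le> t \<Longrightarrow> N s \<omega> \<le> N t \<omega>"
  using gcp by (auto simp: generalized_counting_process_def mono_on_def)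

lemma N_0: "AE \<omega> in M. N 0 \<omega> = 0"
  using gcp by (simp add: generalized_counting_process_def)

lemma q_nonneg: "0 \<le> q n x" and q_le_1: "q n x \<le> 1"
  by (simp_all add: q_def)

lemma q_0: "q n 0 = (if n = 0 then 1 else 0)"
proof -
  have "q n 0 = prob {\<omega> \<in> space M. 0 = n}"
    unfolding q_def using N_0 by (intro finite_measure_eq_AE) auto
  then show ?thesis by (auto simp: prob_space)
qed

text \<open>
  The increments over \<open>[0,x]\<close> and \<open>[x,x+h]\<close> are independent, and the second is distributed as \<open>N h\<close>.
\<close>
lemma prob_two_increments:
  assumes x: "0 \<le> x" and h: "0 \<le> h"
  shows "prob {\<omega> \<in> space M. N x \<omega> = m \<and> N (x + h) \<omega> = m + j} = q m x * q j h"
proof -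
  define \<tau> where "\<tau> i = (if i = 0 then 0 else if i = Suc 0 then x else x + h)" for i :: nat
  define X where "X i \<omega> = real (N (\<tau> (Suc i)) \<omega>) - real (N (\<tau> i) \<omega>)" for i \<omega>
  have X01: "X 0 \<omega> = real (N x \<omega>) - real (N 0 \<omega>)" "X (Suc 0) \<omega> = real (N (x + h) \<omega>) - real (N x \<omega>)" for \<omega>
    by (simp_all add: X_def \<tau>_def)
  have [measurable]: "N 0 \<in> measurable M (count_space UNIV)" "N x \<in> measurable M (count_space UNIV)"
    "N (x + h) \<in> measurable M (count_space UNIV)"
    using x h by (auto intro!: N_measurable)
  have [measurable]: "X 0 \<in> borel_measurable M" "X (Suc 0) \<in> borel_measurable M"
    unfolding X01[abs_def] by measurable
  have "0 \<le> \<tau> 0 \<and> (\<forall>i<2. \<tau> i \<le> \<tau> (Suc i))"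
    using x h by (auto simp: \<tau>_def)
  then have "indep_vars (\<lambda>_. borel) X {..<2::nat}"
    using gcp unfolding generalized_counting_process_def independent_increments_def X_def[abs_def]
    by blast
  then have prod: "prob (\<Inter>i\<in>{..<2}. X i -` (if i = 0 then {real m} else {real j}) \<inter> space M)
      = (\<Prod>i\<in>{..<2::nat}. prob (X i -` (if i = 0 then {real m} else {real j}) \<inter> space M))"
  proof (rule indep_varsD_finite)
    have "(0::nat) \<in> {..<2}" by simp
    then show "{..<2::nat} \<noteq> {}" by blast
  qed auto
  have ind: "prob (X 0 -` {real m} \<inter> X (Suc 0) -` {real j} \<inter> space M)
     = prob (X 0 -` {real m} \<inter> space M) * prob (X (Suc 0) -` {real j} \<inter> space M)"
  proof -
    have "(\<Inter>i\<in>{..<2::nat}. X i -` (if i = 0 then {real m} else {real j}) \<inter> space M)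
        = X 0 -` {real m} \<inter> X (Suc 0) -` {real j} \<inter> space M"
      by (auto simp: lessThan_Suc numeral_2_eq_2)
    moreover note prod
    ultimately show ?thesis by (simp add: lessThan_Suc numeral_2_eq_2 mult.commute)
  qed
  have 1: "prob (X 0 -` {real m} \<inter> X (Suc 0) -` {real j} \<inter> space M)
      = prob {\<omega> \<in> space M. N x \<omega> = m \<and> N (x + h) \<omega> = m + j}"
    using N_0 x h by (intro finite_measure_eq_AE) (auto simp: X01)
  have 2: "prob (X 0 -` {real m} \<inter> space M) = q m x"
    unfolding q_def using N_0 x h by (intro finite_measure_eq_AE) (auto simp: X01)
  have "distr M borel (\<lambda>\<omega>. real (N (x + h) \<omega>) - real (N x \<omega>)) = distr M borel (\<lambda>\<omega>. real (N h \<omega>) - real (N 0 \<omega>))"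
    using gcp x h by (auto simp: generalized_counting_process_def stationary_increments_def)
  then have "measure (distr M borel (\<lambda>\<omega>. real (N (x + h) \<omega>) - real (N x \<omega>))) {real j}
    = measure (distr M borel (\<lambda>\<omega>. real (N h \<omega>) - real (N 0 \<omega>))) {real j}" by simp
  then have "prob ((\<lambda>\<omega>. real (N (x + h) \<omega>) - real (N x \<omega>)) -` {real j} \<inter> space M)
    = prob ((\<lambda>\<omega>. real (N h \<omega>) - real (N 0 \<omega>)) -` {real j} \<inter> space M)"
    using x h by (simp add: measure_distr)
  moreover have "prob ((\<lambda>\<omega>. real (N h \<omega>) - real (N 0 \<omega>)) -` {real j} \<inter> space M) = q j h"
    unfolding q_def using N_0 x h by (intro finite_measure_eq_AE) auto
  ultimately have 3: "prob (X (Suc 0) -` {real j} \<inter> space M) = q j h"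
    unfolding X01[abs_def] by simp
  show ?thesis using ind 1 2 3 by simp
qed

lemma q_add:
  assumes x: "0 \<le> x" and h: "0 \<le> h"
  shows "q n (x + h) = (\<Sum>j\<le>n. q (n - j) x * q j h)"
proof -
  let ?E = "\<lambda>j. {\<omega> \<in> space M. N x \<omega> = n - j \<and> N (x + h) \<omega> = (n - j) + j}"
  have "{\<omega> \<in> space M. N (x + h) \<omega> = n} = (\<Union>j\<in>{..n}. ?E j)"
  proof (intro equalityI subsetI)
    fix \<omega> assume \<omega>: "\<omega> \<in> {\<omega> \<in> space M. N (x + h) \<omega> = n}"
    then have "N x \<omega> \<le> n" using N_mono[of \<omega> x "x + h"] x h by auto
    then show "\<omega> \<in> (\<Union>j\<in>{..n}. ?E j)" using \<omega> by (intro UN_I[of "n - N x \<omega>"]) auto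
  qed auto
  moreover have "prob (\<Union>j\<in>{..n}. ?E j) = (\<Sum>j\<le>n. prob (?E j))"
    using x h by (intro finite_measure_finite_Union) (auto simp: disjoint_family_on_def)
  ultimately have "q n (x + h) = (\<Sum>j\<le>n. prob (?E j))"
    by (simp only: q_def)
  then show ?thesis by (simp only: prob_two_increments[OF x h])
qed

definition total_rate :: real where "total_rate = (\<Sum>i=1..k. lam i)"

text \<open>
  \<open>rate j\<close> is the first-order coefficient of \<open>q j h\<close> at \<open>h = 0\<close> and \<open>err j h\<close> the remainder;
  \<open>drift\<close> below is the right-hand side of the forward equations.
\<close>
definition rate :: "nat \<Rightarrow> real" where
  "rate j = (if j = 0 then - total_rate else if j \<le> k then lam j else 0)"

definition err :: "nat \<Rightarrow> real \<Rightarrow> real" where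
  "err j h = q j h - (if j = 0 then 1 else 0) - rate j * h"

text \<open>
  For \<open>1 \<le> j \<le> k\<close> this is part of the definition of the process; states beyond \<open>k\<close> are dominated by
  \<open>P(N h > k)\<close>; for \<open>j = 0\<close> it follows because the probabilities add up to one.
\<close>
lemma err_small: "((\<lambda>h. err j h / h) \<longlongrightarrow> 0) (at_right 0)"
proof -
  have tail: "((\<lambda>h. prob {\<omega> \<in> space M. N h \<omega> > k} / h) \<longlongrightarrow> 0) (at_right 0)"
    using gcp by (intro smalloD_tendsto) (simp add: generalized_counting_process_def)
  have pos: "((\<lambda>h. err j h / h) \<longlongrightarrow> 0) (at_right 0)" if j: "j \<in> {1..k}" for j
  proof -
    have "((\<lambda>h. (prob {\<omega> \<in> space M. N h \<omega> = j} - lam j * h) / h) \<longlongrightarrow> 0) (at_right 0)"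
      using gcp j by (intro smalloD_tendsto) (auto simp: generalized_counting_process_def)
    then show ?thesis using j by (simp add: err_def rate_def q_def)
  qed
  consider "j = 0" | "j \<in> {1..k}" | "j > k" by force
  then show ?thesis
  proof cases
    case 1
    have split: "q 0 h = 1 - (\<Sum>i=1..k. q i h) - prob {\<omega> \<in> space M. N h \<omega> > k}" if h: "h \<ge> 0" for h
    proof -
      have cover: "(\<Union>i\<in>{..k}. {\<omega> \<in> space M. N h \<omega> = i}) \<union> {\<omega> \<in> space M. N h \<omega> > k} = space M"
        by auto
      have "1 = prob ((\<Union>i\<in>{..k}. {\<omega> \<in> space M. N h \<omega> = i}) \<union> {\<omega> \<in> space M. N h \<omega> > k})"
        unfolding cover by (rule prob_space[symmetric])
      also have "\<dots> = prob (\<Union>i\<in>{..k}. {\<omega> \<in> space M. N h \<omega> = i}) + prob {\<omega> \<in> space M. N h \<omega> > k}"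
        using h by (intro finite_measure_Union) auto
      also have "prob (\<Union>i\<in>{..k}. {\<omega> \<in> space M. N h \<omega> = i}) = (\<Sum>i\<le>k. q i h)"
        unfolding q_def using h by (intro finite_measure_finite_Union) (auto simp: disjoint_family_on_def)
      also have "\<dots> = q 0 h + (\<Sum>i=1..k. q i h)"
        by (subst atMost_atLeast0, subst sum.atLeast_Suc_atMost) simp_all
      finally show ?thesis by simp
    qed
    have "((\<lambda>h. - (\<Sum>i=1..k. err i h / h) - prob {\<omega> \<in> space M. N h \<omega> > k} / h) \<longlongrightarrow> - (\<Sum>i=1..k. 0) - 0) (at_right 0)"
      by (intro tendsto_intros pos tail)
    moreover have "\<forall>\<^sub>F h in at_right 0. - (\<Sum>i=1..k. err i h / h) - prob {\<omega> \<in> space M. N h \<omega> > k} / h = err 0 h / h"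
      using eventually_at_right_less[of 0]
    proof eventually_elim
      case (elim h)
      have "(\<Sum>i=1..k. err i h) = (\<Sum>i=1..k. q i h) - total_rate * h"
        by (simp add: err_def rate_def total_rate_def sum_subtractf sum_distrib_right)
      then have "- (\<Sum>i=1..k. err i h) - prob {\<omega> \<in> space M. N h \<omega> > k} = err 0 h"
        using split[of h] elim by (simp add: err_def rate_def)
      then show ?case
        by (simp only: sum_divide_distrib[symmetric] minus_divide_left diff_divide_distrib[symmetric])
    qed
    ultimately show ?thesis using 1 by (simp add: tendsto_cong)
  next
    case 2
    then show ?thesis by (rule pos)
  next
    case 3
    show ?thesis
    proof (rule Lim_null_comparison[OF _ tail])
      show "\<forall>\<^sub>F h in at_right 0. norm (err j h / h) \<le> prob {\<omega> \<in> space M. N h \<omega> > k} / h"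
        using eventually_at_right_less[of 0]
      proof eventually_elim
        case (elim h)
        have "q j h \<le> prob {\<omega> \<in> space M. N h \<omega> > k}"
          unfolding q_def using 3 elim by (intro finite_measure_mono) auto
        then show ?case using 3 elim q_nonneg[of j h] by (simp add: err_def rate_def divide_right_mono)
      qed
    qed
  qed
qed

definition drift :: "nat \<Rightarrow> real \<Rightarrow> real" where
  "drift n x = (\<Sum>j\<le>n. rate j * q (n - j) x)"

definition err_sum :: "nat \<Rightarrow> real \<Rightarrow> real" where
  "err_sum n h = (\<Sum>j\<le>n. \<bar>err j h\<bar>)"

lemma err_sum_small: "((\<lambda>h. err_sum n h / h) \<longlongrightarrow> 0) (at_right 0)"
proof -
  have "((\<lambda>h. \<Sum>j\<le>n. \<bar>err j h / h\<bar>) \<longlongrightarrow> (\<Sum>j\<le>n. \<bar>0\<bar>)) (at_right 0)"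
    by (intro tendsto_sum tendsto_rabs err_small)
  moreover have "\<forall>\<^sub>F h in at_right 0. (\<Sum>j\<le>n. \<bar>err j h / h\<bar>) = err_sum n h / h"
    using eventually_at_right_less[of 0]
    by eventually_elim (simp add: err_sum_def sum_divide_distrib)
  ultimately show ?thesis by (simp add: tendsto_cong)
qed

text \<open>
  A bound uniform in \<open>x\<close>.  Uniformity is essential for the derivative from the left, where the
  increment is taken at the moving point \<open>x - h\<close>.
\<close>
lemma q_increment:
  assumes "0 \<le> x" "0 \<le> h"
  shows "\<bar>q n (x + h) - q n x - h * drift n x\<bar> \<le> err_sum n h"
proof -
  have "(\<Sum>j\<le>n. q (n - j) x * (if j = 0 then 1 else 0)) = (\<Sum>j\<in>{0}. q (n - j) x * (if j = 0 then 1 else 0))"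
    by (intro sum.mono_neutral_right) auto
  then have "q n (x + h) - q n x - h * drift n x = (\<Sum>j\<le>n. q (n - j) x * err j h)"
    unfolding q_add[OF assms] drift_def err_def
    by (simp add: algebra_simps sum_subtractf sum_distrib_left sum.distrib)
  also have "\<bar>\<dots>\<bar> \<le> (\<Sum>j\<le>n. \<bar>q (n - j) x * err j h\<bar>)" by (rule sum_abs)
  also have "\<dots> \<le> err_sum n h"
    unfolding err_sum_def abs_mult
    by (intro sum_mono mult_left_le_one_le) (auto simp: q_nonneg q_le_1)
  finally show ?thesis .
qed

lemma q_left_continuous:
  assumes x: "x > 0"
  shows "((\<lambda>h. q n (x - h)) \<longlongrightarrow> q n x) (at_right 0)"
proof -
  define C where "C = (\<Sum>j\<le>n. \<bar>rate j\<bar>)"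
  have C: "\<bar>drift n y\<bar> \<le> C" for y
  proof -
    have "\<bar>drift n y\<bar> \<le> (\<Sum>j\<le>n. \<bar>rate j * q (n - j) y\<bar>)" unfolding drift_def by (rule sum_abs)
    also have "\<dots> \<le> C"
      unfolding C_def abs_mult by (intro sum_mono mult_right_le_one_le) (auto simp: q_nonneg q_le_1)
    finally show ?thesis .
  qed
  have "((\<lambda>h. h * C + err_sum n h / h * h) \<longlongrightarrow> 0 * C + 0 * 0) (at_right 0)"
    by (rule tendsto_add[OF tendsto_mult[OF tendsto_ident_at tendsto_const]
          tendsto_mult[OF err_sum_small tendsto_ident_at]])
  moreover have "\<forall>\<^sub>F h in at_right 0. norm (q n (x - h) - q n x) \<le> h * C + err_sum n h / h * h"
    using eventually_at_right_less[of 0] eventually_at_right_real[OF x]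
  proof eventually_elim
    case (elim h)
    have "\<bar>h * drift n (x - h)\<bar> \<le> h * C" using elim C by (simp add: abs_mult mult_left_mono)
    moreover have "\<bar>q n x - q n (x - h) - h * drift n (x - h)\<bar> \<le> err_sum n h"
      using q_increment[of "x - h" h n] elim by simp
    ultimately have "\<bar>q n (x - h) - q n x\<bar> \<le> h * C + err_sum n h" by linarith
    then show ?case using elim by simp
  qed
  ultimately have "((\<lambda>h. q n (x - h) - q n x) \<longlongrightarrow> 0) (at_right 0)"
    by (simp add: Lim_null_comparison)
  then show ?thesis by (simp add: LIM_zero_cancel)
qed

lemma q_right_quotient:
  assumes x: "x \<ge> 0"
  shows "((\<lambda>h. (q n (x + h) - q n x) / h) \<longlongrightarrow> drift n x) (at_right 0)"
proof -
  have "\<forall>\<^sub>F h in at_right 0. norm ((q n (x + h) - q n x) / h - drift n x) \<le> err_sum n h / h"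
    using eventually_at_right_less[of 0]
  proof eventually_elim
    case (elim h)
    have "(q n (x + h) - q n x) / h - drift n x = (q n (x + h) - q n x - h * drift n x) / h"
      using elim by (simp add: field_simps)
    then show ?case using q_increment[OF x, of h n] elim by (simp add: divide_right_mono)
  qed
  from Lim_null_comparison[OF this err_sum_small] show ?thesis by (rule LIM_zero_cancel)
qed

lemma q_left_quotient:
  assumes x: "x > 0"
  shows "((\<lambda>h. (q n x - q n (x - h)) / h) \<longlongrightarrow> drift n x) (at_right 0)"
proof -
  have "\<forall>\<^sub>F h in at_right 0. norm ((q n x - q n (x - h)) / h - drift n (x - h)) \<le> err_sum n h / h"
    using eventually_at_right_less[of 0] eventually_at_right_real[OF x]
  proof eventually_elim
    case (elim h)
    have "(q n x - q n (x - h)) / h - drift n (x - h) = (q n x - q n (x - h) - h * drift n (x - h)) / h"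
      using elim by (simp add: field_simps)
    then show ?case using q_increment[of "x - h" h n] elim by (simp add: divide_right_mono)
  qed
  from Lim_null_comparison[OF this err_sum_small]
  have "((\<lambda>h. (q n x - q n (x - h)) / h - drift n (x - h)) \<longlongrightarrow> 0) (at_right 0)" .
  moreover have "((\<lambda>h. drift n (x - h)) \<longlongrightarrow> drift n x) (at_right 0)"
    unfolding drift_def by (intro tendsto_intros q_left_continuous x)
  ultimately have "((\<lambda>h. ((q n x - q n (x - h)) / h - drift n (x - h)) + drift n (x - h)) \<longlongrightarrow> 0 + drift n x) (at_right 0)"
    by (rule tendsto_add)
  then show ?thesis by simp
qed

lemma q_has_derivative:
  assumes x: "x \<ge> 0"
  shows "(q n has_real_derivative drift n x) (at x within {0..})"
proof -
  have R: "((\<lambda>y. (q n y - q n x) / (y - x)) \<longlongrightarrow> drift n x) (at_right x)"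
    using q_right_quotient[OF x, of n] by (subst filterlim_at_right_to_0) (simp add: add.commute)
  show ?thesis
  proof (cases "x = 0")
    case True
    then show ?thesis using R by (simp add: has_field_derivative_iff at_within_Ici_at_right)
  next
    case False
    then have x: "x > 0" using x by simp
    have "((\<lambda>y. (q n y - q n x) / (y - x)) \<longlongrightarrow> drift n x) (at_left x)"
    proof (subst filterlim_at_left_to_right, subst filterlim_at_right_to_0)
      have "(q n (- (h + - x)) - q n x) / (- (h + - x) - x) = (q n x - q n (x - h)) / h" for h
        by (simp add: divide_simps)
      then show "((\<lambda>h. (q n (- (h + - x)) - q n x) / (- (h + - x) - x)) \<longlongrightarrow> drift n x) (at_right 0)"
        using q_left_quotient[OF x, of n] by simp
    qed
    then have "(q n has_real_derivative drift n x) (at x)"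
      unfolding has_field_derivative_iff using R by (rule filterlim_split_at)
    then show ?thesis by (rule has_field_derivative_at_within)
  qed
qed

text \<open>
  Both sides solve the forward equations with the same initial values.  These are triangular in \<open>n\<close>,
  so by induction the difference in state \<open>n\<close> satisfies \<open>d' = - \<Lambda> d\<close>, and \<open>d exp (\<Lambda> x)\<close> is constant.
\<close>

theorem q_eq_count_prob:
  assumes "x \<ge> 0"
  shows "q n x = count_prob total_rate k lam n x"
  using assms
proof (induction n arbitrary: x rule: less_induct)
  case (less n)
  let ?w = "count_prob total_rate k lam"
  define v where "v x = (q n x - ?w n x) * exp (total_rate * x)" for x
  have "(v has_real_derivative 0) (at y within {0..})" if y: "y \<in> {0..}" for y
  proof -
    have "drift n y = rate 0 * q n y + (\<Sum>j=1..n. rate j * q (n - j) y)"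
      unfolding drift_def by (subst atMost_atLeast0, subst sum.atLeast_Suc_atMost) simp_all
    also have "(\<Sum>j=1..n. rate j * q (n - j) y) = (\<Sum>j=1..min n k. lam j * ?w (n - j) y)"
    proof (intro sum.mono_neutral_cong_right ballI)
      fix j assume "j \<in> {1..min n k}"
      then show "rate j * q (n - j) y = lam j * ?w (n - j) y"
        using less.IH[of "n - j" y] y by (auto simp: rate_def)
    qed (auto simp: rate_def)
    finally have d: "drift n y = - total_rate * q n y + (\<Sum>j=1..min n k. lam j * ?w (n - j) y)"
      by (simp add: rate_def)
    have e: "((\<lambda>x. exp (total_rate * x)) has_real_derivative total_rate * exp (total_rate * y)) (at y within {0..})"
      by (auto intro!: derivative_eq_intros)
    have "((\<lambda>x. q n x - ?w n x) has_real_derivative - total_rate * (q n y - ?w n y)) (at y within {0..})"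
      using y by (intro DERIV_cong[OF DERIV_diff[OF q_has_derivative count_prob_has_derivative]])
        (auto simp: d algebra_simps)
    from DERIV_mult[OF this e] show ?thesis
      unfolding v_def by (rule DERIV_cong) simp
  qed
  then have "\<exists>c. \<forall>y\<in>{0..}. v y = c"
    by (intro has_field_derivative_zero_constant) auto
  then have "v x = v 0" using less.prems by auto
  then show ?case by (simp add: v_def q_0 count_prob_0)
qed

end

section \<open>First passage times of subordinators\<close>

text \<open>
  An abstraction of the mixture \<open>H1 + (2 l)\<^bsup>1/\<nu>\<^esup> H2\<close>: \<open>D\<close> has the paths and the one-dimensional Laplace
  transforms of a subordinator with Laplace exponent \<open>\<phi>\<close>.
\<close>
locale first_passage = prob_space M for M :: "'a measure" +
  fixes D :: "real \<Rightarrow> 'a \<Rightarrow> real" and \<phi> :: "real \<Rightarrow> real"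
  assumes D_measurable [measurable]: "\<And>s. s \<ge> 0 \<Longrightarrow> D s \<in> borel_measurable M"
    and D_mono: "\<And>\<omega> s t. \<omega> \<in> space M \<Longrightarrow> 0 \<le> s \<Longrightarrow> s \<le> t \<Longrightarrow> D s \<omega> \<le> D t \<omega>"
    and D_right_continuous: "\<And>\<omega> s. \<omega> \<in> space M \<Longrightarrow> 0 \<le> s \<Longrightarrow> continuous (at_right s) (\<lambda>s. D s \<omega>)"
    and D_0: "AE \<omega> in M. D 0 \<omega> = 0"
    and D_laplace: "\<And>s u. s \<ge> 0 \<Longrightarrow> u > 0 \<Longrightarrow> (\<integral>\<omega>. exp (- u * D s \<omega>) \<partial>M) = exp (- s * \<phi> u)"
    and \<phi>_pos: "\<And>u. u > 0 \<Longrightarrow> \<phi> u > 0"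
begin

definition passage :: "real \<Rightarrow> 'a \<Rightarrow> real" where
  "passage t \<omega> = (let S = {s. s > 0 \<and> D s \<omega> \<ge> t} in if S = {} then 0 else Inf S)"

lemma passage_nonneg: "passage t \<omega> \<ge> 0"
  unfolding passage_def Let_def by (auto intro!: cInf_greatest)

text \<open>
  Right-continuity of \<open>D\<close> gives the equivalence with a strict inequality on both sides.  It holds at
  every sample point, also where the path stays below \<open>t\<close> and the passage time is \<open>0\<close> by
  convention, so it expresses \<open>passage\<close> by countably many events and gives joint measurability.
\<close>
lemma passage_gt_iff:
  assumes \<omega>: "\<omega> \<in> space M" and x: "x \<ge> 0"
  shows "x < passage t \<omega> \<longleftrightarrow> D x \<omega> < t \<and> (\<exists>q::nat. 1 \<le> q \<and> t \<le> D (real q) \<omega>)"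
proof -
  define S where "S = {s. s > 0 \<and> D s \<omega> \<ge> t}"
  have bdd: "bdd_below S" by (auto simp: S_def bdd_below_def intro!: exI[of _ 0])
  have S: "S \<noteq> {} \<longleftrightarrow> (\<exists>q::nat. 1 \<le> q \<and> t \<le> D (real q) \<omega>)"
  proof
    assume "S \<noteq> {}"
    then obtain s where s: "s > 0" "D s \<omega> \<ge> t" by (auto simp: S_def)
    obtain q :: nat where "s < real q" using reals_Archimedean2 by blast
    then have "1 \<le> q" "t \<le> D (real q) \<omega>"
      using s D_mono[OF \<omega>, of s "real q"] by auto
    then show "\<exists>q::nat. 1 \<le> q \<and> t \<le> D (real q) \<omega>" by blast
  next
    assume "\<exists>q::nat. 1 \<le> q \<and> t \<le> D (real q) \<omega>"
    then obtain q :: nat where "1 \<le> q" "t \<le> D (real q) \<omega>" by blast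
    then have "real q \<in> S" by (simp add: S_def)
    then show "S \<noteq> {}" by blast
  qed
  show ?thesis
  proof (cases "S = {}")
    case True
    then show ?thesis using S x by (auto simp: passage_def S_def[symmetric])
  next
    case False
    have "x < Inf S \<longleftrightarrow> D x \<omega> < t"
    proof
      assume l: "x < Inf S"
      show "D x \<omega> < t"
      proof (rule ccontr)
        assume c: "\<not> D x \<omega> < t"
        define y where "y = (x + Inf S) / 2"
        have y: "x < y" "y < Inf S" using l by (auto simp: y_def)
        then have "y \<in> S" using c x D_mono[OF \<omega>, of x y] by (auto simp: S_def)
        then show False using cInf_lower[OF _ bdd] y by force
      qed
    next
      assume "D x \<omega> < t"
      then have "\<forall>\<^sub>F s in at_right x. D s \<omega> < t"
        using order_tendstoD(2)[OF D_right_continuous[OF \<omega> x, unfolded continuous_within]] by blast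
      then obtain b where b: "b > x" "\<And>s. x < s \<Longrightarrow> s < b \<Longrightarrow> D s \<omega> < t"
        unfolding eventually_at_right_field by blast
      have "b \<le> s" if "s \<in> S" for s
      proof (rule ccontr)
        assume "\<not> b \<le> s"
        define y where "y = (max x s + b) / 2"
        have y: "x < y" "y < b" "s \<le> y" using b \<open>\<not> b \<le> s\<close> by (auto simp: y_def)
        then have "D s \<omega> \<le> D y \<omega>" using that D_mono[OF \<omega>, of s y] by (auto simp: S_def)
        then show False using b(2)[of y] y that by (auto simp: S_def)
      qed
      then have "b \<le> Inf S" using False by (intro cInf_greatest) auto
      then show "x < Inf S" using b by simp
    qed
    then show ?thesis using S False by (auto simp: passage_def S_def[symmetric])
  qed
qed

lemma passage_measurable_pair:
  "(\<lambda>(t, \<omega>). passage t \<omega>) \<in> borel_measurable (borel \<Otimes>\<^sub>M M)"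
proof (subst borel_measurable_iff_greater, intro allI)
  fix a :: real
  show "{w \<in> space (borel \<Otimes>\<^sub>M M). a < (case w of (t, \<omega>) \<Rightarrow> passage t \<omega>)} \<in> sets (borel \<Otimes>\<^sub>M M)"
  proof (cases "a < 0")
    case True
    then have "a < passage t \<omega>" for t \<omega>
      using passage_nonneg[of t \<omega>] by linarith
    then have "{w \<in> space (borel \<Otimes>\<^sub>M M). a < (case w of (t, \<omega>) \<Rightarrow> passage t \<omega>)} = space (borel \<Otimes>\<^sub>M M)"
      by auto
    then show ?thesis by simp
  next
    case False
    then have a[measurable]: "D a \<in> borel_measurable M" by simp
    have q[measurable]: "D (real q) \<in> borel_measurable M" for q by simp
    have "{w \<in> space (borel \<Otimes>\<^sub>M M). a < (case w of (t, \<omega>) \<Rightarrow> passage t \<omega>)}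
      = {w \<in> space (borel \<Otimes>\<^sub>M M). D a (snd w) < fst w \<and> (\<exists>q::nat. 1 \<le> q \<and> fst w \<le> D (real q) (snd w))}"
      using False passage_gt_iff[of _ a] by (auto simp: space_pair_measure)
    also have "\<dots> \<in> sets (borel \<Otimes>\<^sub>M M)" by measurable
    finally show ?thesis .
  qed
qed

lemma passage_measurable [measurable]: "passage t \<in> borel_measurable M"
  using measurable_Pair2[OF passage_measurable_pair, of t] by simp

lemma integrable_exp_D:
  assumes "s \<ge> 0" "u > 0"
  shows "integrable M (\<lambda>\<omega>. exp (- u * D s \<omega>))"
  using D_laplace[OF assms] not_integrable_integral_eq by fastforce

text \<open>
  Markov's inequality: \<open>P(D q < m) \<le> exp m E exp (- D q) = exp (m - q \<phi>(1))\<close>, which tends to \<open>0\<close>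
  as \<open>q\<close> grows.
\<close>
lemma AE_D_unbounded: "AE \<omega> in M. \<forall>t. \<exists>q::nat. 1 \<le> q \<and> t \<le> D (real q) \<omega>"
proof -
  have q[measurable]: "D (real q) \<in> borel_measurable M" for q by simp
  have "AE \<omega> in M. \<exists>q::nat. 1 \<le> q \<and> real m \<le> D (real q) \<omega>" for m :: nat
  proof -
    define A where "A = {\<omega> \<in> space M. \<forall>q::nat. 1 \<le> q \<longrightarrow> D (real q) \<omega> < real m}"
    have A[measurable]: "A \<in> sets M" unfolding A_def by measurable
    have bound: "prob A \<le> exp (real m) * exp (- \<phi> 1) ^ q" if q: "1 \<le> q" for q :: nat
    proof -
      have "prob A = (\<integral>\<omega>. indicator A \<omega> \<partial>M)" by simp
      also have "\<dots> \<le> (\<integral>\<omega>. exp (real m) * exp (- 1 * D (real q) \<omega>) \<partial>M)"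
      proof (intro integral_mono)
        show "integrable M (indicator A :: 'a \<Rightarrow> real)"
          by (rule integrable_real_indicator[OF A]) (simp add: emeasure_eq_measure)
        show "integrable M (\<lambda>\<omega>. exp (real m) * exp (- 1 * D (real q) \<omega>))"
          by (intro integrable_mult_right integrable_exp_D) auto
        fix \<omega> assume "\<omega> \<in> space M"
        show "indicator A \<omega> \<le> exp (real m) * exp (- 1 * D (real q) \<omega>)"
          using q by (auto simp: A_def indicator_def exp_add[symmetric] less_imp_le)
      qed
      also have "\<dots> = exp (real m) * exp (- real q * \<phi> 1)"
        using D_laplace[of "real q" 1] by simp
      also have "exp (- real q * \<phi> 1) = exp (- \<phi> 1) ^ q"
        by (simp add: exp_of_nat_mult[symmetric])
      finally show ?thesis .
    qed
    have "(\<lambda>q. exp (real m) * exp (- \<phi> 1) ^ q) \<longlonglongrightarrow> exp (real m) * 0"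
      using \<phi>_pos[of 1] by (intro tendsto_mult_left LIMSEQ_power_zero) auto
    then have "prob A \<le> exp (real m) * 0"
      by (rule LIMSEQ_le_const) (use bound in blast)
    then have "prob A \<le> 0" by simp
    then have "emeasure M A = 0" by (simp add: emeasure_eq_measure antisym)
    then have "A \<in> null_sets M" using A by (rule null_setsI)
    then have "AE \<omega> in M. \<omega> \<notin> A" by (rule AE_not_in)
    then show ?thesis using AE_space by eventually_elim (auto simp: A_def not_less)
  qed
  then have "AE \<omega> in M. \<forall>m::nat. \<exists>q::nat. 1 \<le> q \<and> real m \<le> D (real q) \<omega>"
    by (simp add: AE_all_countable)
  then show ?thesis
  proof eventually_elim
    case (elim \<omega>)
    show ?case
    proof
      fix t :: real
      obtain m :: nat where "t < real m" using reals_Archimedean2 by blast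
      with elim show "\<exists>q::nat. 1 \<le> q \<and> t \<le> D (real q) \<omega>" by (meson less_imp_le order_trans)
    qed
  qed
qed

lemma AE_passage_gt_iff: "AE \<omega> in M. \<forall>t x. 0 \<le> x \<longrightarrow> (x < passage t \<omega> \<longleftrightarrow> D x \<omega> < t)"
  using AE_D_unbounded AE_space by eventually_elim (simp add: passage_gt_iff)

lemma AE_passage_0: "AE \<omega> in M. passage 0 \<omega> = 0"
  using AE_passage_gt_iff D_0
proof eventually_elim
  case (elim \<omega>)
  then have "\<not> 0 < passage 0 \<omega>" by auto
  then show ?case using passage_nonneg[of 0 \<omega>] by simp
qed

text \<open>
  On the product with an exponential time \<open>t\<close> of rate \<open>u\<close>, the passage time exceeds \<open>a\<close> iff \<open>D a < t\<close>.
  For fixed \<open>\<omega>\<close> this has probability \<open>exp (- u D a \<omega>)\<close>; integrating over \<open>\<omega>\<close> gives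
  \<open>exp (- a \<phi>(u))\<close>.
\<close>
lemma distributed_passage_exponential_time:
  assumes u: "u > 0"
  shows "distributed (density lborel (exponential_density u) \<Otimes>\<^sub>M M) lborel
    (\<lambda>(t, \<omega>). passage t \<omega>) (exponential_density (\<phi> u))"
proof -
  let ?E = "density lborel (exponential_density u)"
  interpret E: prob_space ?E by (rule prob_space_exponential_density[OF u])
  interpret P: pair_prob_space ?E M ..
  have "distributed ?E lborel (\<lambda>x. x) (exponential_density u)"
    unfolding distributed_def using u by (simp add: distr_id2)
  note E_gt = E.exponential_distributedD_gt[OF this _ u]
  have sets_P: "sets (?E \<Otimes>\<^sub>M M) = sets (borel \<Otimes>\<^sub>M M)"
    by (intro sets_pair_measure_cong) auto
  have meas[measurable]: "(\<lambda>(t, \<omega>). passage t \<omega>) \<in> borel_measurable (?E \<Otimes>\<^sub>M M)"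
    using passage_measurable_pair measurable_cong_sets[OF sets_P refl] by blast
  have gt: "P.prob {w \<in> space (?E \<Otimes>\<^sub>M M). a < (case w of (t, \<omega>) \<Rightarrow> passage t \<omega>)} = exp (- a * \<phi> u)"
    if a: "a \<ge> 0" for a
  proof -
    let ?A = "{w \<in> space (?E \<Otimes>\<^sub>M M). a < (case w of (t, \<omega>) \<Rightarrow> passage t \<omega>)}"
    have A: "?A \<in> sets (?E \<Otimes>\<^sub>M M)" by measurable
    have Da[measurable]: "D a \<in> borel_measurable M" using a by simp
    have "emeasure (?E \<Otimes>\<^sub>M M) ?A = (\<integral>\<^sup>+\<omega>. emeasure ?E ((\<lambda>t. (t, \<omega>)) -` ?A) \<partial>M)"
      by (rule P.emeasure_pair_measure_alt2[OF A])
    also have "\<dots> = (\<integral>\<^sup>+\<omega>. ennreal (exp (- u * D a \<omega>)) \<partial>M)"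
    proof (rule nn_integral_cong_AE)
      show "AE \<omega> in M. emeasure ?E ((\<lambda>t. (t, \<omega>)) -` ?A) = ennreal (exp (- u * D a \<omega>))"
        using AE_passage_gt_iff D_0 AE_space
      proof eventually_elim
        case (elim \<omega>)
        have "(\<lambda>t. (t, \<omega>)) -` ?A = {t \<in> space ?E. D a \<omega> < t}"
          using elim a by (auto simp: space_pair_measure)
        moreover have "0 \<le> D a \<omega>" using elim D_mono[of \<omega> 0 a] a by simp
        ultimately show ?case
          using E_gt[of "D a \<omega>"] by (simp add: E.emeasure_eq_measure mult.commute)
      qed
    qed
    also have "\<dots> = ennreal (\<integral>\<omega>. exp (- u * D a \<omega>) \<partial>M)"
      by (rule nn_integral_eq_integral[OF integrable_exp_D[OF a u]]) auto
    finally show ?thesis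
      unfolding D_laplace[OF a u] P.emeasure_eq_measure by simp
  qed
  show ?thesis
  proof (subst P.exponential_distributed_iff[OF \<phi>_pos[OF u]], intro conjI allI impI meas)
    fix a :: real assume a: "0 \<le> a"
    let ?A = "{w \<in> space (?E \<Otimes>\<^sub>M M). a < (case w of (t, \<omega>) \<Rightarrow> passage t \<omega>)}"
    have A: "?A \<in> sets (?E \<Otimes>\<^sub>M M)" by measurable
    have "{w \<in> space (?E \<Otimes>\<^sub>M M). (case w of (t, \<omega>) \<Rightarrow> passage t \<omega>) \<le> a} = space (?E \<Otimes>\<^sub>M M) - ?A"
      by auto
    then show "P.prob {w \<in> space (?E \<Otimes>\<^sub>M M). (case w of (t, \<omega>) \<Rightarrow> passage t \<omega>) \<le> a} = 1 - exp (- a * \<phi> u)"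
      using P.prob_compl[OF A] gt[OF a] by simp
  qed
qed

text \<open>
  By Fubini's theorem the law of the passage time at an exponential time yields the Laplace transform of
  \<open>t \<mapsto> E f(passage t)\<close> for bounded \<open>f\<close>.
\<close>
lemma passage_exponential_time_expectation:
  fixes f :: "real \<Rightarrow> real"
  assumes u: "u > 0" and f[measurable]: "f \<in> borel_measurable borel" and B: "\<And>x. x \<ge> 0 \<Longrightarrow> \<bar>f x\<bar> \<le> B"
  shows "has_bochner_integral lborel (\<lambda>t. expectation (\<lambda>\<omega>. f (passage t \<omega>)) * exponential_density u t)
    (\<integral>x. exponential_density (\<phi> u) x * f x \<partial>lborel)"
proof -
  let ?E = "density lborel (exponential_density u)"
  interpret E: prob_space ?E by (rule prob_space_exponential_density[OF u])
  interpret P: pair_prob_space ?E M ..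
  note dist = distributed_passage_exponential_time[OF u]
  have meas[measurable]: "(\<lambda>(t, \<omega>). passage t \<omega>) \<in> borel_measurable (?E \<Otimes>\<^sub>M M)"
    using distributed_measurable[OF dist] by simp
  have int: "integrable (?E \<Otimes>\<^sub>M M) (\<lambda>w. f (case w of (t, \<omega>) \<Rightarrow> passage t \<omega>))"
    by (rule P.integrable_const_bound[of _ B]) (auto intro!: B passage_nonneg)
  have "(\<integral>x. exponential_density (\<phi> u) x * f x \<partial>lborel) = (\<integral>w. f (case w of (t, \<omega>) \<Rightarrow> passage t \<omega>) \<partial>(?E \<Otimes>\<^sub>M M))"
    using \<phi>_pos[OF u] by (intro distributed_integral[OF dist]) auto
  also have "\<dots> = (\<integral>t. expectation (\<lambda>\<omega>. f (passage t \<omega>)) \<partial>?E)"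
    using P.integral_fst'[OF int] by simp
  finally have eq: "(\<integral>t. expectation (\<lambda>\<omega>. f (passage t \<omega>)) \<partial>?E) = (\<integral>x. exponential_density (\<phi> u) x * f x \<partial>lborel)" ..
  have i: "integrable ?E (\<lambda>t. expectation (\<lambda>\<omega>. f (passage t \<omega>)))"
    using P.integrable_fst'[OF int] by simp
  then have m: "(\<lambda>t. expectation (\<lambda>\<omega>. f (passage t \<omega>))) \<in> borel_measurable lborel"
    by (auto dest: borel_measurable_integrable)
  have "integrable lborel (\<lambda>t. exponential_density u t * expectation (\<lambda>\<omega>. f (passage t \<omega>)))"
    using i u by (subst (asm) integrable_real_density) (auto simp: m)
  moreover have "(\<integral>t. exponential_density u t * expectation (\<lambda>\<omega>. f (passage t \<omega>)) \<partial>lborel) = (\<integral>x. exponential_density (\<phi> u) x * f x \<partial>lborel)"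
    using eq u by (subst (asm) integral_real_density) (auto simp: m)
  ultimately show ?thesis by (simp add: has_bochner_integral_iff mult.commute)
qed

text \<open>
  If \<open>x < passage t\<close> then \<open>D x < t\<close>, and this persists for all levels slightly below \<open>t\<close>.
\<close>
lemma passage_left_limit:
  assumes t: "t > 0" and \<omega>: "\<forall>t x. 0 \<le> x \<longrightarrow> (x < passage t \<omega> \<longleftrightarrow> D x \<omega> < t)"
  shows "((\<lambda>s. passage s \<omega>) \<longlongrightarrow> passage t \<omega>) (at_left t)"
proof (rule increasing_tendsto)
  have "passage s \<omega> \<le> passage t \<omega>" if "s < t" for s
  proof (rule ccontr)
    assume "\<not> passage s \<omega> \<le> passage t \<omega>"
    then have "D (passage t \<omega>) \<omega> < s" using \<omega> passage_nonneg by (meson not_le)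
    then have "passage t \<omega> < passage t \<omega>" using that \<omega> passage_nonneg by (meson less_trans)
    then show False by simp
  qed
  then show "\<forall>\<^sub>F s in at_left t. passage s \<omega> \<le> passage t \<omega>"
    by (auto simp: eventually_at_filter)
  fix x assume x: "x < passage t \<omega>"
  show "\<forall>\<^sub>F s in at_left t. x < passage s \<omega>"
  proof (cases "x < 0")
    case True
    then have "x < passage s \<omega>" for s using passage_nonneg[of s \<omega>] by linarith
    then show ?thesis by simp
  next
    case False
    then have "D x \<omega> < t" using x \<omega> by simp
    then have "\<forall>\<^sub>F s in at_left t. D x \<omega> < s" by (rule order_tendstoD(1)[OF tendsto_ident_at])
    then show ?thesis
      by eventually_elim (use False \<omega> in simp)
  qed
qed

lemma expectation_passage_left_continuous:
  fixes f :: "real \<Rightarrow> real"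
  assumes f: "continuous_on UNIV f" and B: "\<And>x. x \<ge> 0 \<Longrightarrow> \<bar>f x\<bar> \<le> B" and t: "t > 0"
  shows "continuous (at_left t) (\<lambda>t. expectation (\<lambda>\<omega>. f (passage t \<omega>)))"
  unfolding continuous_within
proof (rule tendsto_at_left_sequentially[of "t - 1"])
  fix S :: "nat \<Rightarrow> real" assume S: "\<And>n. S n < t" "S \<longlonglongrightarrow> t"
  have m[measurable]: "f \<in> borel_measurable borel" using f by (rule borel_measurable_continuous_onI)
  have S': "filterlim S (at_left t) sequentially"
    using S by (auto simp: filterlim_at less_imp_neq)
  show "(\<lambda>n. expectation (\<lambda>\<omega>. f (passage (S n) \<omega>))) \<longlonglongrightarrow> expectation (\<lambda>\<omega>. f (passage t \<omega>))"
  proof (rule integral_dominated_convergence[where w = "\<lambda>_. B"])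
    show "AE \<omega> in M. (\<lambda>n. f (passage (S n) \<omega>)) \<longlonglongrightarrow> f (passage t \<omega>)"
      using AE_passage_gt_iff
    proof eventually_elim
      case (elim \<omega>)
      have "(\<lambda>n. passage (S n) \<omega>) \<longlonglongrightarrow> passage t \<omega>"
        by (rule filterlim_compose[OF passage_left_limit[OF t elim] S'])
      moreover have "isCont f (passage t \<omega>)"
        using f by (simp add: continuous_on_eq_continuous_at)
      ultimately show ?case by (rule isCont_tendsto_compose[rotated])
    qed
  qed (auto intro!: B passage_nonneg)
qed simp

end

section \<open>Counting processes at an independent random time\<close>

context counting_process
begin

lemma q_at_random_time_discrete:
  assumes J[measurable]: "J \<in> measurable M (count_space (UNIV :: nat set))"
    and c: "\<And>j. c j \<ge> 0"
    and indep: "\<And>j. prob {\<omega> \<in> space M. N (c j) \<omega> = n \<and> J \<omega> = j} = q n (c j) * prob {\<omega> \<in> space M. J \<omega> = j}"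
  shows "{\<omega> \<in> space M. N (c (J \<omega>)) \<omega> = n} \<in> sets M"
    and "prob {\<omega> \<in> space M. N (c (J \<omega>)) \<omega> = n} = expectation (\<lambda>\<omega>. q n (c (J \<omega>)))"
proof -
  let ?E = "\<lambda>j. {\<omega> \<in> space M. N (c j) \<omega> = n \<and> J \<omega> = j}"
  have [measurable]: "N (c j) \<in> measurable M (count_space UNIV)" for j
    using c by simp
  have E: "?E j \<in> sets M" for j by measurable
  have U: "{\<omega> \<in> space M. N (c (J \<omega>)) \<omega> = n} = (\<Union>j. ?E j)" by auto
  show S: "{\<omega> \<in> space M. N (c (J \<omega>)) \<omega> = n} \<in> sets M"
    unfolding U using E by (intro sets.countable_UN) auto
  have "emeasure M (\<Union>j. ?E j) = (\<Sum>j. emeasure M (?E j))"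
    using E by (intro suminf_emeasure[symmetric]) (auto simp: disjoint_family_on_def)
  also have "\<dots> = (\<Sum>j. \<integral>\<^sup>+\<omega>. ennreal (q n (c j)) * indicator {\<omega> \<in> space M. J \<omega> = j} \<omega> \<partial>M)"
    by (intro suminf_cong, subst nn_integral_cmult_indicator)
      (simp_all add: emeasure_eq_measure indep ennreal_mult q_nonneg)
  also have "\<dots> = (\<integral>\<^sup>+\<omega>. (\<Sum>j. ennreal (q n (c j)) * indicator {\<omega> \<in> space M. J \<omega> = j} \<omega>) \<partial>M)"
    by (rule nn_integral_suminf[symmetric]) simp
  also have "\<dots> = (\<integral>\<^sup>+\<omega>. ennreal (q n (c (J \<omega>))) \<partial>M)"
  proof (rule nn_integral_cong)
    fix \<omega> assume "\<omega> \<in> space M"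
    then have "(\<Sum>j. ennreal (q n (c j)) * indicator {\<omega> \<in> space M. J \<omega> = j} \<omega>)
        = (\<Sum>j\<in>{J \<omega>}. ennreal (q n (c j)) * indicator {\<omega> \<in> space M. J \<omega> = j} \<omega>)"
      by (intro suminf_finite) auto
    then show "(\<Sum>j. ennreal (q n (c j)) * indicator {\<omega> \<in> space M. J \<omega> = j} \<omega>) = ennreal (q n (c (J \<omega>)))"
      using \<open>\<omega> \<in> space M\<close> by simp
  qed
  also have "\<dots> = ennreal (expectation (\<lambda>\<omega>. q n (c (J \<omega>))))"
  proof (rule nn_integral_eq_integral)
    have "(\<lambda>\<omega>. q n (c (J \<omega>))) \<in> borel_measurable M" by measurable
    then show "integrable M (\<lambda>\<omega>. q n (c (J \<omega>)))"
      by (intro integrable_const_bound[of _ 1]) (auto simp: q_nonneg q_le_1)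
  qed (simp add: q_nonneg)
  finally show "prob {\<omega> \<in> space M. N (c (J \<omega>)) \<omega> = n} = expectation (\<lambda>\<omega>. q n (c (J \<omega>)))"
    unfolding U[symmetric] emeasure_eq_measure
    by (subst (asm) ennreal_inj) (auto intro!: integral_nonneg_AE simp: q_nonneg)
qed

text \<open>
  Independence of \<open>N\<close> and \<open>T\<close> can be used directly only at countably many times, so \<open>T\<close> is
  replaced by grid points \<open>c m (J m) = (\<lfloor>(m + 1) T\<rfloor> + 1) / (m + 1)\<close>, which lie in
  \<open>(T, T + 1 / (m + 1)]\<close>.  Right-continuous integer-valued paths satisfy
  \<open>N (c m (J m)) = N T\<close> for large \<open>m\<close>.
\<close>

theorem prob_at_independent_time:
  assumes T[measurable]: "T \<in> borel_measurable M" and T0: "\<And>\<omega>. \<omega> \<in> space M \<Longrightarrow> T \<omega> \<ge> 0"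
    and indep: "\<And>s. s \<ge> 0 \<Longrightarrow> indep_var borel (\<lambda>\<omega>. real (N s \<omega>)) borel T"
  shows "prob {\<omega> \<in> space M. N (T \<omega>) \<omega> = n} = expectation (\<lambda>\<omega>. count_prob total_rate k lam n (T \<omega>))"
proof -
  define J where "J m \<omega> = nat \<lfloor>real (Suc m) * T \<omega>\<rfloor>" for m \<omega>
  define c where "c m j = (real j + 1) / real (Suc m)" for m j :: nat
  have c0: "c m j \<ge> 0" for m j by (simp add: c_def)
  have J[measurable]: "J m \<in> measurable M (count_space UNIV)" for m
    unfolding J_def[abs_def] by measurable
  have ind: "prob {\<omega> \<in> space M. N (c m j) \<omega> = n \<and> J m \<omega> = j} = q n (c m j) * prob {\<omega> \<in> space M. J m \<omega> = j}" for m j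
  proof -
    have B: "{x :: real. nat \<lfloor>real (Suc m) * x\<rfloor> = j} \<in> sets borel" by measurable
    have "prob ((\<lambda>\<omega>. (real (N (c m j) \<omega>), T \<omega>)) -` ({real n} \<times> {x. nat \<lfloor>real (Suc m) * x\<rfloor> = j}) \<inter> space M)
      = prob ((\<lambda>\<omega>. real (N (c m j) \<omega>)) -` {real n} \<inter> space M) * prob (T -` {x. nat \<lfloor>real (Suc m) * x\<rfloor> = j} \<inter> space M)"
      by (rule indep_varD[OF indep[OF c0]]) (use B in auto)
    moreover have "(\<lambda>\<omega>. (real (N (c m j) \<omega>), T \<omega>)) -` ({real n} \<times> {x. nat \<lfloor>real (Suc m) * x\<rfloor> = j}) \<inter> space M
        = {\<omega> \<in> space M. N (c m j) \<omega> = n \<and> J m \<omega> = j}"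
      "(\<lambda>\<omega>. real (N (c m j) \<omega>)) -` {real n} \<inter> space M = {\<omega> \<in> space M. N (c m j) \<omega> = n}"
      "T -` {x. nat \<lfloor>real (Suc m) * x\<rfloor> = j} \<inter> space M = {\<omega> \<in> space M. J m \<omega> = j}"
      by (auto simp: J_def)
    ultimately show ?thesis by (simp only: q_def)
  qed
  note disc = q_at_random_time_discrete[OF J c0 ind]
  have c_gt: "T \<omega> < c m (J m \<omega>)" and c_le: "c m (J m \<omega>) \<le> T \<omega> + 1 / real (Suc m)" if "\<omega> \<in> space M" for m \<omega>
  proof -
    have "real (J m \<omega>) = of_int \<lfloor>real (Suc m) * T \<omega>\<rfloor>"
      using T0[OF that] by (simp add: J_def del: of_nat_Suc)
    then have "real (Suc m) * T \<omega> < real (J m \<omega>) + 1" "real (J m \<omega>) \<le> real (Suc m) * T \<omega>"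
      by linarith+
    then show "T \<omega> < c m (J m \<omega>)" "c m (J m \<omega>) \<le> T \<omega> + 1 / real (Suc m)"
      by (simp_all add: c_def field_simps del: of_nat_Suc)
  qed
  have c_lim: "(\<lambda>m. c m (J m \<omega>)) \<longlonglongrightarrow> T \<omega>" if "\<omega> \<in> space M" for \<omega>
  proof (rule tendsto_sandwich[of "\<lambda>_. T \<omega>" _ _ "\<lambda>m. T \<omega> + 1 / real (Suc m)"])
    have "(\<lambda>m. T \<omega> + 1 / real (Suc m)) \<longlonglongrightarrow> T \<omega> + 0"
      by (intro tendsto_add tendsto_const LIMSEQ_Suc lim_1_over_n)
    then show "(\<lambda>m. T \<omega> + 1 / real (Suc m)) \<longlonglongrightarrow> T \<omega>" by simp
  qed (use c_gt[OF that] c_le[OF that] in \<open>auto intro!: always_eventually less_imp_le\<close>)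
  have ev: "\<forall>\<^sub>F m in sequentially. N (c m (J m \<omega>)) \<omega> = N (T \<omega>) \<omega>" if \<omega>: "\<omega> \<in> space M" for \<omega>
  proof -
    have "continuous (at_right (T \<omega>)) (\<lambda>t. N t \<omega>)"
      using gcp T0[OF \<omega>] \<omega> by (simp add: generalized_counting_process_def)
    then have "\<forall>\<^sub>F s in at_right (T \<omega>). N s \<omega> = N (T \<omega>) \<omega>"
      by (simp add: continuous_within tendsto_discrete)
    moreover have "filterlim (\<lambda>m. c m (J m \<omega>)) (at_right (T \<omega>)) sequentially"
      using c_lim[OF \<omega>] c_gt[OF \<omega>] by (auto simp: filterlim_at less_imp_neq[symmetric])
    ultimately show ?thesis by (rule eventually_compose_filterlim)
  qed
  let ?E = "\<lambda>m. {\<omega> \<in> space M. N (c m (J m \<omega>)) \<omega> = n}" and ?E' = "{\<omega> \<in> space M. N (T \<omega>) \<omega> = n}"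
  have Em[measurable]: "?E m \<in> sets M" for m by (rule disc(1))
  have E': "?E' \<in> sets M"
  proof -
    have "?E' = {\<omega> \<in> space M. \<exists>m0. \<forall>m\<ge>m0. \<omega> \<in> ?E m}"
    proof (intro Collect_cong conj_cong refl)
      fix \<omega> assume \<omega>: "\<omega> \<in> space M"
      obtain m1 where "\<And>m. m \<ge> m1 \<Longrightarrow> N (c m (J m \<omega>)) \<omega> = N (T \<omega>) \<omega>"
        using ev[OF \<omega>] by (auto simp: eventually_sequentially)
      then show "(N (T \<omega>) \<omega> = n) = (\<exists>m0. \<forall>m\<ge>m0. \<omega> \<in> ?E m)"
        using \<omega> by simp (metis nat_le_linear)
    qed
    also have "\<dots> \<in> sets M" by measurable
    finally show ?thesis .
  qed
  have "(\<lambda>m. \<integral>\<omega>. indicator (?E m) \<omega> \<partial>M) \<longlonglongrightarrow> (\<integral>\<omega>. indicator ?E' \<omega> \<partial>M :: real)"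
  proof (rule integral_dominated_convergence[where w = "\<lambda>_. 1"])
    show "AE \<omega> in M. (\<lambda>m. indicator (?E m) \<omega> :: real) \<longlonglongrightarrow> indicator ?E' \<omega>"
    proof (rule AE_I2)
      fix \<omega> assume \<omega>: "\<omega> \<in> space M"
      have "\<forall>\<^sub>F m in sequentially. indicator (?E m) \<omega> = (indicator ?E' \<omega> :: real)"
        using ev[OF \<omega>] by eventually_elim (simp add: indicator_def)
      then show "(\<lambda>m. indicator (?E m) \<omega> :: real) \<longlonglongrightarrow> indicator ?E' \<omega>" by (rule tendsto_eventually)
    qed
  qed (use Em E' in \<open>auto simp: indicator_def\<close>)
  then have lim1: "(\<lambda>m. prob (?E m)) \<longlonglongrightarrow> prob ?E'"
    using Em E' by simp
  let ?g = "count_prob total_rate k lam n"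
  have g_cont: "continuous_on UNIV ?g"
    unfolding count_prob_def by (intro continuous_intros) auto
  then have g[measurable]: "?g \<in> borel_measurable borel" by (rule borel_measurable_continuous_onI)
  have g_bd: "\<bar>?g x\<bar> \<le> 1" if "x \<ge> 0" for x
    using q_eq_count_prob[OF that, of n] q_nonneg[of n x] q_le_1[of n x] by simp
  have "(\<lambda>m. expectation (\<lambda>\<omega>. ?g (c m (J m \<omega>)))) \<longlonglongrightarrow> expectation (\<lambda>\<omega>. ?g (T \<omega>))"
  proof (rule integral_dominated_convergence[where w = "\<lambda>_. 1"])
    show "AE \<omega> in M. (\<lambda>m. ?g (c m (J m \<omega>))) \<longlonglongrightarrow> ?g (T \<omega>)"
    proof (rule AE_I2)
      fix \<omega> assume \<omega>: "\<omega> \<in> space M"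
      have "isCont ?g (T \<omega>)" using g_cont by (simp add: continuous_on_eq_continuous_at)
      then show "(\<lambda>m. ?g (c m (J m \<omega>))) \<longlonglongrightarrow> ?g (T \<omega>)" using c_lim[OF \<omega>] by (rule isCont_tendsto_compose)
    qed
  qed (auto intro!: g_bd c0)
  then have "(\<lambda>m. prob (?E m)) \<longlonglongrightarrow> expectation (\<lambda>\<omega>. ?g (T \<omega>))"
    unfolding disc(2) q_eq_count_prob[OF c0] .
  then show ?thesis using LIMSEQ_unique[OF lim1] by simp
qed

end

section \<open>State probabilities at the inverse process\<close>

text \<open>
  The degenerate order \<open>\<beta> = 1\<close>, where \<open>H t = t\<close>, has the same properties as the proper subordinators;
  it occurs for \<open>\<nu> = 1/2\<close>.
\<close>
lemma stable_subordinatorD: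
  assumes M: "prob_space M" and H: "stable_subordinator M \<beta> H"
  shows "t \<ge> 0 \<Longrightarrow> H t \<in> borel_measurable M"
    and "\<omega> \<in> space M \<Longrightarrow> 0 \<le> s \<Longrightarrow> s \<le> t \<Longrightarrow> H s \<omega> \<le> H t \<omega>"
    and "\<omega> \<in> space M \<Longrightarrow> 0 \<le> t \<Longrightarrow> continuous (at_right t) (\<lambda>s. H s \<omega>)"
    and "AE \<omega> in M. H 0 \<omega> = 0"
    and "t \<ge> 0 \<Longrightarrow> u > 0 \<Longrightarrow> (\<integral>\<omega>. exp (- u * H t \<omega>) \<partial>M) = exp (- t * u powr \<beta>)"
proof -
  interpret prob_space M by fact
  have "(t \<ge> 0 \<longrightarrow> H t \<in> borel_measurable M)
    \<and> (\<omega> \<in> space M \<longrightarrow> 0 \<le> s \<longrightarrow> s \<le> t \<longrightarrow> H s \<omega> \<le> H t \<omega>)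
    \<and> (\<omega> \<in> space M \<longrightarrow> 0 \<le> t \<longrightarrow> continuous (at_right t) (\<lambda>s. H s \<omega>))
    \<and> (AE \<omega> in M. H 0 \<omega> = 0)
    \<and> (t \<ge> 0 \<longrightarrow> u > 0 \<longrightarrow> (\<integral>\<omega>. exp (- u * H t \<omega>) \<partial>M) = exp (- t * u powr \<beta>))" for t s u \<omega>
  proof (cases "\<beta> = 1")
    case True
    then have H: "H t \<omega> = t" if "t \<ge> 0" "\<omega> \<in> space M" for t \<omega>
      using H that by (simp add: stable_subordinator_def)
    have "H t \<in> borel_measurable M" if "t \<ge> 0"
      using H[OF that] by (subst measurable_cong[where g = "\<lambda>_. t"]) auto
    moreover have "continuous (at_right t) (\<lambda>s. H s \<omega>)" if "\<omega> \<in> space M" "0 \<le> t"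
    proof -
      have "\<forall>\<^sub>F s in at_right t. s = H s \<omega>"
        using eventually_at_right_less[of t] by eventually_elim (use H that in simp)
      then have "((\<lambda>s. H s \<omega>) \<longlongrightarrow> t) (at_right t)"
        by (rule Lim_transform_eventually[OF tendsto_ident_at])
      then show ?thesis using H that by (simp add: continuous_within)
    qed
    moreover have "(\<integral>\<omega>. exp (- u * H t \<omega>) \<partial>M) = exp (- t * u powr \<beta>)" if "t \<ge> 0" "u > 0"
    proof -
      have "(\<integral>\<omega>. exp (- u * H t \<omega>) \<partial>M) = (\<integral>\<omega>. exp (- u * t) \<partial>M)"
        using H that by (intro Bochner_Integration.integral_cong) auto
      then show ?thesis using True that by (simp add: prob_space mult.commute)
    qed
    ultimately show ?thesis using H by auto
  next
    case False
    then show ?thesis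
      using H unfolding stable_subordinator_def levy_process_def cadlag_on_halfline_def mono_on_def
      by auto
  qed
  then show "t \<ge> 0 \<Longrightarrow> H t \<in> borel_measurable M"
    and "\<omega> \<in> space M \<Longrightarrow> 0 \<le> s \<Longrightarrow> s \<le> t \<Longrightarrow> H s \<omega> \<le> H t \<omega>"
    and "\<omega> \<in> space M \<Longrightarrow> 0 \<le> t \<Longrightarrow> continuous (at_right t) (\<lambda>s. H s \<omega>)"
    and "AE \<omega> in M. H 0 \<omega> = 0"
    and "t \<ge> 0 \<Longrightarrow> u > 0 \<Longrightarrow> (\<integral>\<omega>. exp (- u * H t \<omega>) \<partial>M) = exp (- t * u powr \<beta>)"
    by blast+
qed

lemma independent_processesD:
  assumes "prob_space M" "independent_processes M X Y" "s \<ge> 0" "t \<ge> 0"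
  shows "prob_space.indep_var M borel (X s) borel (Y t)"
proof -
  interpret prob_space M by fact
  have "indep_var borel ((\<lambda>f. f s) \<circ> (\<lambda>\<omega>. \<lambda>t\<in>{0..}. X t \<omega>)) borel ((\<lambda>f. f t) \<circ> (\<lambda>\<omega>. \<lambda>t\<in>{0..}. Y t \<omega>))"
    using assms unfolding independent_processes_def
    by (intro indep_var_compose) (auto intro!: measurable_component_singleton)
  then show ?thesis using assms by (simp add: comp_def)
qed

text \<open>
  The factor \<open>(2 l)\<^bsup>1/\<nu>\<^esup>\<close> in front of \<open>H2\<close> becomes \<open>2 l\<close> in the Laplace exponent.
\<close>
lemma first_passage_stable_mixture:
  assumes M: "prob_space M" and \<nu>: "0 < \<nu>" and l: "l > 0"
    and H1: "stable_subordinator M (2 * \<nu>) H1" and H2: "stable_subordinator M \<nu> H2"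
    and indep: "independent_processes M H1 H2"
  shows "first_passage M (\<lambda>s \<omega>. H1 s \<omega> + (2 * l) powr (1 / \<nu>) * H2 s \<omega>)
    (\<lambda>u. u powr (2 * \<nu>) + 2 * l * u powr \<nu>)"
proof -
  interpret prob_space M by fact
  define c where "c = (2 * l) powr (1 / \<nu>)"
  have c: "c > 0" using l by (simp add: c_def)
  note P1 = stable_subordinatorD[OF M H1] and P2 = stable_subordinatorD[OF M H2]
  have "first_passage M (\<lambda>s \<omega>. H1 s \<omega> + c * H2 s \<omega>) (\<lambda>u. u powr (2 * \<nu>) + 2 * l * u powr \<nu>)"
  proof
    fix s :: real assume s: "s \<ge> 0"
    note [measurable] = P1(1)[OF s] P2(1)[OF s]
    show "(\<lambda>\<omega>. H1 s \<omega> + c * H2 s \<omega>) \<in> borel_measurable M" by measurable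
  next
    fix \<omega> s t assume "\<omega> \<in> space M" "0 \<le> (s::real)" "s \<le> t"
    then show "H1 s \<omega> + c * H2 s \<omega> \<le> H1 t \<omega> + c * H2 t \<omega>"
      using P1(2)[of \<omega> s t] P2(2)[of \<omega> s t] c by (intro add_mono mult_left_mono) auto
  next
    fix \<omega> s assume "\<omega> \<in> space M" "0 \<le> (s::real)"
    then show "continuous (at_right s) (\<lambda>s. H1 s \<omega> + c * H2 s \<omega>)"
      by (intro continuous_intros P1(3) P2(3))
  next
    show "AE \<omega> in M. H1 0 \<omega> + c * H2 0 \<omega> = 0"
      using P1(4) P2(4) by eventually_elim simp
  next
    fix s u :: real assume s: "s \<ge> 0" and u: "u > 0"
    have uc: "u * c > 0" using u c by simp
    have i: "integrable M f" if "(\<integral>\<omega>. f \<omega> \<partial>M) = exp y" for f :: "'a \<Rightarrow> real" and y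
      using that not_integrable_integral_eq by fastforce
    have "indep_var borel ((\<lambda>x. exp (- u * x)) \<circ> H1 s) borel ((\<lambda>x. exp (- (u * c) * x)) \<circ> H2 s)"
      by (rule indep_var_compose[OF independent_processesD[OF M indep s s]]) measurable
    then have "(\<integral>\<omega>. exp (- u * H1 s \<omega>) * exp (- (u * c) * H2 s \<omega>) \<partial>M)
      = (\<integral>\<omega>. exp (- u * H1 s \<omega>) \<partial>M) * (\<integral>\<omega>. exp (- (u * c) * H2 s \<omega>) \<partial>M)"
      unfolding comp_def
      by (rule indep_var_lebesgue_integral) (rule i[OF P1(5)[OF s u]], rule i[OF P2(5)[OF s uc]])
    also have "\<dots> = exp (- s * u powr (2 * \<nu>)) * exp (- s * (u * c) powr \<nu>)"
      unfolding P1(5)[OF s u] P2(5)[OF s uc] ..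
    also have "(u * c) powr \<nu> = u powr \<nu> * (2 * l)"
      using u c l \<nu> by (simp add: powr_mult c_def powr_powr)
    finally show "(\<integral>\<omega>. exp (- u * (H1 s \<omega> + c * H2 s \<omega>)) \<partial>M) = exp (- s * (u powr (2 * \<nu>) + 2 * l * u powr \<nu>))"
      by (simp add: exp_add[symmetric] algebra_simps)
  next
    fix u :: real assume "u > 0"
    then show "u powr (2 * \<nu>) + 2 * l * u powr \<nu> > 0" using l by (intro add_pos_pos) auto
  qed
  then show ?thesis by (simp add: c_def)
qed

lemma exponential_density_moment_integral:
  assumes \<phi>: "\<phi> > 0" and \<Lambda>: "\<Lambda> > 0"
  shows "(\<integral>x. exponential_density \<phi> x * (exp (- \<Lambda> * x) * x ^ r / fact r) \<partial>lborel) = \<phi> / (\<phi> + \<Lambda>) ^ Suc r"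
proof -
  have p: "\<phi> + \<Lambda> > 0" using assms by simp
  have "(\<integral>\<^sup>+x. ennreal (erlang_density r (\<phi> + \<Lambda>) x) \<partial>lborel) = ennreal 1"
    using nn_integral_erlang_ith_moment[OF p, of r 0] by simp
  then have one: "(\<integral>x. erlang_density r (\<phi> + \<Lambda>) x \<partial>lborel) = 1"
    using p by (subst (asm) nn_integral_eq_integrable) auto
  have "exponential_density \<phi> x * (exp (- \<Lambda> * x) * x ^ r / fact r)
      = \<phi> / (\<phi> + \<Lambda>) ^ Suc r * erlang_density r (\<phi> + \<Lambda>) x" for x
  proof -
    have e: "exp (- (\<phi> + \<Lambda>) * x) = exp (- x * \<phi>) * exp (- \<Lambda> * x)"
      by (simp add: exp_add[symmetric] algebra_simps)
    have assoc: "\<phi> * a * (b * y / z) = \<phi> / d * (d * y * (a * b) / z)" if "d \<noteq> 0" for a b y z d :: real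
      using that by (simp add: field_simps)
    have d: "(\<phi> + \<Lambda>) ^ Suc r \<noteq> 0" using p by simp
    show ?thesis
    proof (cases "x < 0")
      case False
      then show ?thesis
        unfolding erlang_density_def[of r] exponential_density_def e
        by (simp only: if_False) (rule assoc[OF d])
    qed (simp add: erlang_density_def)
  qed
  then show ?thesis using one by (simp del: power_Suc)
qed

lemma pow_over_fact_le_exp: "x \<ge> 0 \<Longrightarrow> x ^ r / fact r \<le> exp x" for x :: real
proof -
  assume x: "x \<ge> 0"
  have "(\<Sum>n\<in>{r}. x ^ n / fact n) \<le> (\<Sum>n. x ^ n / fact n)"
    using x summable_exp[of x] by (intro sum_le_suminf) (auto simp: field_simps)
  then show ?thesis by (simp add: exp_def scaleR_conv_of_real field_simps)
qed

lemma exp_moment_bound: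
  fixes \<Lambda> x :: real
  assumes \<Lambda>: "\<Lambda> > 0" and x: "x \<ge> 0"
  shows "\<bar>exp (- \<Lambda> * x) * x ^ r / fact r\<bar> \<le> 1 / \<Lambda> ^ r"
proof -
  have "(\<Lambda> * x) ^ r / fact r \<le> exp (\<Lambda> * x)" using assms by (intro pow_over_fact_le_exp) auto
  then have "exp (- (\<Lambda> * x)) * ((\<Lambda> * x) ^ r / fact r) \<le> exp (- (\<Lambda> * x)) * exp (\<Lambda> * x)"
    by (intro mult_left_mono) auto
  then have "\<Lambda> ^ r * (exp (- \<Lambda> * x) * x ^ r / fact r) \<le> 1"
    by (simp add: power_mult_distrib mult_ac exp_add[symmetric])
  moreover have "exp (- \<Lambda> * x) * x ^ r / fact r \<ge> 0" using x by simp
  ultimately show ?thesis using \<Lambda> by (simp add: field_simps)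
qed
text \<open>
  For \<open>t > 0\<close> both sides have the same Laplace transform for all rates \<open>u\<close> so large that
  \<open>u\<^bsup>- \<nu>\<^esup>\<close> lies within the radius of convergence, and both are left-continuous.  At \<open>t = 0\<close> the passage
  time vanishes almost surely.
\<close>
lemma passage_moment:
  assumes fp: "first_passage M D (\<lambda>u. u powr (2 * \<nu>) + 2 * l * u powr \<nu>)"
    and \<nu>: "0 < \<nu>" and l: "l > 0" and \<Lambda>: "\<Lambda> > 0" and t: "t \<ge> 0"
  shows "(\<integral>\<omega>. exp (- \<Lambda> * first_passage.passage D t \<omega>) * first_passage.passage D t \<omega> ^ r / fact r \<partial>M)
    = frac_series \<nu> (moment_fps l \<Lambda> r) t"
proof -
  interpret first_passage M D "\<lambda>u. u powr (2 * \<nu>) + 2 * l * u powr \<nu>" by fact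
  define f where "f x = exp (- \<Lambda> * x) * x ^ r / fact r" for x
  define e where "e t = expectation (\<lambda>\<omega>. f (passage t \<omega>))" for t
  let ?A = "moment_fps l \<Lambda> r"
  have A: "fps_conv_radius ?A > 0" by (rule fps_conv_radius_moment_fps)
  have fc: "continuous_on UNIV f" unfolding f_def by (intro continuous_intros) auto
  then have fm[measurable]: "f \<in> borel_measurable borel" by (rule borel_measurable_continuous_onI)
  have fb: "\<bar>f x\<bar> \<le> 1 / \<Lambda> ^ r" if "x \<ge> 0" for x
    unfolding f_def by (rule exp_moment_bound[OF \<Lambda> that])
  have "e t = frac_series \<nu> ?A t"
  proof (cases "t = 0")
    case True
    have "e 0 = (\<integral>\<omega>. f 0 \<partial>M)"
      unfolding e_def using AE_passage_0 by (intro integral_cong_AE) auto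
    also have "\<dots> = (if r = 0 then 1 else 0)" by (simp add: f_def prob_space)
    also have "\<dots> = fps_nth ?A 0"
      by (cases r) (simp_all add: moment_fps_def fps_mult_nth_0 power_mult)
    finally show ?thesis using True by (simp add: frac_series_0[OF \<nu> A])
  next
    case False
    with t have t: "t > 0" by simp
    obtain \<rho> where \<rho>: "0 < \<rho>" "ereal \<rho> < fps_conv_radius ?A"
      using ereal_dense2[OF A] by (auto simp: zero_ereal_def)
    define u0 where "u0 = \<rho> powr (- 1 / \<nu>)"
    have u0: "u0 > 0" using \<rho> by (simp add: u0_def)
    have "e t - frac_series \<nu> ?A t = 0"
    proof (rule laplace_unique_left_continuous[OF u0 _ t])
      fix u assume uu: "u0 \<le> u"
      then have u: "u > 0" using u0 by simp
      have "u powr (- \<nu>) \<le> u0 powr (- \<nu>)"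
        using uu u0 \<nu> by (intro powr_mono2') auto
      also have "\<dots> = \<rho>" using \<rho> \<nu> by (simp add: u0_def powr_powr)
      finally have R: "ereal (u powr (- \<nu>)) < fps_conv_radius ?A"
        using \<rho> by (meson ereal_less_eq(3) le_less_trans)
      let ?\<phi> = "u powr (2 * \<nu>) + 2 * l * u powr \<nu>"
      have "has_bochner_integral lborel (\<lambda>t. e t * exponential_density u t) (\<integral>x. exponential_density ?\<phi> x * f x \<partial>lborel)"
        unfolding e_def by (rule passage_exponential_time_expectation[OF u fm fb])
      also have "(\<integral>x. exponential_density ?\<phi> x * f x \<partial>lborel) = ?\<phi> / (?\<phi> + \<Lambda>) ^ Suc r"
        unfolding f_def by (rule exponential_density_moment_integral[OF \<phi>_pos[OF u] \<Lambda>])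
      also have "\<dots> = eval_fps ?A (u powr (- \<nu>))"
        using eval_moment_fps[OF u l _ R] \<Lambda> by simp
      finally have "has_bochner_integral lborel
          (\<lambda>t. e t * exponential_density u t - frac_series \<nu> ?A t * exponential_density u t)
          (eval_fps ?A (u powr (- \<nu>)) - eval_fps ?A (u powr (- \<nu>)))"
        by (intro has_bochner_integral_diff frac_series_laplace[OF \<nu> R u])
      then show "has_bochner_integral lborel (\<lambda>t. (e t - frac_series \<nu> ?A t) * exponential_density u t) 0"
        by (simp add: left_diff_distrib)
    next
      have "isCont (frac_series \<nu> ?A) t"
        using frac_series_has_derivative(1)[OF \<nu> A t] by (rule DERIV_isCont)
      then have "continuous (at_left t) (frac_series \<nu> ?A)"
        by (rule continuous_at_imp_continuous_at_within)
      then show "continuous (at_left t) (\<lambda>t. e t - frac_series \<nu> ?A t)"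
        unfolding e_def by (intro continuous_intros expectation_passage_left_continuous[OF fc fb t])
    qed
    then show ?thesis by simp
  qed
  then show ?thesis by (simp add: e_def f_def)
qed

lemma state_probability:
  assumes M: "prob_space M" and \<nu>: "0 < \<nu>" and l: "l > 0" and k: "k \<ge> 1"
    and lam: "\<And>i. i \<in> {1..k} \<Longrightarrow> lam i > 0" and \<Lambda>: "\<Lambda> = (\<Sum>i=1..k. lam i)"
    and N: "generalized_counting_process M k lam N"
    and H1: "stable_subordinator M (2 * \<nu>) H1" and H2: "stable_subordinator M \<nu> H2"
    and H12: "independent_processes M H1 H2" and L: "L = inverse_process \<nu> l H1 H2"
    and NL: "independent_processes M (\<lambda>t \<omega>. real (N t \<omega>)) L" and t: "t \<ge> 0"
  shows "measure M {\<omega> \<in> space M. N (L t \<omega>) \<omega> = n} = frac_series \<nu> (state_fps l \<Lambda> k lam n) t"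
proof -
  have \<Lambda>0: "\<Lambda> > 0"
    unfolding \<Lambda> using k lam by (intro sum_pos) auto
  define D where "D s \<omega> = H1 s \<omega> + (2 * l) powr (1 / \<nu>) * H2 s \<omega>" for s \<omega>
  have fp: "first_passage M D (\<lambda>u. u powr (2 * \<nu>) + 2 * l * u powr \<nu>)"
    using first_passage_stable_mixture[OF M \<nu> l H1 H2 H12] by (simp add: D_def[abs_def])
  interpret first_passage M D "\<lambda>u. u powr (2 * \<nu>) + 2 * l * u powr \<nu>" by fact
  interpret C: counting_process M k lam N
    by unfold_locales (rule N)
  have Lp: "L s = passage s" for s
    by (simp add: L fun_eq_iff inverse_process_def passage_def D_def)
  have rate: "C.total_rate = \<Lambda>" by (simp add: C.total_rate_def \<Lambda>)
  have int: "integrable M (\<lambda>\<omega>. exp (- \<Lambda> * passage t \<omega>) * passage t \<omega> ^ r / fact r)" for r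
    by (rule integrable_const_bound[of _ "1 / \<Lambda> ^ r"])
      (use exp_moment_bound[OF \<Lambda>0 passage_nonneg] in auto)
  have "measure M {\<omega> \<in> space M. N (L t \<omega>) \<omega> = n} = expectation (\<lambda>\<omega>. count_prob \<Lambda> k lam n (passage t \<omega>))"
    unfolding Lp rate[symmetric]
  proof (rule C.prob_at_independent_time)
    show "indep_var borel (\<lambda>\<omega>. real (N s \<omega>)) borel (passage t)" if "s \<ge> 0" for s
      using independent_processesD[OF M NL that t] by (simp add: Lp)
  qed (auto simp: passage_nonneg)
  also have "\<dots> = expectation (\<lambda>\<omega>. \<Sum>r=0..n. jump_weight k lam r n * (exp (- \<Lambda> * passage t \<omega>) * passage t \<omega> ^ r / fact r))"
    by (simp add: count_prob_def sum_distrib_left mult_ac)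
  also have "\<dots> = (\<Sum>r=0..n. jump_weight k lam r n * expectation (\<lambda>\<omega>. exp (- \<Lambda> * passage t \<omega>) * passage t \<omega> ^ r / fact r))"
    by (subst Bochner_Integration.integral_sum) (rule integrable_mult_right[OF int], simp only: integral_mult_right_zero)
  also have "\<dots> = (\<Sum>r=0..n. jump_weight k lam r n * frac_series \<nu> (moment_fps l \<Lambda> r) t)"
    by (simp only: passage_moment[OF fp \<nu> l \<Lambda>0 t])
  also have "\<dots> = frac_series \<nu> (state_fps l \<Lambda> k lam n) t"
    by (rule frac_series_state_fps[OF \<nu>, symmetric])
  finally show ?thesis .
qed

lemma frac_series_state_fps_governing:
  assumes \<nu>: "0 < \<nu>"
  shows "frac_series \<nu> (fps_shift 2 (state_fps l \<Lambda> k lam n)) t + 2 * l * frac_series \<nu> (fps_shift 1 (state_fps l \<Lambda> k lam n)) t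
    = - \<Lambda> * frac_series \<nu> (state_fps l \<Lambda> k lam n) t
      + (\<Sum>j=1..min n k. lam j * frac_series \<nu> (state_fps l \<Lambda> k lam (n - j)) t)"
proof -
  let ?P = "state_fps l \<Lambda> k lam"
  have R: "fps_conv_radius (?P m) > 0" "fps_conv_radius (fps_shift i (?P m)) > 0" for m i
    using fps_conv_radius_state_fps[of l \<Lambda> k lam m] by simp_all
  have "frac_series \<nu> (fps_shift 2 (?P n) + fps_const (2 * l) * fps_shift 1 (?P n)) t
    = frac_series \<nu> ((\<Sum>j=1..min n k. fps_const (lam j) * ?P (n - j)) + fps_const (- \<Lambda>) * ?P n) t"
    unfolding state_fps_governing by (simp add: algebra_simps flip: fps_const_neg)
  then show ?thesis
    using R by (simp add: frac_series_add_cmult[OF \<nu>] frac_series_sum_cmult[OF \<nu>]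
        fps_conv_radius_sum_pos fps_conv_radius_mult_pos)
qed

theorem theorem10:
  fixes M :: "'a measure"
    and \<nu> l :: real
    and k :: nat
    and lam :: "nat \<Rightarrow> real"
    and N :: "real \<Rightarrow> 'a \<Rightarrow> nat"
    and H1 H2 L :: "real \<Rightarrow> 'a \<Rightarrow> real"
    and \<Lambda> :: real
    and p :: "nat \<Rightarrow> real \<Rightarrow> real"
  assumes "prob_space M"
    and "0 < \<nu>" and "\<nu> \<le> 1 / 2"
    and "l > 0"
    and "k \<ge> 1"
    and "\<And>i. i \<in> {1..k} \<Longrightarrow> lam i > 0"
    and "\<Lambda> = (\<Sum>i=1..k. lam i)"
    and "generalized_counting_process M k lam N"
    and "stable_subordinator M (2 * \<nu>) H1"
    and "stable_subordinator M \<nu> H2"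
    and "independent_processes M H1 H2"
    and "L = inverse_process \<nu> l H1 H2"
    and "independent_processes M (\<lambda>t \<omega>. real (N t \<omega>)) L"
    and "\<And>n t. p n t = measure M {\<omega> \<in> space M. N (L t \<omega>) \<omega> = n}"
  shows "(\<forall>n. \<forall>t>0.
            caputo_differentiable (2 * \<nu>) (p n) t \<and>
            caputo_differentiable \<nu> (p n) t \<and>
            caputo_deriv (2 * \<nu>) (p n) t + 2 * l * caputo_deriv \<nu> (p n) t
              = - \<Lambda> * p n t + (\<Sum>j=1..min n k. lam j * p (n - j) t))
       \<and> p 0 0 = 1 \<and> (\<forall>n\<ge>1. p n 0 = 0)
       \<and> (l = sqrt \<Lambda> \<longrightarrow> (\<forall>n. \<forall>t\<ge>0. p n t = closed_form_critical \<nu> k lam n t))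
       \<and> (l > sqrt \<Lambda> \<longrightarrow> (\<forall>n. \<forall>t\<ge>0. p n t = closed_form_supercritical \<nu> l k lam n t))"
  proof -
  interpret prob_space M by fact
  have \<Lambda>_pos: "\<Lambda> > 0"
    unfolding assms(7) using assms(5,6) by (intro sum_pos) auto
  let ?P = "state_fps l \<Lambda> k lam"
  have p: "p n t = frac_series \<nu> (?P n) t" if "t \<ge> 0" for n t
    unfolding assms(14) using state_probability[OF assms(1,2,4-13) that] .
  have R: "fps_conv_radius (?P n) > 0" for n by (rule fps_conv_radius_state_fps)
  have "caputo_differentiable (2 * \<nu>) (p n) t \<and> caputo_differentiable \<nu> (p n) t \<and>
      caputo_deriv (2 * \<nu>) (p n) t + 2 * l * caputo_deriv \<nu> (p n) t
        = - \<Lambda> * p n t + (\<Sum>j=1..min n k. lam j * p (n - j) t)" if t: "t > 0" for n t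
  proof -
    have gap: "fps_nth (?P n) i = 0" if "0 < i" "i < 2" for i
      using that state_fps_low_coeffs(2)[of l \<Lambda> k lam n] by (cases "i = 1") auto
    note two = caputo_differentiable_frac_series[OF assms(2) R p, of 2]
      caputo_deriv_frac_series[OF assms(2) R p, of 2]
    note one = caputo_differentiable_frac_series[OF assms(2) R p, of 1]
      caputo_deriv_frac_series[OF assms(2) R p, of 1]
    show ?thesis
      using two(1)[of n t] two(2)[of n t] one(1)[of n t] one(2)[of n t] gap t assms(2,3)
        frac_series_state_fps_governing[OF assms(2), of l \<Lambda> k lam n t]
      by (simp add: p)
  qed
  moreover have "p n 0 = (if n = 0 then 1 else 0)" for n
    using state_fps_low_coeffs(1)[of l \<Lambda> k lam n] by (simp add: p frac_series_0[OF assms(2) R])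
  moreover have "p n t = closed_form_critical \<nu> k lam n t" if "l = sqrt \<Lambda>" "t \<ge> 0" for n t
    using closed_form_critical_eq[OF assms(2,7) that(1)] \<Lambda>_pos p[OF that(2)] by simp
  moreover have "p n t = closed_form_supercritical \<nu> l k lam n t" if "l > sqrt \<Lambda>" "t \<ge> 0" for n t
    using closed_form_supercritical_eq[OF assms(2,7) that(1)] \<Lambda>_pos p[OF that(2)] by simp
  ultimately show ?thesis by simp
qed

end
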